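(* Let $Y=\{(x,y)\in\mathbb{R}^2:(x/a)^2+y^2=1\}$ with $1<a\le\sqrt2$ and Euclidean metric, and let $r_1=\frac{4\sqrt{3}a}{a^2+3}<r<r_2=\frac{4\sqrt{3}a^2}{3a^2+1}$. Then there is $\epsilon>0$ such that for every finite $\epsilon$-dense subset $X\subseteq Y$, the cyclic graph $\mathrm{VR}(X;r)$ has winding fraction $\frac13$ and at least two periodic orbits of length three; hence $\mathrm{VR}(X;r)\simeq\bigvee^k S^2$ for some $k\ge1$ (for either choice $\mathrm{VR}_<$ or $\mathrm{VR}_\le$).
   Context: $\mathrm{VR}_<(X;r)$ (resp. $\mathrm{VR}_\le(X;r)$) is the Vietoris–Rips complex: vertex set $X$, simplices the finite subsets of diameter $<r$ (resp. $\le r$); $\mathrm{VR}(X;r)$ denotes either, and also its 1-skeleton as a directed graph. Orient $Y$ clockwise and identify it with the circle $S^1=\mathbb{R}/\mathbb{Z}$ via an orientation-preserving homeomorphism; write $(p,q)_Y$, $(p,q]_Y$, $[p,q]_Y$ for clockwise arcs. For $p\in Y$ let $h^{-1}(p)$ be the point of $Y$ farthest from $p$, and for $0<r<2$ let $g_r(p)$ be the unique point $q\in[p,h^{-1}(p)]_Y$ with $d(p,q)=r$. Edges are oriented $p\to p'$ when $p'\in(p,g_r(p))_Y$ (resp. $(p,g_r(p)]_Y$). For a finite directed graph of this type, the dynamics $f$ sends $v$ to the clockwise-most vertex of $\{v\}\cup\{w:v\to w\}$; periodic vertices, periodic orbits and their lengths are defined via $f^i(v)=v$. The winding fraction of a finite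 cyclic graph $G$ is $\sup\{k/n:\exists$ cyclic homomorphism $C_n^k\to G\}$ where $C_n^k$ ($0\le k<n/2$) has vertices $0,\dots,n-1$ and edges $i\to i+s\bmod n$, $1\le s\le k$; a cyclic homomorphism is a directed-graph homomorphism (edges map to edges or collapse) that weakly preserves cyclic order and is non-constant when the domain has a directed cycle. $X$ is $\epsilon$-dense if every point of $Y$ is within Euclidean distance $\epsilon$ of $X$. *)

theory Defs
  imports "HOL-Analysis.Analysis"
begin

type_synonym pt = "real \<times> real"

definition ellipse :: "real \<Rightarrow> pt set" where
  "ellipse a = {(x, y). (x / a)\<^sup>2 + y\<^sup>2 = 1}"

text \<open>Clockwise parametrisation of Y by R/Z (orientation-preserving identification with S^1).\<close>
definition ellpt :: "real \<Rightarrow> real \<Rightarrow> pt" where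
  "ellpt a t = (a * cos (2 * pi * t), - sin (2 * pi * t))"

definition ang :: "real \<Rightarrow> pt \<Rightarrow> real" where
  "ang a p = (THE t. 0 \<le> t \<and> t < 1 \<and> ellpt a t = p)"

definition cw :: "real \<Rightarrow> pt \<Rightarrow> pt \<Rightarrow> real" where
  "cw a p q = frac (ang a q - ang a p)"

definition arc_oo :: "real \<Rightarrow> pt \<Rightarrow> pt \<Rightarrow> pt set" where
  "arc_oo a p q = {z \<in> ellipse a. 0 < cw a p z \<and> cw a p z < cw a p q}"
definition arc_oc :: "real \<Rightarrow> pt \<Rightarrow> pt \<Rightarrow> pt set" where
  "arc_oc a p q = {z \<in> ellipse a. 0 < cw a p z \<and> cw a p z \<le> cw a p q}"
definition arc_cc :: "real \<Rightarrow> pt \<Rightarrow> pt \<Rightarrow> pt set" where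
  "arc_cc a p q = {z \<in> ellipse a. cw a p z \<le> cw a p q}"

definition cyc_order :: "real \<Rightarrow> pt \<Rightarrow> pt \<Rightarrow> pt \<Rightarrow> bool" where
  "cyc_order a p q z \<longleftrightarrow> 0 < cw a p q \<and> cw a p q < cw a p z"

definition farthest :: "real \<Rightarrow> pt \<Rightarrow> pt" where
  "farthest a p = (THE q. q \<in> ellipse a \<and> (\<forall>z \<in> ellipse a. dist p z \<le> dist p q))"

definition gmap :: "real \<Rightarrow> real \<Rightarrow> pt \<Rightarrow> pt" where
  "gmap a r p = (THE q. q \<in> arc_cc a p (farthest a p) \<and> dist p q = r)"

definition vr_edge :: "real \<Rightarrow> bool \<Rightarrow> pt set \<Rightarrow> real \<Rightarrow> pt \<Rightarrow> pt \<Rightarrow> bool" where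
  "vr_edge a strict X r p q \<longleftrightarrow> p \<in> X \<and> q \<in> X \<and>
     q \<in> (if strict then arc_oo a p (gmap a r p) else arc_oc a p (gmap a r p))"

definition vr_dyn :: "real \<Rightarrow> bool \<Rightarrow> pt set \<Rightarrow> real \<Rightarrow> pt \<Rightarrow> pt" where
  "vr_dyn a strict X r v = (let N = insert v {w. vr_edge a strict X r v w} in
     (THE w. w \<in> N \<and> (\<forall>u \<in> N. cw a v u \<le> cw a v w)))"

definition orbit_of :: "(pt \<Rightarrow> pt) \<Rightarrow> pt \<Rightarrow> pt set" where
  "orbit_of f v = {(f ^^ i) v | i. True}"

definition periodic3 :: "(pt \<Rightarrow> pt) \<Rightarrow> pt \<Rightarrow> bool" where
  "periodic3 f v \<longleftrightarrow> (f ^^ 3) v = v \<and> (f ^^ 1) v \<noteq> v \<and> (f ^^ 2) v \<noteq> v"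

text \<open>Cyclic homomorphism C_n^k -> VR(X;r) (vertices 0..n-1 of C_n^k in clockwise order).\<close>
definition cyclic_hom :: "real \<Rightarrow> bool \<Rightarrow> pt set \<Rightarrow> real \<Rightarrow> nat \<Rightarrow> nat \<Rightarrow> (nat \<Rightarrow> pt) \<Rightarrow> bool" where
  "cyclic_hom a strict X r n k h \<longleftrightarrow>
     (\<forall>i < n. h i \<in> X) \<and>
     (\<forall>i < n. \<forall>s \<in> {1..k}. h i = h ((i + s) mod n) \<or> vr_edge a strict X r (h i) (h ((i + s) mod n))) \<and>
     (\<forall>i j l. i < j \<and> j < l \<and> l < n \<and> h i \<noteq> h j \<and> h j \<noteq> h l \<and> h i \<noteq> h l
         \<longrightarrow> cyc_order a (h i) (h j) (h l)) \<and>
     (1 \<le> k \<longrightarrow> (\<exists>i < n. h i \<noteq> h 0))"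

definition winding_fraction :: "real \<Rightarrow> bool \<Rightarrow> pt set \<Rightarrow> real \<Rightarrow> real" where
  "winding_fraction a strict X r =
     Sup {real k / real n | n k. 2 * k < n \<and> (\<exists>h. cyclic_hom a strict X r n k h)}"

definition vr_simplices :: "bool \<Rightarrow> pt set \<Rightarrow> real \<Rightarrow> pt set set" where
  "vr_simplices strict X r = {\<sigma>. \<sigma> \<subseteq> X \<and> finite \<sigma> \<and> \<sigma> \<noteq> {} \<and>
      (\<forall>x \<in> \<sigma>. \<forall>y \<in> \<sigma>. if strict then dist x y < r else dist x y \<le> r)}"

text \<open>Geometric realisation of a simplicial complex K on a finite vertex set V,
  as barycentric-coordinate functions inside the product space R^V.\<close>
definition geom_real :: "'v set \<Rightarrow> 'v set set \<Rightarrow> ('v \<Rightarrow> real) topology" where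
  "geom_real V K = subtopology (product_topology (\<lambda>_. euclideanreal) V)
     {f \<in> topspace (product_topology (\<lambda>_. euclideanreal) V).
        (\<forall>v \<in> V. 0 \<le> f v) \<and> sum f V = 1 \<and> {v \<in> V. f v \<noteq> 0} \<in> K}"

text \<open>Wedge of k 2-spheres: k internally tangent round spheres in R^3 meeting only at the origin.\<close>
definition wedge_S2 :: "nat \<Rightarrow> (real \<times> real \<times> real) topology" where
  "wedge_S2 k = subtopology euclidean (\<Union>i \<in> {1..k}. sphere (real i, 0, 0) (real i))"

definition eps_dense :: "real \<Rightarrow> real \<Rightarrow> pt set \<Rightarrow> bool" where
  "eps_dense a \<epsilon> X \<longleftrightarrow> (\<forall>y \<in> ellipse a. \<exists>x \<in> X. dist y x \<le> \<epsilon>)"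

end

(* The dynamics lift to a monotone map F of the line commuting with the unit shift. For a sufficiently
   dense sample, F follows the two smallest inscribed equilateral triangles (side r1 < r) and cannot
   overtake the two largest ones (side r2 > r), whose vertices alternate with those of the smallest.
   This traps two different orbits with F^3 = id + 1, and one such orbit already pins the winding
   fraction to 1/3.

   For the homotopy type, a vertex outside the image of the dynamics is dominated by its clockwise
   successor, so it can be removed without changing the dynamics elsewhere. What remains is a disjoint
   union of P periodic orbits of length three. It is cut into three blocks permuted by F; the simplices
   missing a block form a band around the circle, and the other simplices are the P triangles spanned
   by the orbits. The band together with one of the triangles is contractible, and collapsing it leaves
   P - 1 two-spheres. *)

theory Submission
  imports Defs
begin

section \<open>Geometric realisations\<close>

text \<open>The combinatorial part rests on one geometric fact: under an arc of less than half a
  turn whose chord is shorter than the minor axis 2, no subarc has a longer chord. The bound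
  \<open>a\<^sup>2 \<le> 2\<close> gives this, and it also gives r2 \<le> 2, so every admissible
  \<open>r\<close> lies in that range. Nesting makes the lifted dynamics monotone for the strict and
  the non-strict relation alike; a triangle with short sides then bounds orbits from below, and one
  with long sides bounds them from above. The obstacle in contracting the band is that adjacency
  between neighbouring blocks is one-sided: a vertex of index 0 is joined to all of the preceding
  block, but only to index 0 of the following one. Weight can therefore move to index 0 in a block
  only after it has moved in the next block, or if the next block carries little weight. Cutting off
  small block masses gives the room for this. The contraction extends over the other triangles by
  dilation and radial projection, and the quotient is realised by an explicit map onto tangent
  spheres.\<close>

definition down_closed :: "'v set set \<Rightarrow> bool" where
  "down_closed K \<longleftrightarrow> (\<forall>\<sigma>\<in>K. \<forall>\<tau>. \<tau> \<subseteq> \<sigma> \<and> \<tau> \<noteq> {} \<longrightarrow> \<tau> \<in> K)"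

definition supp :: "'v set \<Rightarrow> ('v \<Rightarrow> real) \<Rightarrow> 'v set" where
  "supp V f = {v \<in> V. f v \<noteq> 0}"

lemma supp_nonempty: "sum f V = 1 \<Longrightarrow> supp V f \<noteq> {}"
  by (rule notI, subst (asm) sum.neutral) (auto simp: supp_def)

lemma topspace_geom_real:
  "topspace (geom_real V K) =
     {f \<in> extensional V. (\<forall>v\<in>V. 0 \<le> f v) \<and> sum f V = 1 \<and> supp V f \<in> K}"
  by (auto simp: geom_real_def supp_def PiE_def)

lemma continuous_map_coord:
  assumes "v \<in> V"
  shows "continuous_map (geom_real V K) euclideanreal (\<lambda>f. f v)"
  unfolding geom_real_def
  by (intro continuous_map_from_subtopology continuous_map_product_projection assms)

lemma continuous_map_into_geom_real:
  "continuous_map S (geom_real V K) g \<longleftrightarrow>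
     (\<forall>x\<in>topspace S. g x \<in> topspace (geom_real V K)) \<and>
     (\<forall>v\<in>V. continuous_map S euclideanreal (\<lambda>x. g x v))"
  (is "?l \<longleftrightarrow> ?r")
proof
  assume l: ?l
  show ?r
  proof (intro conjI ballI)
    fix x assume "x \<in> topspace S"
    then show "g x \<in> topspace (geom_real V K)"
      using continuous_map_funspace[OF l] by (rule funcset_mem[rotated])
  next
    fix v assume "v \<in> V"
    from continuous_map_compose[OF l continuous_map_coord[OF this]]
    show "continuous_map S euclideanreal (\<lambda>x. g x v)" unfolding o_def .
  qed
next
  assume r: ?r
  have "continuous_map S (product_topology (\<lambda>_. euclideanreal) V) g"
    unfolding continuous_map_componentwise
    using r by (auto simp: topspace_geom_real)
  then show ?l
    unfolding geom_real_def continuous_map_in_subtopology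
    using r by (auto simp: geom_real_def)
qed

lemma geom_real_eq_subtopology:
  "geom_real V K = subtopology (product_topology (\<lambda>_. euclideanreal) V) (topspace (geom_real V K))"
  unfolding geom_real_def by (simp only: topspace_subtopology subtopology_restrict)

lemma geom_real_subcomplex:
  assumes "K' \<subseteq> K"
  shows "geom_real V K' = subtopology (geom_real V K) (topspace (geom_real V K'))"
  using assms unfolding geom_real_def subtopology_subtopology
  by (intro arg_cong2[where f = subtopology] refl) auto

text \<open>A point with coordinate sum 1 has non-empty support, so closure under faces reduces
  membership to vanishing outside some simplex. Only the finitely many simplices inside
  \<open>V\<close> matter, which leaves a finite union of closed conditions.\<close>

lemma closedin_product_geom_real:
  assumes "finite V" "down_closed K"
  shows "closedin (product_topology (\<lambda>_. euclideanreal) V) (topspace (geom_real V K))"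
proof -
  let ?P = "product_topology (\<lambda>_. euclideanreal) V"
  have c: "continuous_map ?P euclideanreal (\<lambda>f. f v)" if "v \<in> V" for v
    by (intro continuous_map_product_projection that)
  have cl: "closedin ?P {f \<in> topspace ?P. g f \<in> C}"
    if "continuous_map ?P euclideanreal g" "closed C" for g :: "('a \<Rightarrow> real) \<Rightarrow> real" and C
    by (rule closedin_continuous_map_preimage[OF that(1)]) (use that(2) in simp)
  have nn: "closedin ?P {f \<in> topspace ?P. \<forall>v\<in>V. f v \<in> {0..}}"
  proof (cases "V = {}")
    case False
    have "closedin ?P (\<Inter>v\<in>V. {f \<in> topspace ?P. f v \<in> {0..}})"
      by (rule closedin_INT[OF False]) (intro cl c, auto)
    also have "(\<Inter>v\<in>V. {f \<in> topspace ?P. f v \<in> {0..}}) = {f \<in> topspace ?P. \<forall>v\<in>V. f v \<in> {0..}}"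
      using False by blast
    finally show ?thesis .
  next
    case True
    then have "{f \<in> topspace ?P. \<forall>v\<in>V. f v \<in> {0..}} = topspace ?P" by auto
    then show ?thesis by (simp only: closedin_topspace)
  qed
  have s1: "closedin ?P {f \<in> topspace ?P. sum f V \<in> {1}}"
    by (intro cl continuous_map_sum c closed_singleton assms(1))
  have z: "closedin ?P {f \<in> topspace ?P. \<forall>v\<in>V-\<sigma>. f v \<in> {0}}" for \<sigma>
  proof (cases "V - \<sigma> = {}")
    case False
    have "closedin ?P (\<Inter>v\<in>V-\<sigma>. {f \<in> topspace ?P. f v \<in> {0}})"
      by (rule closedin_INT[OF False]) (intro cl c, auto)
    also have "(\<Inter>v\<in>V-\<sigma>. {f \<in> topspace ?P. f v \<in> {0}}) = {f \<in> topspace ?P. \<forall>v\<in>V-\<sigma>. f v \<in> {0}}"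
      using False by blast
    finally show ?thesis .
  next
    case True
    then have "{f \<in> topspace ?P. \<forall>v\<in>V-\<sigma>. f v \<in> {0}} = topspace ?P" by auto
    then show ?thesis by (simp only: closedin_topspace)
  qed
  have u: "closedin ?P (\<Union>\<sigma>\<in>K \<inter> Pow V. {f \<in> topspace ?P. \<forall>v\<in>V-\<sigma>. f v \<in> {0}})"
    using z assms(1) by (intro closedin_Union) auto
  have "topspace (geom_real V K) = {f \<in> topspace ?P. \<forall>v\<in>V. f v \<in> {0..}} \<inter>
     {f \<in> topspace ?P. sum f V \<in> {1}} \<inter> (\<Union>\<sigma>\<in>K \<inter> Pow V. {f \<in> topspace ?P. \<forall>v\<in>V-\<sigma>. f v \<in> {0}})"
    (is "_ = ?R")
  proof
    show "topspace (geom_real V K) \<subseteq> ?R"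
      unfolding topspace_geom_real by (auto simp: supp_def PiE_def)
    show "?R \<subseteq> topspace (geom_real V K)"
    proof
      fix f assume f: "f \<in> ?R"
      then obtain \<sigma> where \<sigma>: "\<sigma> \<in> K" "\<forall>v\<in>V-\<sigma>. f v = 0" by auto
      have "supp V f \<subseteq> \<sigma>" using \<sigma> by (auto simp: supp_def)
      moreover have "supp V f \<noteq> {}"
      using f by (intro supp_nonempty) auto
      ultimately have "supp V f \<in> K" using assms(2) \<sigma>(1) by (auto simp: down_closed_def)
      then show "f \<in> topspace (geom_real V K)" using f by (auto simp: topspace_geom_real PiE_def)
    qed
  qed
  then show ?thesis using nn s1 u by (simp add: closedin_Int)
qed

lemma closedin_geom_real:
  assumes "finite V" "down_closed K'" "K' \<subseteq> K"
  shows "closedin (geom_real V K) (topspace (geom_real V K'))"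
proof -
  have "topspace (geom_real V K') \<subseteq> topspace (geom_real V K)"
    using assms(3) by (auto simp: topspace_geom_real)
  then show ?thesis
    by (subst geom_real_eq_subtopology) (rule closedin_subset_topspace[OF closedin_product_geom_real[OF assms(1,2)]])
qed

lemma coord_le_1:
  assumes "finite V" "f \<in> topspace (geom_real V K)" "v \<in> V"
  shows "f v \<le> 1"
  using assms member_le_sum[of v V f] by (auto simp: topspace_geom_real)

lemma compact_space_geom_real:
  assumes "finite V" "down_closed K"
  shows "compact_space (geom_real V K)"
proof -
  let ?P = "product_topology (\<lambda>_. euclideanreal) V"
  have "compactin ?P (PiE V (\<lambda>_. {0..1}))"
    by (simp add: compactin_PiE)
  moreover have "topspace (geom_real V K) \<subseteq> PiE V (\<lambda>_. {0..1})"
    using coord_le_1[OF assms(1)] by (auto simp: topspace_geom_real PiE_def)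
  ultimately have "compactin ?P (topspace (geom_real V K))"
    using closed_compactin closedin_product_geom_real[OF assms] by blast
  then show ?thesis by (subst geom_real_eq_subtopology) (rule compact_space_subtopology)
qed

text \<open>The straight-line homotopy works: at every time its support lies in the union of the two
  supports, which is a simplex by assumption.\<close>

lemma homotopic_contiguous:
  assumes V: "finite V" and K: "down_closed K"
    and f: "continuous_map S (geom_real V K) f" and g: "continuous_map S (geom_real V K) g"
    and fg: "\<And>x. x \<in> topspace S \<Longrightarrow> supp V (f x) \<union> supp V (g x) \<in> K"
  shows "homotopic_with (\<lambda>_. True) S (geom_real V K) f g"
proof -
  define h where "h = (\<lambda>(t::real, x). restrict (\<lambda>v. (1 - t) * f x v + t * g x v) V)"
  have in_f: "f x \<in> topspace (geom_real V K)" and in_g: "g x \<in> topspace (geom_real V K)"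
    if "x \<in> topspace S" for x
    using f g that by (auto simp: continuous_map_into_geom_real)
  have fc: "continuous_map (prod_topology (top_of_set {0..1}) S) euclideanreal (\<lambda>z. f (snd z) v)"
    and gc: "continuous_map (prod_topology (top_of_set {0..1}) S) euclideanreal (\<lambda>z. g (snd z) v)"
    if "v \<in> V" for v
    using continuous_map_compose[OF continuous_map_snd, of S euclideanreal "\<lambda>x. f x v"]
      continuous_map_compose[OF continuous_map_snd, of S euclideanreal "\<lambda>x. g x v"]
      f g that by (auto simp: continuous_map_into_geom_real o_def)
  have tc: "continuous_map (prod_topology (top_of_set {0..1}) S) euclideanreal (\<lambda>z. fst z)"
    by (rule continuous_map_into_fulltopology[OF continuous_map_fst])
  have "continuous_map (prod_topology (top_of_set {0..1}) S) (geom_real V K) h"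
    unfolding continuous_map_into_geom_real
  proof (intro conjI ballI)
    fix z assume "z \<in> topspace (prod_topology (top_of_set {0..1::real}) S)"
    then obtain t x where z: "z = (t, x)" "0 \<le> t" "t \<le> 1" "x \<in> topspace S" by (cases z) auto
    have s: "supp V (h z) \<subseteq> supp V (f x) \<union> supp V (g x)"
      by (auto simp: supp_def h_def z)
    have one: "sum (h z) V = 1"
      using in_f[OF z(4)] in_g[OF z(4)]
      by (simp add: h_def z sum.distrib topspace_geom_real flip: sum_distrib_left)
    then have "supp V (h z) \<noteq> {}"
      by (rule supp_nonempty)
    with s fg[OF z(4)] K have "supp V (h z) \<in> K" by (auto simp: down_closed_def)
    with one show "h z \<in> topspace (geom_real V K)"
      using in_f[OF z(4)] in_g[OF z(4)] z(2,3) by (auto simp: topspace_geom_real h_def z)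
  next
    fix v assume v: "v \<in> V"
    have "continuous_map (prod_topology (top_of_set {0..1}) S) euclideanreal
        (\<lambda>z. (1 - fst z) * f (snd z) v + fst z * g (snd z) v)"
      using v by (intro continuous_map_add continuous_map_real_mult continuous_map_diff tc fc gc) auto
    then show "continuous_map (prod_topology (top_of_set {0..1}) S) euclideanreal (\<lambda>z. h z v)"
      using v by (simp add: h_def case_prod_unfold)
  qed
  moreover have "h (0, x) = f x" "h (1, x) = g x" if "x \<in> topspace S" for x
    using in_f[OF that] in_g[OF that]
    by (auto simp: h_def topspace_geom_real fun_eq_iff extensional_def)
  ultimately show ?thesis
    by (subst homotopic_with) auto
qed

text \<open>The retraction \<open>\<rho>\<close> moves the weight of \<open>v\<close> onto
  \<open>w\<close>. As \<open>w\<close> can be added to every simplex containing \<open>v\<close>, a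
  point and its image always lie in a common simplex, so the retraction is contiguous to the
  identity.\<close>

lemma geom_real_remove_dominated:
  assumes V: "finite V" and K: "down_closed K" and KV: "\<And>\<sigma>. \<sigma> \<in> K \<Longrightarrow> \<sigma> \<subseteq> V"
    and vw: "v \<in> V" "w \<in> V" "v \<noteq> w"
    and dom: "\<And>\<sigma>. \<sigma> \<in> K \<Longrightarrow> v \<in> \<sigma> \<Longrightarrow> insert w \<sigma> \<in> K"
  shows "geom_real V K homotopy_equivalent_space geom_real (V - {v}) {\<sigma> \<in> K. v \<notin> \<sigma>}"
proof -
  let ?V' = "V - {v}" and ?K' = "{\<sigma> \<in> K. v \<notin> \<sigma>}"
  define \<rho> where "\<rho> f = restrict (\<lambda>u. if u = w then f w + f v else f u) ?V'" for f :: "'a \<Rightarrow> real"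
  define \<iota> where "\<iota> g = restrict (\<lambda>u. if u = v then 0 else g u) V" for g :: "'a \<Rightarrow> real"
  have sumV: "sum f V = f v + (f w + sum f (V - {v} - {w}))" for f :: "'a \<Rightarrow> real"
    using V vw by (metis finite_Diff insertE insert_Diff sum.remove)
  have sum\<rho>: "sum (\<rho> f) ?V' = sum f V" for f
  proof -
    have "sum (\<rho> f) ?V' = \<rho> f w + sum (\<rho> f) (V - {v} - {w})"
      using V vw by (intro sum.remove) auto
    also have "sum (\<rho> f) (V - {v} - {w}) = sum f (V - {v} - {w})"
      by (intro sum.cong) (auto simp: \<rho>_def)
    finally show ?thesis using vw by (simp add: sumV \<rho>_def)
  qed
  have sum\<iota>: "sum (\<iota> g) V = sum g ?V'" for g
  proof -
    have "sum (\<iota> g) V = \<iota> g v + sum (\<iota> g) ?V'" using V vw by (intro sum.remove) auto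
    also have "sum (\<iota> g) ?V' = sum g ?V'" by (intro sum.cong) (auto simp: \<iota>_def)
    finally show ?thesis using vw by (simp add: \<iota>_def)
  qed
  \<comment> \<open>Non-negative weights cannot cancel, so the merged weight at \<open>w\<close>
    vanishes only if both summands do.\<close>
  have supp\<rho>: "supp ?V' (\<rho> f) = supp V f - {v} \<union> (if f v = 0 then {} else {w})"
    if "f \<in> topspace (geom_real V K)" for f
  proof -
    have "f w + f v = 0 \<longleftrightarrow> f w = 0 \<and> f v = 0"
      using that vw by (intro add_nonneg_eq_0_iff) (auto simp: topspace_geom_real)
    then show ?thesis using vw by (auto simp: supp_def \<rho>_def)
  qed
  have star: "supp V f \<union> (if f v = 0 then {} else {w}) \<in> K"
    if "f \<in> topspace (geom_real V K)" for f
    using that vw dom[of "supp V f"] by (auto simp: topspace_geom_real supp_def)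
  have \<rho>_in: "\<rho> f \<in> topspace (geom_real ?V' ?K')" if f: "f \<in> topspace (geom_real V K)" for f
  proof -
    have "supp ?V' (\<rho> f) \<subseteq> supp V f \<union> (if f v = 0 then {} else {w})"
      by (auto simp: supp\<rho>[OF f])
    moreover have "supp ?V' (\<rho> f) \<noteq> {}"
      using sum\<rho>[of f] f by (intro supp_nonempty) (simp add: topspace_geom_real)
    ultimately have "supp ?V' (\<rho> f) \<in> K" using star[OF f] K by (meson down_closed_def)
    then show ?thesis using f sum\<rho>[of f] vw
      by (auto simp: topspace_geom_real \<rho>_def) (auto simp: supp_def)
  qed
  have \<iota>_in: "\<iota> g \<in> topspace (geom_real V K)" if g: "g \<in> topspace (geom_real ?V' ?K')" for g
  proof -
    have "supp V (\<iota> g) = supp ?V' g" by (auto simp: supp_def \<iota>_def)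
    then show ?thesis using g sum\<iota>[of g] by (auto simp: topspace_geom_real \<iota>_def)
  qed
  have c\<rho>: "continuous_map (geom_real V K) (geom_real ?V' ?K') \<rho>"
    unfolding continuous_map_into_geom_real
  proof (intro conjI ballI \<rho>_in)
    fix u assume "u \<in> ?V'"
    then show "continuous_map (geom_real V K) euclideanreal (\<lambda>x. \<rho> x u)"
      using vw by (cases "u = w") (auto simp: \<rho>_def intro!: continuous_map_add continuous_map_coord)
  qed
  have c\<iota>: "continuous_map (geom_real ?V' ?K') (geom_real V K) \<iota>"
    unfolding continuous_map_into_geom_real
  proof (intro conjI ballI \<iota>_in)
    fix u assume "u \<in> V"
    then show "continuous_map (geom_real ?V' ?K') euclideanreal (\<lambda>x. \<iota> x u)"
      by (cases "u = v") (auto simp: \<iota>_def intro!: continuous_map_coord)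
  qed
  have "\<rho> (\<iota> g) = g" if "g \<in> topspace (geom_real ?V' ?K')" for g
    using that vw by (auto simp: \<rho>_def \<iota>_def fun_eq_iff topspace_geom_real extensional_def)
  then have 1: "homotopic_with (\<lambda>_. True) (geom_real ?V' ?K') (geom_real ?V' ?K') (\<rho> \<circ> \<iota>) id"
    by (intro homotopic_with_equal continuous_map_compose[OF c\<iota> c\<rho>]) auto
  have 2: "homotopic_with (\<lambda>_. True) (geom_real V K) (geom_real V K) (\<iota> \<circ> \<rho>) id"
  proof (rule homotopic_contiguous[OF V K continuous_map_compose[OF c\<rho> c\<iota>] continuous_map_id])
    fix f assume f: "f \<in> topspace (geom_real V K)"
    have "supp V (\<iota> (\<rho> f)) = supp ?V' (\<rho> f)" by (auto simp: supp_def \<iota>_def)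
    then have "supp V ((\<iota> \<circ> \<rho>) f) \<union> supp V (id f) = supp V f \<union> (if f v = 0 then {} else {w})"
      by (auto simp: supp\<rho>[OF f])
    then show "supp V ((\<iota> \<circ> \<rho>) f) \<union> supp V (id f) \<in> K" using star[OF f] by simp
  qed
  show ?thesis
    unfolding homotopy_equivalent_space_def using c\<rho> c\<iota> 1 2 by blast
qed

lemma geom_real_iso:
  assumes \<phi>: "bij_betw \<phi> V V'"
    and K: "\<And>\<sigma>. \<sigma> \<subseteq> V \<Longrightarrow> \<sigma> \<in> K \<longleftrightarrow> \<phi> ` \<sigma> \<in> K'"
  shows "geom_real V K homotopy_equivalent_space geom_real V' K'"
proof -
  define \<psi> where "\<psi> = inv_into V \<phi>"
  have inv: "\<And>v. v \<in> V \<Longrightarrow> \<psi> (\<phi> v) = v" "\<And>v. v \<in> V' \<Longrightarrow> \<phi> (\<psi> v) = v"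
    and mem: "\<And>v. v \<in> V \<Longrightarrow> \<phi> v \<in> V'" "\<And>v. v \<in> V' \<Longrightarrow> \<psi> v \<in> V"
    using \<phi> by (auto simp: \<psi>_def bij_betw_inv_into_left bij_betw_inv_into_right bij_betw_apply
        intro: bij_betw_apply[OF bij_betw_inv_into])
  have \<psi>: "bij_betw \<psi> V' V" using \<phi> by (simp add: \<psi>_def bij_betw_inv_into)
  define A where "A f = restrict (f \<circ> \<psi>) V'" for f :: "'a \<Rightarrow> real"
  define B where "B f = restrict (f \<circ> \<phi>) V" for f :: "'b \<Rightarrow> real"
  have sA: "supp V' (A f) = \<phi> ` supp V f" for f
    using inv mem by (force simp: supp_def A_def image_iff)
  have sB: "\<phi> ` supp V (B f) = supp V' f" for f
    using inv mem by (force simp: supp_def B_def image_iff)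
  have sub: "supp V f \<subseteq> V" for f by (auto simp: supp_def)
  have "sum (A f) V' = sum f V" for f
    using sum.reindex_bij_betw[OF \<psi>, of f] by (simp add: A_def)
  then have A_in: "A f \<in> topspace (geom_real V' K')" if "f \<in> topspace (geom_real V K)" for f
    using that mem K[OF sub] by (auto simp: topspace_geom_real sA) (auto simp: A_def)
  have "sum (B f) V = sum f V'" for f
    using sum.reindex_bij_betw[OF \<phi>, of f] by (simp add: B_def)
  then have B_in: "B f \<in> topspace (geom_real V K)" if "f \<in> topspace (geom_real V' K')" for f
    using that mem K[OF sub] by (auto simp: topspace_geom_real sB) (auto simp: B_def)
  have "continuous_map (geom_real V K) (geom_real V' K') A"
    unfolding continuous_map_into_geom_real
    using A_in mem by (auto simp: A_def intro!: continuous_map_coord)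
  moreover have "continuous_map (geom_real V' K') (geom_real V K) B"
    unfolding continuous_map_into_geom_real
    using B_in mem by (auto simp: B_def intro!: continuous_map_coord)
  moreover have "B (A f) = f" if "f \<in> topspace (geom_real V K)" for f
    using that mem inv by (auto simp: A_def B_def topspace_geom_real fun_eq_iff extensional_def)
  moreover have "A (B f) = f" if "f \<in> topspace (geom_real V' K')" for f
    using that mem inv by (auto simp: A_def B_def topspace_geom_real fun_eq_iff extensional_def)
  ultimately have "homeomorphic_maps (geom_real V K) (geom_real V' K') A B"
    by (simp add: homeomorphic_maps_def)
  then show ?thesis
    using homeomorphic_imp_homotopy_equivalent_space homeomorphic_space_def by blast
qed

text \<open>Stands for the collapse of a contractible subspace \<open>M\<close> whose contraction
  has been extended to \<open>H\<close> on all of \<open>X\<close>. At time 1, \<open>H\<close> is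
  constant on \<open>M\<close> and descends along \<open>q\<close> to the homotopy inverse
  \<open>p\<close>. Since \<open>H\<close> never leaves \<open>M\<close> once inside,
  \<open>q \<circ> H\<close> descends as well, this time along \<open>Q\<close>, the product of
  \<open>q\<close> with the unit interval; compactness and the Hausdorff property make both
  \<open>q\<close> and \<open>Q\<close> quotient maps.\<close>

lemma homotopy_equivalent_collapse:
  assumes compX: "compact_space X" and hausY: "Hausdorff_space Y"
    and q: "continuous_map X Y q" and surj: "q ` topspace X = topspace Y"
    and inj: "\<And>x y. x \<in> topspace X \<Longrightarrow> y \<in> topspace X \<Longrightarrow> q x = q y \<Longrightarrow> x = y \<or> (x \<in> M \<and> y \<in> M)"
    and MX: "M \<subseteq> topspace X" and qM: "\<And>x. x \<in> M \<Longrightarrow> q x = o'"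
    and H: "continuous_map (prod_topology (top_of_set {0..1::real}) X) X H"
    and H0: "\<And>x. x \<in> topspace X \<Longrightarrow> H (0, x) = x"
    and H1: "\<And>x. x \<in> M \<Longrightarrow> H (1, x) = m"
    and HM: "\<And>t x. t \<in> {0..1} \<Longrightarrow> x \<in> M \<Longrightarrow> H (t, x) \<in> M"
  shows "X homotopy_equivalent_space Y"
proof -
  let ?I = "top_of_set {0..1::real}"
  define s where "s = inv_into (topspace X) q"
  have s: "s y \<in> topspace X" "q (s y) = y" if "y \<in> topspace Y" for y
    using that surj by (auto simp: s_def inv_into_into f_inv_into_f)
  have sq: "s (q x) = x \<or> (s (q x) \<in> M \<and> x \<in> M)" if "x \<in> topspace X" for x
  proof -
    have "q x \<in> topspace Y" using that surj by blast
    then show ?thesis using s[of "q x"] inj[of "s (q x)" x] that by auto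
  qed
  have qq: "quotient_map X Y q"
    using continuous_imp_quotient_map[OF q compX hausY surj] .
  define p where "p y = H (1, s y)" for y
  have pq: "p (q x) = H (1, x)" if "x \<in> topspace X" for x
    using sq[OF that] H1 by (auto simp: p_def)
  have H1c: "continuous_map X X (\<lambda>x. H (1, x))"
    using continuous_map_compose[OF _ H, of X "\<lambda>x. (1, x)"]
    by (auto simp: o_def continuous_map_pairwise)
  have pc: "continuous_map Y X p"
    by (rule continuous_compose_quotient_map[OF qq])
       (rule continuous_map_eq[OF H1c], simp add: pq)
  define Q where "Q = (\<lambda>(t::real, x). (t, q x))"
  define G where "G = (\<lambda>(t::real, y). q (H (t, s y)))"
  have Qc: "continuous_map (prod_topology ?I X) (prod_topology ?I Y) Q"
    unfolding Q_def case_prod_unfold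
    by (intro continuous_map_paired[THEN iffD2] conjI continuous_map_fst
        continuous_map_compose[OF continuous_map_snd q, unfolded o_def])
  have QQ: "quotient_map (prod_topology ?I X) (prod_topology ?I Y) Q"
  proof (rule continuous_imp_quotient_map[OF Qc])
    show "compact_space (prod_topology ?I X)"
      using compX by (simp add: compact_space_prod_topology compact_space_subtopology)
    show "Hausdorff_space (prod_topology ?I Y)"
      using hausY by (simp add: Hausdorff_space_prod_topology Hausdorff_space_subtopology)
    show "Q ` topspace (prod_topology ?I X) = topspace (prod_topology ?I Y)"
      using surj by (force simp: Q_def image_iff)
  qed
  have GQ: "G (Q z) = q (H z)" if zX: "z \<in> topspace (prod_topology ?I X)" for z
  proof -
    obtain t x where z: "z = (t, x)" "t \<in> {0..1}" "x \<in> topspace X" using zX by (cases z) auto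
    show ?thesis using sq[OF z(3)] HM[OF z(2)] qM by (auto simp: G_def Q_def z(1))
  qed
  have Gc: "continuous_map (prod_topology ?I Y) Y G"
    by (rule continuous_compose_quotient_map[OF QQ])
       (rule continuous_map_eq[OF continuous_map_compose[OF H q]], simp add: GQ)
  have "homotopic_with (\<lambda>_. True) Y Y id (q \<circ> p)"
    by (subst homotopic_with, simp, intro exI[of _ G] conjI ballI Gc) (auto simp: G_def p_def s H0)
  moreover have "homotopic_with (\<lambda>_. True) X X id (p \<circ> q)"
    by (subst homotopic_with, simp, intro exI[of _ H] conjI ballI H) (auto simp: pq H0)
  ultimately show ?thesis
    unfolding homotopy_equivalent_space_def using pc q
    by (auto simp: homotopic_with_sym)
qed

section \<open>The clique complex of three cyclically linked blocks\<close>

definition verts :: "nat \<Rightarrow> (nat \<times> nat) set" where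
  "verts P = {..<P} \<times> {..<3}"

text \<open>The pair \<open>(i, k)\<close> stands for the \<open>i\<close>-th point, in clockwise
  order, of the initial block, advanced \<open>k\<close> times. Its outgoing edges reach exactly as
  far as \<open>(i, k + 1)\<close>, hence in the next block they meet the indices up to
  \<open>i\<close>. The last clause is the same rule with the roles exchanged.\<close>

definition block_adj :: "nat \<times> nat \<Rightarrow> nat \<times> nat \<Rightarrow> bool" where
  "block_adj u v \<longleftrightarrow> snd u = snd v \<or> (snd v = (snd u + 1) mod 3 \<and> fst v \<le> fst u) \<or>
     (snd u = (snd v + 1) mod 3 \<and> fst u \<le> fst v)"

definition block_complex :: "nat \<Rightarrow> (nat \<times> nat) set set" where
  "block_complex P = {\<sigma>. \<sigma> \<subseteq> verts P \<and> \<sigma> \<noteq> {} \<and> (\<forall>u\<in>\<sigma>. \<forall>v\<in>\<sigma>. block_adj u v)}"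

definition tri :: "nat \<Rightarrow> (nat \<times> nat) set" where
  "tri i = {i} \<times> {..<3}"

text \<open>Triangle 0 is the one to fill in because 0 is the least index: its vertex in the
  following block is adjacent to every vertex of a given block, so weight can be gathered on
  it.\<close>

definition band_complex :: "nat \<Rightarrow> (nat \<times> nat) set set" where
  "band_complex P = {\<sigma> \<in> block_complex P. (\<exists>k<3. \<forall>i. (i, k) \<notin> \<sigma>) \<or> \<sigma> = tri 0}"

definition tri_complex :: "nat \<Rightarrow> (nat \<times> nat) set set" where
  "tri_complex i = {\<sigma>. \<sigma> \<noteq> {} \<and> \<sigma> \<subseteq> tri i}"

abbreviation "blocks P \<equiv> geom_real (verts P) (block_complex P)"
abbreviation "band P \<equiv> geom_real (verts P) (band_complex P)"
abbreviation "cell P i \<equiv> geom_real (verts P) (tri_complex i)"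

lemma less_3_iff: "k < (3::nat) \<longleftrightarrow> k = 0 \<or> k = 1 \<or> k = 2"
  by auto

lemma lessThan_3: "{..<3::nat} = {0, 1, 2}"
  by auto

lemma tri_in_block: "i < P \<Longrightarrow> tri i \<in> block_complex P"
  by (auto simp: tri_def block_complex_def verts_def block_adj_def less_3_iff)

lemma finite_verts: "finite (verts P)"
  by (simp add: verts_def)

lemma block_complex_down: "down_closed (block_complex P)"
  unfolding down_closed_def block_complex_def by blast

lemma tri_proper_subset:
  assumes "\<sigma> \<subseteq> tri i" "\<sigma> \<noteq> tri i"
  obtains k where "k < 3" "\<And>j. (j, k) \<notin> \<sigma>"
  using assms by (auto simp: tri_def)

lemma band_complex_down: "down_closed (band_complex P)"
proof -
  have "\<tau> \<in> band_complex P" if *: "\<sigma> \<in> band_complex P" "\<tau> \<subseteq> \<sigma>" "\<tau> \<noteq> {}" for \<sigma> \<tau>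
  proof -
    have "\<tau> \<in> block_complex P"
      using * block_complex_down unfolding band_complex_def down_closed_def by blast
    moreover have "(\<exists>k<3. \<forall>i. (i, k) \<notin> \<tau>) \<or> \<tau> = tri 0"
    proof (cases "\<sigma> = tri 0")
      case True
      then show ?thesis using *(2) tri_proper_subset[of \<tau> 0] by metis
    next
      case False
      then obtain k where "k < 3" "\<forall>i. (i, k) \<notin> \<sigma>" using *(1) unfolding band_complex_def by blast
      then show ?thesis using *(2) by blast
    qed
    ultimately show ?thesis by (simp add: band_complex_def)
  qed
  then show ?thesis by (auto simp: down_closed_def)
qed

lemma tri_complex_down: "down_closed (tri_complex i)"
  by (auto simp: down_closed_def tri_complex_def)

lemma tri_complex_sub: "i < P \<Longrightarrow> tri_complex i \<subseteq> block_complex P"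
  using tri_in_block block_complex_down unfolding tri_complex_def down_closed_def by blast

lemma band_complex_sub: "band_complex P \<subseteq> block_complex P"
  by (auto simp: band_complex_def)

text \<open>In a simplex that meets all three blocks the indices decrease weakly from each block to
  the next. Going once around the cycle forces them all to be equal.\<close>

lemma block_complex_cases:
  assumes "\<sigma> \<in> block_complex P"
  shows "(\<exists>k<3. \<forall>i. (i, k) \<notin> \<sigma>) \<or> (\<exists>i<P. \<sigma> = tri i)"
proof (rule disjCI)
  assume "\<not> (\<exists>i<P. \<sigma> = tri i)"
  show "\<exists>k<3. \<forall>i. (i, k) \<notin> \<sigma>"
  proof (rule ccontr)
    assume "\<not> (\<exists>k<3. \<forall>i. (i, k) \<notin> \<sigma>)"
    then have ex: "\<exists>i. (i, k) \<in> \<sigma>" if "k < 3" for k using that by blast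
    obtain a b c where abc: "(a, 0) \<in> \<sigma>" "(b, 1) \<in> \<sigma>" "(c, 2) \<in> \<sigma>"
      using ex[of 0] ex[of 1] ex[of 2] by auto
    have adj: "block_adj u v" if "u \<in> \<sigma>" "v \<in> \<sigma>" for u v
      using assms that by (auto simp: block_complex_def)
    have 1: "y \<le> x" if "(x, 0) \<in> \<sigma>" "(y, 1) \<in> \<sigma>" for x y
      using adj[OF that] by (auto simp: block_adj_def)
    have 2: "y \<le> x" if "(x, 1) \<in> \<sigma>" "(y, 2) \<in> \<sigma>" for x y
      using adj[OF that] by (auto simp: block_adj_def)
    have 3: "y \<le> x" if "(x, 2) \<in> \<sigma>" "(y, 0) \<in> \<sigma>" for x y
      using adj[OF that] by (auto simp: block_adj_def)
    have eq: "x = a" if "(x, k) \<in> \<sigma>" "k < 3" for x k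
    proof -
      have "b \<le> a" "c \<le> b" "a \<le> c" using 1 2 3 abc by auto
      moreover from that(2) consider "k = 0" | "k = 1" | "k = 2" unfolding less_3_iff by blast
      then have "(b \<le> x \<and> x \<le> c) \<or> (c \<le> x \<and> x \<le> a) \<or> (a \<le> x \<and> x \<le> b)"
        using 1 2 3 abc that(1) by cases auto
      ultimately show ?thesis by linarith
    qed
    have "\<sigma> \<subseteq> tri a"
    proof
      fix u assume u: "u \<in> \<sigma>"
      then have "snd u < 3" using assms by (auto simp: block_complex_def verts_def)
      with u eq[of "fst u" "snd u"] show "u \<in> tri a" by (auto simp: tri_def mem_Times_iff)
    qed
    moreover have "tri a \<subseteq> \<sigma>"
      using abc eq[OF abc(2)] eq[OF abc(3)] by (auto simp: tri_def less_3_iff)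
    moreover have "a < P" using abc assms by (auto simp: block_complex_def verts_def)
    ultimately show False using \<open>\<not> (\<exists>i<P. \<sigma> = tri i)\<close> by blast
  qed
qed

lemma block_complex_cases':
  assumes "\<sigma> \<in> block_complex P" "\<sigma> \<notin> band_complex P"
  obtains i where "0 < i" "i < P" "\<sigma> = tri i"
proof -
  have "\<not> (\<exists>k<3. \<forall>i. (i, k) \<notin> \<sigma>)" "\<sigma> \<noteq> tri 0" using assms unfolding band_complex_def by blast+
  then obtain i where "i < P" "\<sigma> = tri i" "i \<noteq> 0" using block_complex_cases[OF assms(1)] by metis
  then show thesis using that by simp
qed

subsection \<open>The band together with one triangle is contractible\<close>

definition mass :: "nat \<Rightarrow> (nat \<times> nat \<Rightarrow> real) \<Rightarrow> nat \<Rightarrow> real" where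
  "mass P f k = (\<Sum>i<P. f (i, k))"

text \<open>Three masses with sum 1 cannot all be at most 1/4, so the denominator is positive. A
  block survives only with mass above 1/4, and then every other block has mass below 3/4; the
  interpolation parameters of the contraction use this gap.\<close>

definition cutoff :: "nat \<Rightarrow> (nat \<times> nat \<Rightarrow> real) \<Rightarrow> nat \<Rightarrow> real" where
  "cutoff P f k = max 0 (mass P f k - 1/4) / (\<Sum>l<3. max 0 (mass P f l - 1/4))"

text \<open>In every surviving block the fraction \<open>1 - \<mu>\<close> of the weight keeps its
  proportions and the fraction \<open>\<mu>\<close> goes to index 0. The \<open>max\<close> equals
  the mass wherever the cutoff is non-zero, and keeps the quotient continuous elsewhere.\<close>

definition push :: "nat \<Rightarrow> ((nat \<times> nat \<Rightarrow> real) \<Rightarrow> nat \<Rightarrow> real) \<Rightarrow> (nat \<times> nat \<Rightarrow> real) \<Rightarrow> nat \<times> nat \<Rightarrow> real" where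
  "push P \<mu> f = restrict (\<lambda>(i, k). cutoff P f k *
     ((1 - \<mu> f k) * (f (i, k) / max (1/4) (mass P f k)) + \<mu> f k * (if i = 0 then 1 else 0))) (verts P)"

lemma sum_verts: "sum f (verts P) = mass P f 0 + mass P f 1 + mass P f 2"
proof -
  have "sum f (verts P) = (\<Sum>i<P. \<Sum>k<3. f (i, k))"
    by (simp add: verts_def sum.cartesian_product)
  then show ?thesis by (simp add: lessThan_3 sum.distrib mass_def add.assoc)
qed

lemma cutoff_denom:
  assumes "mass P f 0 + mass P f 1 + mass P f 2 = 1"
  shows "(\<Sum>l<3. max 0 (mass P f l - 1/4)) > 0"
  using assms by (auto simp: lessThan_3 max_def)

lemma cutoff_nonneg: "cutoff P f k \<ge> 0"
  unfolding cutoff_def by (intro divide_nonneg_nonneg sum_nonneg) auto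

lemma cutoff_pos_iff:
  assumes "mass P f 0 + mass P f 1 + mass P f 2 = 1"
  shows "cutoff P f k \<noteq> 0 \<longleftrightarrow> mass P f k > 1/4"
  using cutoff_denom[OF assms] by (auto simp: cutoff_def)

lemma sum_cutoff:
  assumes "mass P f 0 + mass P f 1 + mass P f 2 = 1"
  shows "cutoff P f 0 + cutoff P f 1 + cutoff P f 2 = 1"
  using cutoff_denom[OF assms] by (simp add: cutoff_def lessThan_3 divide_simps)

lemma sum_push:
  assumes "mass P f 0 + mass P f 1 + mass P f 2 = 1" "0 < P"
  shows "sum (push P \<mu> f) (verts P) = 1"
proof -
  have m: "mass P (push P \<mu> f) k = cutoff P f k" if "k < 3" for k
  proof (cases "cutoff P f k = 0")
    case True
    have "mass P (push P \<mu> f) k = (\<Sum>i<P. 0)"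
      unfolding mass_def[of P "push P \<mu> f"] using that True
      by (intro sum.cong) (auto simp: push_def verts_def)
    then show ?thesis using True by simp
  next
    case False
    then have gt: "mass P f k > 1/4" using cutoff_pos_iff[OF assms(1)] by simp
    have "mass P (push P \<mu> f) k = (\<Sum>i<P. cutoff P f k *
     ((1 - \<mu> f k) * (f (i, k) / mass P f k) + \<mu> f k * (if i = 0 then 1 else 0)))"
      unfolding mass_def[of P "push P \<mu> f"] using that gt
      by (intro sum.cong) (auto simp: push_def verts_def max_def)
    also have "\<dots> = cutoff P f k * ((1 - \<mu> f k) * ((\<Sum>i<P. f (i, k)) / mass P f k) + \<mu> f k * (\<Sum>i<P. if i = 0 then 1 else 0))"
      by (simp only: sum_distrib_left[symmetric] sum.distrib sum_divide_distrib[symmetric])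
    also have "(\<Sum>i<P. if i = 0 then 1 else (0::real)) = 1"
      using assms(2) by (simp add: sum.delta)
    finally show ?thesis using gt by (simp add: mass_def)
  qed
  show ?thesis unfolding sum_verts using m sum_cutoff[OF assms(1)] by simp
qed

lemma supp_push:
  assumes "mass P f 0 + mass P f 1 + mass P f 2 = 1" "(i, k) \<in> supp (verts P) (push P \<mu> f)"
  shows "i < P" "k < 3" "mass P f k > 1/4" "(f (i, k) \<noteq> 0 \<and> \<mu> f k \<noteq> 1) \<or> (i = 0 \<and> \<mu> f k \<noteq> 0)"
  using assms cutoff_pos_iff[OF assms(1), of k]
  by (auto simp: supp_def push_def verts_def split: if_splits)

text \<open>The set \<open>S\<close> collects the vertices used by two pushes of the same point. Off
  triangle 0 one block is empty, and the only dangerous pair is \<open>(i, k)\<close> with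
  \<open>(j, k + 1)\<close> and \<open>i < j\<close>. Such a \<open>j\<close> is not 0, so the later
  block has not been moved completely; by the condition on the parameters the earlier block has then
  not been moved at all, so both vertices belong to the original simplex and are adjacent.\<close>

lemma push_union_in_band:
  assumes P: "0 < P" and f: "f \<in> topspace (band P)"
    and S: "\<And>i k. (i, k) \<in> S \<Longrightarrow> i < P \<and> k < 3 \<and> mass P f k > 1/4 \<and>
        ((f (i, k) \<noteq> 0 \<and> (\<mu> f k \<noteq> 1 \<or> \<mu>' f k \<noteq> 1)) \<or> (i = 0 \<and> (\<mu> f k \<noteq> 0 \<or> \<mu>' f k \<noteq> 0)))"
    and ne: "S \<noteq> {}"
    and \<mu>: "\<And>k. k < 3 \<Longrightarrow> mass P f k > 1/4 \<Longrightarrow> mass P f ((k + 1) mod 3) > 1/4 \<Longrightarrow>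
        mass P f ((k + 2) mod 3) = 0 \<Longrightarrow>
        (\<mu> f ((k + 1) mod 3) = 1 \<and> \<mu>' f ((k + 1) mod 3) = 1) \<or> (\<mu> f k = 0 \<and> \<mu>' f k = 0)"
  shows "S \<in> band_complex P"
proof -
  have sK: "supp (verts P) f \<in> band_complex P" using f by (simp add: topspace_geom_real)
  show ?thesis
  proof (cases "supp (verts P) f = tri 0")
    case True
    have "S \<subseteq> tri 0"
    proof
      fix u assume "u \<in> S"
      moreover obtain i k where "u = (i, k)" by force
      ultimately have u: "(i, k) \<in> S" "u = (i, k)" by auto
      from S[OF u(1)] have "i = 0 \<or> (i, k) \<in> supp (verts P) f"
        by (auto simp: supp_def verts_def)
      then show "u \<in> tri 0" using True S[OF u(1)] by (auto simp: u tri_def)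
    qed
    moreover have "tri 0 \<in> band_complex P" using tri_in_block[OF P] by (simp add: band_complex_def)
    ultimately show ?thesis using band_complex_down ne by (auto simp: down_closed_def)
  next
    case False
    then obtain k0 where k0: "k0 < 3" "\<And>i. (i, k0) \<notin> supp (verts P) f"
      using sK by (auto simp: band_complex_def)
    have "f (i, k0) = 0" if "i < P" for i
      using k0 that by (force simp: supp_def verts_def)
    then have m0: "mass P f k0 = 0" by (simp add: mass_def)
    have adj: "block_adj u v" if "f u \<noteq> 0" "f v \<noteq> 0" "u \<in> verts P" "v \<in> verts P" for u v
    proof -
      have "u \<in> supp (verts P) f" "v \<in> supp (verts P) f" using that by (auto simp: supp_def)
      then show ?thesis using sK unfolding band_complex_def block_complex_def by blast
    qed
    have cross: "j \<le> i" if "(i, k) \<in> S" "(j, (k + 1) mod 3) \<in> S" "k0 = (k + 2) mod 3" "k < 3" for i j k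
    proof (rule ccontr)
      assume ji: "\<not> j \<le> i"
      let ?k' = "(k + 1) mod 3"
      have k': "?k' < 3" "?k' \<noteq> k" "k \<noteq> (?k' + 1) mod 3" using that(4) by (auto simp: less_3_iff)
      from S[OF that(2)] ji have j: "f (j, ?k') \<noteq> 0" "\<mu> f ?k' \<noteq> 1 \<or> \<mu>' f ?k' \<noteq> 1" "j < P" by auto
      with \<mu>[of k] S[OF that(1)] S[OF that(2)] m0 that(3,4)
      have "\<mu> f k = 0 \<and> \<mu>' f k = 0" by auto
      with S[OF that(1)] have "f (i, k) \<noteq> 0" "i < P" by auto
      with adj[of "(i, k)" "(j, ?k')"] j k' that(4) ji show False
        by (auto simp: block_adj_def verts_def)
    qed
    have no: "(i, k0) \<notin> S" for i using S[of i k0] m0 by auto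
    have "block_adj u v" if uv: "u \<in> S" "v \<in> S" for u v
    proof -
      obtain i k j l where e: "u = (i, k)" "v = (j, l)" by (cases u, cases v) auto
      have lt: "k < 3" "l < 3" "k \<noteq> k0" "l \<noteq> k0" using S uv no by (auto simp: e)
      consider "k = l" | "l = (k + 1) mod 3" "k0 = (k + 2) mod 3"
        | "k = (l + 1) mod 3" "k0 = (l + 2) mod 3"
        using lt k0(1) by (auto simp: less_3_iff)
      then show ?thesis
        using cross[of i k j] cross[of j l i] uv lt by cases (auto simp: block_adj_def e)
    qed
    moreover have "S \<subseteq> verts P" using S by (force simp: verts_def)
    ultimately show ?thesis using no k0(1) ne by (auto simp: band_complex_def block_complex_def)
  qed
qed

lemma mass_total:
  assumes "f \<in> topspace (geom_real (verts P) K)"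
  shows "mass P f 0 + mass P f 1 + mass P f 2 = 1"
  using assms sum_verts[of f P] by (simp add: topspace_geom_real)

lemma mass_nonneg:
  assumes "f \<in> topspace (geom_real (verts P) K)" "k < 3"
  shows "mass P f k \<ge> 0"
  using assms unfolding mass_def
  by (intro sum_nonneg) (auto simp: topspace_geom_real verts_def)

lemma mass_pair_le:
  assumes "f \<in> topspace (geom_real (verts P) K)" "k < 3" "l < 3" "k \<noteq> l"
  shows "mass P f k + mass P f l \<le> 1"
  using mass_total[OF assms(1)] mass_nonneg[OF assms(1), of 0] mass_nonneg[OF assms(1), of 1]
    mass_nonneg[OF assms(1), of 2] assms(2-4) unfolding less_3_iff by auto

lemma continuous_map_mass:
  assumes "k < 3"
  shows "continuous_map (geom_real (verts P) K) euclideanreal (\<lambda>f. mass P f k)"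
  unfolding mass_def using assms
  by (intro continuous_map_sum continuous_map_coord) (auto simp: verts_def)

lemma continuous_map_cutoff:
  assumes "k < 3"
  shows "continuous_map (geom_real (verts P) K) euclideanreal (\<lambda>f. cutoff P f k)"
  unfolding cutoff_def
proof (intro continuous_map_real_divide continuous_map_real_max continuous_map_diff continuous_map_sum
    continuous_map_mass assms)
  fix f assume "f \<in> topspace (geom_real (verts P) K)"
  from cutoff_denom[OF mass_total[OF this]]
  show "(\<Sum>l<3. max 0 (mass P f l - 1/4)) \<noteq> 0" by simp
qed (auto intro: continuous_map_mass)

lemma continuous_map_push:
  assumes P: "0 < P"
    and in_band: "\<And>f. f \<in> topspace (band P) \<Longrightarrow>
      supp (verts P) (push P \<mu> f) \<in> band_complex P"
    and \<mu>: "\<And>k. k < 3 \<Longrightarrow> continuous_map (band P) euclideanreal (\<lambda>f. \<mu> f k)"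
    and \<mu>01: "\<And>f k. f \<in> topspace (band P) \<Longrightarrow> k < 3 \<Longrightarrow> 0 \<le> \<mu> f k \<and> \<mu> f k \<le> 1"
  shows "continuous_map (band P) (band P) (push P \<mu>)"
  unfolding continuous_map_into_geom_real
proof (intro conjI ballI)
  fix f assume f: "f \<in> topspace (band P)"
  have "0 \<le> push P \<mu> f v" if vV: "v \<in> verts P" for v
  proof -
    obtain i k where v: "v = (i, k)" "k < 3" using vV by (auto simp: verts_def)
    have "0 \<le> f v" using f vV by (auto simp: topspace_geom_real)
    then have "0 \<le> f (i, k) / max (1/4) (mass P f k)" using v by (intro divide_nonneg_nonneg) auto
    then have "0 \<le> cutoff P f k * ((1 - \<mu> f k) * (f (i, k) / max (1/4) (mass P f k)) + \<mu> f k * (if i = 0 then 1 else 0))"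
      using \<mu>01[OF f v(2)] cutoff_nonneg[of P f k]
      by (intro mult_nonneg_nonneg add_nonneg_nonneg) auto
    then show ?thesis using vV by (simp only: push_def v restrict_apply' prod.case)
  qed
  then show "push P \<mu> f \<in> topspace (band P)"
    using sum_push[OF mass_total[OF f] P] in_band[OF f]
    by (auto simp: topspace_geom_real) (auto simp: push_def)
next
  fix v assume v: "v \<in> verts P"
  then obtain i k where e: "v = (i, k)" "k < 3" by (auto simp: verts_def)
  have "continuous_map (band P) euclideanreal
     (\<lambda>f. cutoff P f k * ((1 - \<mu> f k) * (f (i, k) / max (1/4) (mass P f k)) + \<mu> f k * (if i = 0 then 1 else 0)))"
    using v unfolding e
    by (intro continuous_map_real_mult continuous_map_cutoff continuous_map_add continuous_map_diff \<mu>
        continuous_map_real_divide continuous_map_coord continuous_map_real_max continuous_map_mass e) auto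
  then show "continuous_map (band P) euclideanreal (\<lambda>f. push P \<mu> f v)"
    using v by (simp add: push_def e)
qed

lemma band_contraction:
  assumes P: "0 < P"
  shows "homotopic_with (\<lambda>_. True) (band P)
     (band P) id
     (\<lambda>_. restrict (\<lambda>v. if v = (0, 0) then 1 else 0) (verts P))"
proof -
  let ?V = "verts P" and ?K = "band_complex P"
  let ?M = "geom_real ?V ?K"
  \<comment> \<open>When a block and its successor both survive, \<open>\<mu>2\<close> and
    \<open>\<mu>3\<close> leave the earlier of the two alone: \<open>\<mu>2\<close> starts at mass
    3/4, and \<open>\<mu>3\<close> stops once the successor reaches 1/4. When the successor of a
    block is empty, \<open>\<mu>3\<close> is 1 on that block. Thus \<open>\<mu>3\<close> meets both
    alternatives of the adjacency criterion and links the maps that spare the earlier block with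
    \<open>\<mu>4\<close>, which moves everything.\<close>
  define \<mu>1 :: "(nat \<times> nat \<Rightarrow> real) \<Rightarrow> nat \<Rightarrow> real" where "\<mu>1 = (\<lambda>f k. 0)"
  define \<mu>2 where "\<mu>2 = (\<lambda>f k. max 0 (4 * mass P f k - 3))"
  define \<mu>3 where "\<mu>3 = (\<lambda>f k. max 0 (1 - 4 * mass P f ((k + 1) mod 3)))"
  define \<mu>4 :: "(nat \<times> nat \<Rightarrow> real) \<Rightarrow> nat \<Rightarrow> real" where "\<mu>4 = (\<lambda>f k. 1)"
  have union: "supp ?V (push P \<mu> f) \<union> supp ?V (push P \<mu>' f) \<in> ?K"
    if f: "f \<in> topspace ?M"
     and \<mu>: "\<And>k. k < 3 \<Longrightarrow> mass P f k > 1/4 \<Longrightarrow> mass P f ((k + 1) mod 3) > 1/4 \<Longrightarrow>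
        mass P f ((k + 2) mod 3) = 0 \<Longrightarrow>
        (\<mu> f ((k + 1) mod 3) = 1 \<and> \<mu>' f ((k + 1) mod 3) = 1) \<or> (\<mu> f k = 0 \<and> \<mu>' f k = 0)"
    for \<mu> \<mu>' f
  proof (rule push_union_in_band[where \<mu> = \<mu> and \<mu>' = \<mu>', OF P f _ _ \<mu>])
    fix i k assume "(i, k) \<in> supp ?V (push P \<mu> f) \<union> supp ?V (push P \<mu>' f)"
    then show "i < P \<and> k < 3 \<and> mass P f k > 1/4 \<and>
        ((f (i, k) \<noteq> 0 \<and> (\<mu> f k \<noteq> 1 \<or> \<mu>' f k \<noteq> 1)) \<or> (i = 0 \<and> (\<mu> f k \<noteq> 0 \<or> \<mu>' f k \<noteq> 0)))"
      using supp_push[OF mass_total[OF f], of i k] by blast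
  next
    show "supp ?V (push P \<mu> f) \<union> supp ?V (push P \<mu>' f) \<noteq> {}"
      using supp_nonempty[OF sum_push[OF mass_total[OF f] P]] by blast
  qed
  have lt: "(k + 1) mod 3 < 3" "(k + 1) mod 3 \<noteq> k" if "k < 3" for k :: nat
    using that unfolding less_3_iff by auto
  have le1: "mass P f k \<le> 1" if "f \<in> topspace ?M" "k < 3" for f k
    using mass_pair_le[OF that lt(1)[OF that(2)]] lt(2)[OF that(2)] mass_nonneg[OF that(1) lt(1)[OF that(2)]]
    by linarith
  have 12: "supp ?V (push P \<mu>1 f) \<union> supp ?V (push P \<mu>2 f) \<in> ?K"
    and 23: "supp ?V (push P \<mu>2 f) \<union> supp ?V (push P \<mu>3 f) \<in> ?K"
    and 34: "supp ?V (push P \<mu>3 f) \<union> supp ?V (push P \<mu>4 f) \<in> ?K" if f: "f \<in> topspace ?M" for f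
  proof -
    have small: "\<mu>2 f k = 0" if "k < 3" "mass P f ((k + 1) mod 3) > 1/4" for k
      using mass_pair_le[OF f that(1) lt(1)[OF that(1)]] lt(2)[OF that(1)] that by (simp add: \<mu>2_def)
    show "supp ?V (push P \<mu>1 f) \<union> supp ?V (push P \<mu>2 f) \<in> ?K"
      by (rule union[OF f]) (use small in \<open>auto simp: \<mu>1_def\<close>)
    show "supp ?V (push P \<mu>2 f) \<union> supp ?V (push P \<mu>3 f) \<in> ?K"
      by (rule union[OF f]) (use small in \<open>auto simp: \<mu>3_def\<close>)
    show "supp ?V (push P \<mu>3 f) \<union> supp ?V (push P \<mu>4 f) \<in> ?K"
    proof (rule union[OF f])
      fix k assume k: "k < (3::nat)" "mass P f ((k + 2) mod 3) = 0"
      have "((k + 1) mod 3 + 1) mod 3 = (k + 2) mod 3" using k(1) unfolding less_3_iff by auto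
      then have "\<mu>3 f ((k + 1) mod 3) = 1" by (simp only: \<mu>3_def k(2))
      then show "(\<mu>3 f ((k + 1) mod 3) = 1 \<and> \<mu>4 f ((k + 1) mod 3) = 1) \<or> (\<mu>3 f k = 0 \<and> \<mu>4 f k = 0)"
        by (simp add: \<mu>4_def)
    qed
  qed
  have in_K: "supp ?V (push P \<mu> f) \<in> ?K" if "f \<in> topspace ?M"
    "\<exists>S. supp ?V (push P \<mu> f) \<union> S \<in> ?K" for f \<mu>
    using that supp_nonempty[OF sum_push[OF mass_total[OF that(1)] P]] band_complex_down
    unfolding down_closed_def by blast
  have c1: "continuous_map ?M ?M (push P \<mu>1)"
    by (rule continuous_map_push[OF P in_K]) (use 12 in \<open>auto simp: \<mu>1_def\<close>)
  have c2: "continuous_map ?M ?M (push P \<mu>2)"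
  proof (rule continuous_map_push[OF P in_K])
    show "continuous_map ?M euclideanreal (\<lambda>f. \<mu>2 f k)" if "k < 3" for k
      unfolding \<mu>2_def using that
      by (intro continuous_map_real_max continuous_map_diff continuous_map_real_mult continuous_map_mass) auto
  qed (use 23 le1 in \<open>auto simp: \<mu>2_def\<close>)
  have c3: "continuous_map ?M ?M (push P \<mu>3)"
  proof (rule continuous_map_push[OF P in_K])
    show "continuous_map ?M euclideanreal (\<lambda>f. \<mu>3 f k)" if "k < 3" for k
      unfolding \<mu>3_def using that
      by (intro continuous_map_real_max continuous_map_diff continuous_map_real_mult continuous_map_mass) auto
  qed (use 34 mass_nonneg lt(1) in \<open>auto simp: \<mu>3_def\<close>)
  have c4: "continuous_map ?M ?M (push P \<mu>4)"
    by (rule continuous_map_push[OF P in_K]) (use 34 in \<open>auto simp: \<mu>4_def Un_commute\<close>)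
  note [trans] = homotopic_with_trans
  note contig = homotopic_contiguous[OF finite_verts band_complex_down]
  let ?e = "restrict (\<lambda>v. if v = (0, 0) then 1 else 0) (verts P) :: nat \<times> nat \<Rightarrow> real"
  have tri0: "\<sigma> \<in> ?K" if "\<sigma> \<subseteq> tri 0" "\<sigma> \<noteq> {}" for \<sigma>
    using that band_complex_down tri_in_block[OF P] unfolding down_closed_def band_complex_def by blast
  have z: "(0, 0) \<in> ?V" using P by (simp add: verts_def)
  have se: "supp ?V ?e = {(0, 0)}" using z by (auto simp: supp_def)
  have "sum ?e ?V = 1" using z finite_verts[of P] by (simp add: sum.delta)
  then have e: "?e \<in> topspace ?M"
    using tri0[of "{(0, 0)}"] se by (auto simp: topspace_geom_real tri_def)
  have "homotopic_with (\<lambda>_. True) ?M ?M id (push P \<mu>1)"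
  proof (rule contig[OF continuous_map_id c1])
    fix f assume f: "f \<in> topspace ?M"
    have "supp ?V (push P \<mu>1 f) \<subseteq> supp ?V f"
      by (auto simp: supp_def push_def \<mu>1_def)
    then show "supp ?V (id f) \<union> supp ?V (push P \<mu>1 f) \<in> ?K"
      using f by (simp add: topspace_geom_real Un_absorb2)
  qed
  also have "homotopic_with (\<lambda>_. True) ?M ?M (push P \<mu>1) (push P \<mu>2)" by (rule contig[OF c1 c2 12])
  also have "homotopic_with (\<lambda>_. True) ?M ?M (push P \<mu>2) (push P \<mu>3)" by (rule contig[OF c2 c3 23])
  also have "homotopic_with (\<lambda>_. True) ?M ?M (push P \<mu>3) (push P \<mu>4)" by (rule contig[OF c3 c4 34])
  also have "homotopic_with (\<lambda>_. True) ?M ?M (push P \<mu>4) (\<lambda>_. ?e)"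
  proof (rule contig[OF c4])
    show "continuous_map ?M ?M (\<lambda>_. ?e)" using e by simp
    fix f assume f: "f \<in> topspace ?M"
    have "supp ?V (push P \<mu>4 f) \<subseteq> tri 0"
      using supp_push[OF mass_total[OF f], of _ _ \<mu>4] by (force simp: tri_def \<mu>4_def)
    then show "supp ?V (push P \<mu>4 f) \<union> supp ?V ?e \<in> ?K"
      unfolding se by (intro tri0) (auto simp: tri_def)
  qed
  finally show ?thesis .
qed

subsection \<open>Collapsing the contractible part\<close>

lemma topspace_geom_real_mono:
  "K' \<subseteq> K \<Longrightarrow> topspace (geom_real V K') \<subseteq> topspace (geom_real V K)"
  by (auto simp: topspace_geom_real)

definition tmin :: "nat \<Rightarrow> (nat \<times> nat \<Rightarrow> real) \<Rightarrow> real" where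
  "tmin i f = min (f (i, 0)) (min (f (i, 1)) (f (i, 2)))"

text \<open>Dilation of triangle \<open>i\<close> by the factor \<open>s\<close> about its
  barycentre. The least coordinate becomes \<open>1/3 + s * (tmin i f - 1/3)\<close>, so the image
  lies on the boundary exactly when \<open>s * (1 - 3 * tmin i f) = 1\<close>.\<close>

definition scale :: "nat \<Rightarrow> nat \<Rightarrow> real \<Rightarrow> (nat \<times> nat \<Rightarrow> real) \<Rightarrow> nat \<times> nat \<Rightarrow> real" where
  "scale P i s f = restrict (\<lambda>v. if fst v = i then 1/3 + s * (f v - 1/3) else 0) (verts P)"

lemma sum_tri:
  assumes "i < P" "\<And>v. v \<in> verts P - tri i \<Longrightarrow> g v = 0"
  shows "sum g (verts P) = g (i, 0) + g (i, 1) + g (i, 2)"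
proof -
  have "sum g (verts P) = sum g (tri i)"
    using assms finite_verts[of P]
    by (intro sum.mono_neutral_right) (auto simp: verts_def tri_def)
  also have "tri i = {(i, 0), (i, 1), (i, 2)}" by (auto simp: tri_def)
  finally show ?thesis by (simp add: add.assoc)
qed

lemma tri_real_iff:
  assumes "i < P"
  shows "f \<in> topspace (cell P i) \<longleftrightarrow>
    f \<in> extensional (verts P) \<and> (\<forall>v\<in>verts P. 0 \<le> f v) \<and>
    (\<forall>v\<in>verts P - tri i. f v = 0) \<and> f (i, 0) + f (i, 1) + f (i, 2) = 1"
    (is "?l \<longleftrightarrow> ?r")
proof
  assume l: ?l
  then have z: "\<forall>v\<in>verts P - tri i. f v = 0"
    by (auto simp: topspace_geom_real tri_complex_def supp_def)
  then show ?r using l sum_tri[OF assms, of f] by (simp add: topspace_geom_real)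
next
  assume r: ?r
  then have "sum f (verts P) = 1" using sum_tri[OF assms, of f] by simp
  moreover from this have "supp (verts P) f \<in> tri_complex i"
    using supp_nonempty[of f] r by (auto simp: tri_complex_def supp_def)
  ultimately show ?l using r by (simp add: topspace_geom_real)
qed

lemma tri_mem: "i < P \<Longrightarrow> (i, 0) \<in> verts P" "i < P \<Longrightarrow> (i, 1) \<in> verts P"
    "i < P \<Longrightarrow> (i, 2) \<in> verts P"
  by (auto simp: verts_def)

lemma tmin_bounds:
  assumes "i < P" "f \<in> topspace (cell P i)"
  shows "0 \<le> tmin i f" "tmin i f \<le> 1/3"
  using assms tri_mem[OF assms(1)] unfolding tri_real_iff[OF assms(1)] tmin_def by auto

lemma scale_in_tri:
  assumes i: "i < P" and f: "f \<in> topspace (cell P i)"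
    and s: "0 \<le> s" "s * (1 - 3 * tmin i f) \<le> 1"
  shows "scale P i s f \<in> topspace (cell P i)"
proof -
  have "0 \<le> 1/3 + s * (f (i, k) - 1/3)" if "k < 3" for k
  proof -
    have "tmin i f \<le> f (i, k)" using that unfolding less_3_iff tmin_def by auto
    then have "s * (tmin i f - 1/3) \<le> s * (f (i, k) - 1/3)" using s by (intro mult_left_mono) auto
    then show ?thesis using s(2) by (simp add: algebra_simps)
  qed
  moreover have "1/3 + s * (f (i, 0) - 1/3) + (1/3 + s * (f (i, 1) - 1/3)) + (1/3 + s * (f (i, 2) - 1/3))
      = 1 + s * (f (i, 0) + f (i, 1) + f (i, 2) - 1)"
    by (simp add: algebra_simps)
  ultimately show ?thesis
    using f tri_mem[OF i] unfolding tri_real_iff[OF i]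
    by (auto simp: scale_def) (auto simp: verts_def tri_def)
qed

text \<open>A face of triangle \<open>i\<close> lies in the band as soon as it misses a block, that
  is, when one coordinate vanishes. The index 0 is excluded because the band contains that triangle
  whole.\<close>

lemma tri_inter_band:
  assumes i: "0 < i" "i < P" and f: "f \<in> topspace (cell P i)"
  shows "f \<in> topspace (band P) \<longleftrightarrow> tmin i f = 0"
proof -
  have nn: "0 \<le> f (i, 0)" "0 \<le> f (i, 1)" "0 \<le> f (i, 2)"
    using f tri_mem[OF i(2)] by (auto simp: topspace_geom_real)
  have S: "supp (verts P) f \<subseteq> tri i" "supp (verts P) f \<in> block_complex P"
    using f tri_complex_sub[OF i(2)] by (auto simp: topspace_geom_real tri_complex_def)
  then have nt: "supp (verts P) f \<noteq> tri 0" using i by (auto simp: tri_def lessThan_3)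
  have mem: "(j, k) \<notin> supp (verts P) f" if "j \<noteq> i" for j k
    using S(1) that by (auto simp: tri_def)
  have "f \<in> topspace (band P) \<longleftrightarrow>
     (\<exists>k<3. \<forall>j. (j, k) \<notin> supp (verts P) f)"
    using f S(2) nt by (auto simp: topspace_geom_real band_complex_def)
  also have "\<dots> \<longleftrightarrow> (\<exists>k<3. f (i, k) = 0)"
  proof (intro ex_cong1 conj_cong refl iffI allI)
    fix k :: nat assume "k < 3" "\<forall>j. (j, k) \<notin> supp (verts P) f"
    then show "f (i, k) = 0" using i by (auto simp: supp_def verts_def)
  next
    fix k j :: nat assume "f (i, k) = 0"
    then show "(j, k) \<notin> supp (verts P) f" using mem[of j k] by (cases "j = i") (auto simp: supp_def)
  qed
  also have "\<dots> \<longleftrightarrow> tmin i f = 0"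
    using nn unfolding less_3_iff tmin_def by (auto simp: min_def)
  finally show ?thesis .
qed

lemma scale_in_band:
  assumes i: "0 < i" "i < P" and f: "f \<in> topspace (cell P i)"
    and s: "0 \<le> s" "s * (1 - 3 * tmin i f) = 1"
  shows "scale P i s f \<in> topspace (band P)"
proof -
  have "tmin i (scale P i s f) = 1/3 + s * (tmin i f - 1/3)"
    using tri_mem[OF i(2)] s(1) unfolding tmin_def scale_def
    by (auto simp: min_def mult_le_cancel_left)
  also have "\<dots> = 0" using s(2) by (simp add: algebra_simps)
  finally show ?thesis
    using tri_inter_band[OF i scale_in_tri[OF i(2) f s(1)]] s(2) by simp
qed

lemma continuous_map_tmin:
  assumes "i < P"
  shows "continuous_map (geom_real (verts P) K) euclideanreal (tmin i)"
  unfolding tmin_def using tri_mem[OF assms]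
  by (intro continuous_map_real_min continuous_map_coord)

lemma tri_disjoint:
  assumes "i < P" "f \<in> topspace (cell P i)"
    "f \<in> topspace (cell P j)"
  shows "i = j"
proof -
  have "supp (verts P) f \<subseteq> tri i \<inter> tri j" "supp (verts P) f \<noteq> {}"
    using assms by (auto simp: topspace_geom_real tri_complex_def)
  then show ?thesis by (auto simp: tri_def)
qed

lemma not_band_in_tri:
  assumes "f \<in> topspace (blocks P)"
    "f \<notin> topspace (band P)"
  obtains i where "0 < i" "i < P" "f \<in> topspace (cell P i)"
proof -
  have "supp (verts P) f \<in> block_complex P" "supp (verts P) f \<notin> band_complex P"
    using assms by (auto simp: topspace_geom_real)
  then obtain i where i: "0 < i" "i < P" "supp (verts P) f = tri i"
    by (rule block_complex_cases')
  then have "f \<in> topspace (cell P i)"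
    using assms(1) by (auto simp: topspace_geom_real tri_complex_def tri_def lessThan_3)
  with i show thesis using that by blast
qed

text \<open>An explicit homotopy extension. At time \<open>t\<close> a point of triangle
  \<open>i\<close> is dilated by \<open>1 + t\<close>; a point that would leave the triangle is
  projected radially to the boundary, and the excess is spent as time in the given homotopy
  \<open>h\<close>. On the boundary itself the excess is \<open>t\<close>, so there the extension
  agrees with \<open>h\<close>.\<close>

lemma extend_contraction:
  assumes P: "0 < P"
    and h: "continuous_map (prod_topology (top_of_set {0..1::real}) (band P))
       (band P) h"
    and h0: "\<And>f. f \<in> topspace (band P) \<Longrightarrow> h (0, f) = f"
  obtains H where "continuous_map (prod_topology (top_of_set {0..1::real}) (blocks P))
       (blocks P) H"
    "\<And>f. f \<in> topspace (blocks P) \<Longrightarrow> H (0, f) = f"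
    "\<And>t f. t \<in> {0..1} \<Longrightarrow> f \<in> topspace (band P) \<Longrightarrow> H (t, f) = h (t, f)"
proof -
  let ?V = "verts P" and ?I = "top_of_set {0..1::real}"
  let ?L = "blocks P" and ?B = "band P"
  let ?T = "cell P"
  define E where "E i = (\<lambda>z. if (1 + fst z) * (1 - 3 * tmin i (snd z)) \<le> 1 then scale P i (1 + fst z) (snd z)
      else h ((1 + fst z) * (1 - 3 * tmin i (snd z)) - 1, scale P i (1 / (1 - 3 * tmin i (snd z))) (snd z)))" for i
  \<comment> \<open>Index 0 is free to denote the band, since triangle 0 is part of it. The parts
    are finitely many closed sets, which permits pasting.\<close>
  define part where "part i = (if i = 0 then {0..1::real} \<times> topspace ?B else {0..1} \<times> topspace (?T i))" for i
  define F where "F i = (if i = 0 then h else E i)" for i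
  have BL: "topspace ?B \<subseteq> topspace ?L" and Bsub: "subtopology ?L (topspace ?B) = ?B"
    using band_complex_sub[of P] by (simp_all add: geom_real_subcomplex[symmetric] topspace_geom_real_mono)
  have TL: "topspace (?T i) \<subseteq> topspace ?L" and Tsub: "subtopology ?L (topspace (?T i)) = ?T i" if "i < P" for i
    using tri_complex_sub[OF that] by (simp_all add: geom_real_subcomplex[symmetric] topspace_geom_real_mono)
  have intoL: "continuous_map X ?L g" if "continuous_map X ?B g" for X :: "(real \<times> (nat \<times> nat \<Rightarrow> real)) topology" and g
    using that Bsub continuous_map_into_fulltopology by metis
  have contE: "continuous_map (prod_topology ?I (?T i)) ?L (E i)" if i: "0 < i" "i < P" for i
    unfolding E_def
  proof (rule continuous_map_cases_le)
    let ?Z = "prod_topology ?I (?T i)"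
    let ?p = "\<lambda>z. (1 + fst z) * (1 - 3 * tmin i (snd z))"
    have cf: "continuous_map ?Z euclideanreal fst"
      by (rule continuous_map_into_fulltopology[OF continuous_map_fst])
    have cm: "continuous_map ?Z euclideanreal (\<lambda>z. tmin i (snd z))"
      using continuous_map_compose[OF continuous_map_snd continuous_map_tmin[OF i(2)]] by (simp add: o_def)
    have cv: "continuous_map ?Z euclideanreal (\<lambda>z. snd z v)" if "v \<in> ?V" for v
      using continuous_map_compose[OF continuous_map_snd continuous_map_coord[OF that]] by (simp add: o_def)
    show cp: "continuous_map ?Z euclideanreal ?p"
      by (intro continuous_map_real_mult continuous_map_add continuous_map_diff cf cm) auto
    show "continuous_map ?Z euclideanreal (\<lambda>_. 1)" by simp
    show "continuous_map (subtopology ?Z {z \<in> topspace ?Z. ?p z \<le> 1}) ?L (\<lambda>z. scale P i (1 + fst z) (snd z))"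
      unfolding continuous_map_into_geom_real
    proof (intro conjI ballI)
      fix z assume "z \<in> topspace (subtopology ?Z {z \<in> topspace ?Z. ?p z \<le> 1})"
      then have z: "0 \<le> fst z" "snd z \<in> topspace (?T i)" "?p z \<le> 1" by auto
      have "scale P i (1 + fst z) (snd z) \<in> topspace (?T i)"
        using z by (intro scale_in_tri i) auto
      then show "scale P i (1 + fst z) (snd z) \<in> topspace ?L" using TL[OF i(2)] by blast
    next
      fix v assume v: "v \<in> ?V"
      show "continuous_map (subtopology ?Z {z \<in> topspace ?Z. ?p z \<le> 1}) euclideanreal
         (\<lambda>z. scale P i (1 + fst z) (snd z) v)"
      proof (cases "fst v = i")
        case True
        have "continuous_map ?Z euclideanreal (\<lambda>z. 1/3 + (1 + fst z) * (snd z v - 1/3))"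
          by (intro continuous_map_add continuous_map_real_mult continuous_map_diff cf cv v) auto
        then show ?thesis
          using True v by (simp add: scale_def continuous_map_from_subtopology)
      qed (use v in \<open>simp add: scale_def\<close>)
    qed
    let ?Z2 = "subtopology ?Z {z \<in> topspace ?Z. 1 \<le> ?p z}"
    \<comment> \<open>The bounds 1 and 2 on the product make its excess over 1 a legal time for
      \<open>h\<close>, and the positive factor makes the radial projection defined.\<close>
    have Z2: "0 \<le> fst z" "fst z \<le> 1" "snd z \<in> topspace (?T i)" "1 \<le> ?p z" "0 < 1 - 3 * tmin i (snd z)"
        "?p z \<le> 2" if "z \<in> topspace ?Z2" for z
    proof -
      show z: "0 \<le> fst z" "fst z \<le> 1" "snd z \<in> topspace (?T i)" "1 \<le> ?p z" using that by auto
      have "?p z > 0" using z(4) by linarith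
      then show "0 < 1 - 3 * tmin i (snd z)" using z(1) by (simp add: zero_less_mult_iff)
      have "?p z \<le> 2 * 1" using z tmin_bounds[OF i(2) z(3)] by (intro mult_mono) auto
      then show "?p z \<le> 2" by simp
    qed
    have 1: "continuous_map ?Z2 ?I (\<lambda>z. ?p z - 1)"
      unfolding continuous_map_in_subtopology using Z2(4,6)
      by (auto intro!: continuous_map_from_subtopology[OF continuous_map_diff] cp simp del: topspace_subtopology)
    have 2: "continuous_map ?Z2 ?B (\<lambda>z. scale P i (1 / (1 - 3 * tmin i (snd z))) (snd z))"
      unfolding continuous_map_into_geom_real
    proof (intro conjI ballI)
      fix z assume z: "z \<in> topspace ?Z2"
      show "scale P i (1 / (1 - 3 * tmin i (snd z))) (snd z) \<in> topspace ?B"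
        using Z2(5)[OF z] by (intro scale_in_band i Z2(3)[OF z]) simp_all
    next
      fix v assume v: "v \<in> ?V"
      have c: "continuous_map ?Z2 euclideanreal (\<lambda>z. 1 / (1 - 3 * tmin i (snd z)))"
      proof (intro continuous_map_real_divide continuous_map_diff continuous_map_real_mult
          continuous_map_from_subtopology[OF cm])
        show "1 - 3 * tmin i (snd z) \<noteq> 0" if "z \<in> topspace ?Z2" for z using Z2(5)[OF that] by simp
      qed auto
      show "continuous_map ?Z2 euclideanreal
         (\<lambda>z. scale P i (1 / (1 - 3 * tmin i (snd z))) (snd z) v)"
      proof (cases "fst v = i")
        case True
        have "continuous_map ?Z2 euclideanreal (\<lambda>z. 1/3 + 1 / (1 - 3 * tmin i (snd z)) * (snd z v - 1/3))"
          by (intro continuous_map_add continuous_map_real_mult continuous_map_diff c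
              continuous_map_from_subtopology[OF cv[OF v]]) auto
        then show ?thesis
          by (simp only: scale_def restrict_apply'[OF v] True if_True simp_thms)
      qed (use v in \<open>simp add: scale_def\<close>)
    qed
    show "continuous_map ?Z2 ?L (\<lambda>z. h (?p z - 1, scale P i (1 / (1 - 3 * tmin i (snd z))) (snd z)))"
      using intoL[OF continuous_map_compose[OF continuous_map_pairedI[OF 1 2] h]] by (simp add: o_def)
    fix z assume z: "z \<in> topspace ?Z" "?p z = 1"
    then have z2: "z \<in> topspace ?Z2" by auto
    then have "scale P i (1 / (1 - 3 * tmin i (snd z))) (snd z) \<in> topspace ?B"
      using 2 unfolding continuous_map_into_geom_real by blast
    then have "h (?p z - 1, scale P i (1 / (1 - 3 * tmin i (snd z))) (snd z)) = scale P i (1 / (1 - 3 * tmin i (snd z))) (snd z)"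
      using z(2) by (simp add: h0)
    moreover have "1 / (1 - 3 * tmin i (snd z)) = 1 + fst z"
      using z(2) Z2(5)[OF z2] by (simp add: field_simps)
    ultimately show "scale P i (1 + fst z) (snd z) = h (?p z - 1, scale P i (1 / (1 - 3 * tmin i (snd z))) (snd z))"
      by simp
  qed
  have scale1: "scale P i 1 f = f" if "f \<in> topspace (?T i)" "i < P" for i f
    using that unfolding tri_real_iff[OF that(2)]
    by (auto simp: scale_def fun_eq_iff extensional_def tri_def verts_def)
  have E0: "E i (0, f) = f" if "f \<in> topspace (?T i)" "i < P" for i f
    using tmin_bounds[OF that(2,1)] scale1[OF that] by (auto simp: E_def)
  have Eh: "E i (t, f) = h (t, f)"
    if "f \<in> topspace (?T i)" "f \<in> topspace ?B" "0 < i" "i < P" "t \<in> {0..1}" for i f t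
  proof -
    have "tmin i f = 0" using tri_inter_band[OF that(3,4,1)] that(2) by simp
    then show ?thesis using that(5) scale1[OF that(1,4)] h0[OF that(2)]
      by (cases "t = 0") (auto simp: E_def)
  qed
  obtain H where H: "continuous_map (prod_topology ?I ?L) ?L H"
     "\<And>z i. i \<in> {..<P} \<Longrightarrow> z \<in> topspace (prod_topology ?I ?L) \<inter> part i \<Longrightarrow> H z = F i z"
  proof (rule pasting_lemma_exists_closed[where X = "prod_topology ?I ?L" and Y = ?L and I = "{..<P}" and T = part and f = F])
    show "topspace (prod_topology ?I ?L) \<subseteq> \<Union>(part ` {..<P})"
    proof
      fix z assume z: "z \<in> topspace (prod_topology ?I ?L)"
      show "z \<in> \<Union>(part ` {..<P})"
      proof (cases "snd z \<in> topspace ?B")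
        case True
        then show ?thesis using z P by (intro UN_I[of 0]) (auto simp: part_def mem_Times_iff)
      next
        case False
        then obtain i where "0 < i" "i < P" "snd z \<in> topspace (?T i)"
          using not_band_in_tri z by (metis mem_Times_iff topspace_prod_topology)
        then show ?thesis using z by (intro UN_I[of i]) (auto simp: part_def mem_Times_iff)
      qed
    qed
    show "closedin (prod_topology ?I ?L) (part i)" if "i \<in> {..<P}" for i
      using that closedin_geom_real[OF finite_verts band_complex_down band_complex_sub]
        closedin_geom_real[OF finite_verts tri_complex_down tri_complex_sub]
        closedin_topspace[of ?I]
      by (auto simp: part_def closedin_prod_Times_iff)
    show "continuous_map (subtopology (prod_topology ?I ?L) (part i)) ?L (F i)" if "i \<in> {..<P}" for i
      using that intoL[OF h] contE[of i]
      by (auto simp: part_def F_def subtopology_Times subtopology_subtopology Bsub Tsub)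
    show "F i z = F j z" if "i \<in> {..<P}" "j \<in> {..<P}" "z \<in> topspace (prod_topology ?I ?L) \<inter> part i \<inter> part j" for i j z
    proof -
      obtain t f where z: "z = (t, f)" by force
      show ?thesis
        using that Eh[of f i t] Eh[of f j t] tri_disjoint[of i P f j]
        by (cases "i = 0"; cases "j = 0") (auto simp: z part_def F_def)
    qed
  qed auto
  show thesis
  proof (rule that[OF H(1)])
    fix t f assume "t \<in> {0..1::real}" "f \<in> topspace ?B"
    then show "H (t, f) = h (t, f)" using H(2)[of 0 "(t, f)"] P BL by (auto simp: part_def F_def)
  next
    fix f assume f: "f \<in> topspace ?L"
    show "H (0, f) = f"
    proof (cases "f \<in> topspace ?B")
      case True
      then show ?thesis using H(2)[of 0 "(0, f)"] P f h0 by (auto simp: part_def F_def)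
    next
      case False
      then obtain i where "0 < i" "i < P" "f \<in> topspace (?T i)"
        using not_band_in_tri f by blast
      then show ?thesis using H(2)[of i "(0, f)"] f E0[of f i] by (auto simp: part_def F_def)
    qed
  qed
qed

section \<open>Mapping the triangles onto tangent spheres\<close>

lemma in_sphere_iff:
  assumes "0 \<le> c"
  shows "(x, y, z) \<in> sphere (c, 0, 0) c \<longleftrightarrow> x\<^sup>2 + y\<^sup>2 + z\<^sup>2 = 2 * c * (x::real)"
proof -
  have "(x, y, z) \<in> sphere (c, 0, 0) c \<longleftrightarrow> sqrt ((c - x)\<^sup>2 + (y\<^sup>2 + z\<^sup>2)) = c"
    by (simp add: dist_Pair_Pair dist_real_def)
  also have "\<dots> \<longleftrightarrow> (c - x)\<^sup>2 + (y\<^sup>2 + z\<^sup>2) = c\<^sup>2"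
  proof -
    have "c = sqrt (c\<^sup>2)" using assms by simp
    then show ?thesis by (metis real_sqrt_eq_iff)
  qed
  also have "\<dots> \<longleftrightarrow> x\<^sup>2 + y\<^sup>2 + z\<^sup>2 = 2 * c * x"
    by (auto simp: power2_eq_square algebra_simps)
  finally show ?thesis .
qed

text \<open>Inversion in the origin turns the sphere of radius \<open>i\<close> through the origin into the plane at
  height \<open>1/(2i)\<close>. The open triangle is mapped radially onto that plane by \<open>w / m\<close>, where \<open>w\<close> is the
  offset from the barycentre and \<open>m\<close> the least barycentric coordinate; the inverted point is
  \<open>(m\<^sup>2/(2i), m w) / qden\<close>. The last summand of \<open>qden\<close> vanishes on the triangle and keeps the
  formula continuous elsewhere.\<close>

definition qden :: "nat \<Rightarrow> (nat \<times> nat \<Rightarrow> real) \<Rightarrow> real" where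
  "qden i f = (tmin i f)\<^sup>2 / (4 * (real i)\<^sup>2) + (f (i, 0) - 1/3)\<^sup>2 + (f (i, 1) - 1/3)\<^sup>2
     + (1 - f (i, 0) - f (i, 1) - f (i, 2))\<^sup>2"

definition q0 :: "nat \<Rightarrow> (nat \<times> nat \<Rightarrow> real) \<Rightarrow> real" where
  "q0 i f = (tmin i f)\<^sup>2 / (2 * real i) / qden i f"

definition q12 :: "nat \<Rightarrow> nat \<Rightarrow> (nat \<times> nat \<Rightarrow> real) \<Rightarrow> real" where
  "q12 k i f = tmin i f * (f (i, k) - 1/3) / qden i f"

definition collapse :: "nat \<Rightarrow> (nat \<times> nat \<Rightarrow> real) \<Rightarrow> real \<times> real \<times> real" where
  "collapse P f = (\<Sum>i\<in>{1..<P}. q0 i f, \<Sum>i\<in>{1..<P}. q12 0 i f, \<Sum>i\<in>{1..<P}. q12 1 i f)"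

text \<open>If all four squares vanished, every coordinate would be 1/3, and then the least
  coordinate could not be 0.\<close>

lemma qden_pos:
  assumes "0 < i"
  shows "qden i f > 0"
proof (rule ccontr)
  assume "\<not> qden i f > 0"
  moreover have "qden i f \<ge> 0" by (simp add: qden_def)
  ultimately have z: "qden i f = 0" by simp
  have "(tmin i f)\<^sup>2 / (4 * (real i)\<^sup>2) \<ge> 0" by simp
  with z have "(tmin i f)\<^sup>2 / (4 * (real i)\<^sup>2) = 0 \<and> (f (i, 0) - 1/3)\<^sup>2 = 0 \<and> (f (i, 1) - 1/3)\<^sup>2 = 0
     \<and> (1 - f (i, 0) - f (i, 1) - f (i, 2))\<^sup>2 = 0"
    unfolding qden_def by (simp only: add_nonneg_eq_0_iff zero_le_power2 add_nonneg_nonneg)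
  then have "tmin i f = 0" "f (i, 0) = 1/3" "f (i, 1) = 1/3" "f (i, 2) = 1/3" using assms by auto
  then show False by (simp add: tmin_def)
qed

lemma continuous_map_collapse:
  "continuous_map (geom_real (verts P) K) euclidean (collapse P)"
proof -
  have c: "continuous_map (geom_real (verts P) K) euclideanreal (\<lambda>f. f (i, 0))"
      "continuous_map (geom_real (verts P) K) euclideanreal (\<lambda>f. f (i, 1))"
      "continuous_map (geom_real (verts P) K) euclideanreal (\<lambda>f. f (i, 2))"
      "continuous_map (geom_real (verts P) K) euclideanreal (tmin i)"
    if "i \<in> {1..<P}" for i
    using that tri_mem[of i P] continuous_map_tmin by (auto intro!: continuous_map_coord)
  have d: "continuous_map (geom_real (verts P) K) euclideanreal (qden i)" if "i \<in> {1..<P}" for i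
    unfolding qden_def using that
    by (intro continuous_map_add continuous_map_diff continuous_map_real_pow continuous_map_real_divide c) auto
  have nz: "qden i f \<noteq> 0" if "i \<in> {1..<P}" for i f using qden_pos[of i f] that by simp
  have "continuous_map (geom_real (verts P) K) euclideanreal (\<lambda>f. \<Sum>i\<in>{1..<P}. q0 i f)"
    unfolding q0_def using nz
    by (intro continuous_map_sum continuous_map_real_divide continuous_map_real_pow c d) auto
  moreover have "continuous_map (geom_real (verts P) K) euclideanreal (\<lambda>f. \<Sum>i\<in>{1..<P}. q12 0 i f)"
    unfolding q12_def using nz
    by (intro continuous_map_sum continuous_map_real_divide continuous_map_real_mult continuous_map_diff c d) auto
  moreover have "continuous_map (geom_real (verts P) K) euclideanreal (\<lambda>f. \<Sum>i\<in>{1..<P}. q12 1 i f)"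
    unfolding q12_def using nz
    by (intro continuous_map_sum continuous_map_real_divide continuous_map_real_mult continuous_map_diff c d) auto
  ultimately have "continuous_map (geom_real (verts P) K)
     (prod_topology euclideanreal (prod_topology euclideanreal euclideanreal)) (collapse P)"
    unfolding collapse_def by (intro continuous_map_pairedI)
  then show ?thesis by simp
qed

lemma collapse_band:
  assumes "f \<in> topspace (band P)"
  shows "collapse P f = (0, 0, 0)"
proof -
  have "tmin i f = 0" if "i \<in> {1..<P}" for i
  proof -
    have i: "0 < i" "i < P" using that by auto
    have nn: "0 \<le> f (i, 0)" "0 \<le> f (i, 1)" "0 \<le> f (i, 2)"
      using assms tri_mem[OF i(2)] by (auto simp: topspace_geom_real)
    have S: "supp (verts P) f \<in> band_complex P" using assms by (simp add: topspace_geom_real)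
    have "\<exists>k<3. (i, k) \<notin> supp (verts P) f"
    proof (cases "supp (verts P) f = tri 0")
      case True
      then show ?thesis using i by (intro exI[of _ 0]) (simp add: tri_def)
    next
      case False
      then show ?thesis using S unfolding band_complex_def by blast
    qed
    then have "\<exists>k<3. f (i, k) = 0" using i by (auto simp: supp_def verts_def)
    then show ?thesis using nn unfolding less_3_iff tmin_def by (auto simp: min_def)
  qed
  then show ?thesis by (auto simp: collapse_def q0_def q12_def)
qed

lemma collapse_tri:
  assumes i: "0 < i" "i < P" and f: "f \<in> topspace (cell P i)"
  shows "collapse P f = (q0 i f, q12 0 i f, q12 1 i f)"
proof -
  have z: "tmin j f = 0" if "j \<in> {1..<P}" "j \<noteq> i" for j
    using f that tri_mem[of j P] unfolding tri_real_iff[OF i(2)] by (auto simp: tmin_def tri_def)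
  have "(\<Sum>j\<in>{1..<P}. q0 j f) = (\<Sum>j\<in>{i}. q0 j f)"
    by (rule sum.mono_neutral_right) (use i z in \<open>auto simp: q0_def\<close>)
  moreover have "(\<Sum>j\<in>{1..<P}. q12 k j f) = (\<Sum>j\<in>{i}. q12 k j f)" for k
    by (rule sum.mono_neutral_right) (use i z in \<open>auto simp: q12_def\<close>)
  ultimately show ?thesis by (simp add: collapse_def)
qed

lemma collapse_tri_sphere:
  assumes i: "0 < i" "i < P" and f: "f \<in> topspace (cell P i)"
  shows "collapse P f \<in> sphere (real i, 0, 0) (real i)"
    and "collapse P f = (x, y, z) \<Longrightarrow> x\<^sup>2 + y\<^sup>2 + z\<^sup>2 = 2 * real i * x"
proof -
  define d where "d = qden i f"
  define m where "m = tmin i f"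
  define w0 where "w0 = f (i, 0) - 1/3"
  define w1 where "w1 = f (i, 1) - 1/3"
  have d: "d > 0" using qden_pos[OF i(1)] by (simp add: d_def)
  have "1 - f (i, 0) - f (i, 1) - f (i, 2) = 0"
    using f unfolding tri_real_iff[OF i(2)] by simp
  then have dd: "d = m\<^sup>2 / (4 * (real i)\<^sup>2) + w0\<^sup>2 + w1\<^sup>2"
    by (simp add: d_def qden_def m_def w0_def w1_def)
  have "(m\<^sup>2 / (2 * real i) / d)\<^sup>2 + (m * w0 / d)\<^sup>2 + (m * w1 / d)\<^sup>2 =
      m\<^sup>2 * (m\<^sup>2 / (4 * (real i)\<^sup>2) + w0\<^sup>2 + w1\<^sup>2) / d\<^sup>2"
    by (simp add: power_divide power_mult_distrib add_divide_distrib algebra_simps power2_eq_square)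
  also have "\<dots> = m\<^sup>2 / d" unfolding dd[symmetric] using d by (simp add: power2_eq_square)
  also have "\<dots> = 2 * real i * (m\<^sup>2 / (2 * real i) / d)" using i by simp
  finally have *: "(q0 i f)\<^sup>2 + (q12 0 i f)\<^sup>2 + (q12 1 i f)\<^sup>2 = 2 * real i * q0 i f"
    by (simp add: q0_def q12_def d_def m_def w0_def w1_def)
  then show "collapse P f \<in> sphere (real i, 0, 0) (real i)"
    unfolding collapse_tri[OF assms] by (subst in_sphere_iff) auto
  show "x\<^sup>2 + y\<^sup>2 + z\<^sup>2 = 2 * real i * x" if "collapse P f = (x, y, z)"
    using that * unfolding collapse_tri[OF assms] by auto
qed

text \<open>Equal images make both the offsets from the barycentre and the least coordinates
  proportional with the same factor \<open>s\<close>. But a least coordinate is 1/3 plus an offset,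
  and the constant 1/3 forces \<open>s = 1\<close>.\<close>

lemma collapse_tri_inj:
  assumes i: "0 < i" "i < P" and f: "f \<in> topspace (cell P i)"
    and g: "g \<in> topspace (cell P i)"
    and mf: "tmin i f > 0" and mg: "tmin i g > 0"
    and eq: "collapse P f = collapse P g"
  shows "f = g"
proof -
  define s where "s = tmin i f / tmin i g"
  have s: "s > 0" "tmin i f = s * tmin i g" using mf mg by (simp_all add: s_def)
  have df: "qden i f > 0" "qden i g > 0" using qden_pos[OF i(1)] by auto
  have e: "q0 i f = q0 i g" "q12 0 i f = q12 0 i g" "q12 1 i f = q12 1 i g"
    using eq unfolding collapse_tri[OF i f] collapse_tri[OF i g] by auto
  have e0: "(tmin i f)\<^sup>2 / qden i f = (tmin i g)\<^sup>2 / qden i g"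
  proof -
    have "q0 i u = (tmin i u)\<^sup>2 / qden i u / (2 * real i)" for u by (simp add: q0_def)
    then show ?thesis using e(1) i(1) by (metis divide_cancel_right mult_eq_0_iff of_nat_eq_0_iff less_irrefl zero_neq_numeral)
  qed
  have "s\<^sup>2 * qden i g = qden i f" using e0 mg df
    by (simp add: s(2) field_simps power_mult_distrib) 
  have w: "f (i, k) - 1/3 = s * (g (i, k) - 1/3)" if "q12 k i f = q12 k i g" for k
  proof -
    have "tmin i f * (f (i, k) - 1/3) / (s\<^sup>2 * qden i g) = tmin i g * (g (i, k) - 1/3) / qden i g"
      using that \<open>s\<^sup>2 * qden i g = qden i f\<close> by (simp add: q12_def)
    then have "tmin i g / (s * qden i g) * (f (i, k) - 1/3) = tmin i g / (s * qden i g) * (s * (g (i, k) - 1/3))"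
      using mg df s(1) by (simp add: s(2) power2_eq_square)
    moreover have "tmin i g / (s * qden i g) \<noteq> 0" using mg df s(1) by simp
    ultimately show ?thesis using mult_left_cancel by blast
  qed
  have w01: "f (i, 0) - 1/3 = s * (g (i, 0) - 1/3)" "f (i, 1) - 1/3 = s * (g (i, 1) - 1/3)"
    using w e by auto
  have sf: "f (i, 0) + f (i, 1) + f (i, 2) = 1" "g (i, 0) + g (i, 1) + g (i, 2) = 1"
    using f g unfolding tri_real_iff[OF i(2)] by auto
  have "f (i, 2) - 1/3 = - (f (i, 0) - 1/3) - (f (i, 1) - 1/3)" using sf by simp
  also have "\<dots> = s * (- (g (i, 0) - 1/3) - (g (i, 1) - 1/3))" unfolding w01 by (simp add: algebra_simps)
  also have "- (g (i, 0) - 1/3) - (g (i, 1) - 1/3) = g (i, 2) - 1/3" using sf by simp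
  finally have w2: "f (i, 2) - 1/3 = s * (g (i, 2) - 1/3)" .
  have "tmin i f = 1/3 + s * (tmin i g - 1/3)"
  proof -
    have "f (i, k) = 1/3 + s * (g (i, k) - 1/3)" if "k = 0 \<or> k = 1 \<or> k = 2" for k
      using that w01 w2 by auto
    then show ?thesis using s(1) unfolding tmin_def
      by (auto simp: min_def mult_le_cancel_left)
  qed
  then have "s = 1" unfolding s(2) by (simp add: algebra_simps)
  then have k: "f (i, k) = g (i, k)" if "k < 3" for k
    using that w01 w2 unfolding less_3_iff by auto
  show "f = g"
  proof
    fix v show "f v = g v"
    proof (cases "v \<in> tri i")
      case True
      then show ?thesis using k by (auto simp: tri_def)
    next
      case False
      then show ?thesis
        using f g extensional_arb[of f "verts P" v] extensional_arb[of g "verts P" v] unfolding tri_real_iff[OF i(2)]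
        by (cases "v \<in> verts P") simp_all
    qed
  qed
qed

lemma collapse_surj:
  assumes i: "0 < i" "i < P" and xyz: "x\<^sup>2 + y\<^sup>2 + z\<^sup>2 = 2 * real i * x" "x \<noteq> 0"
  obtains f where "f \<in> topspace (cell P i)" "collapse P f = (x, y, z)"
proof -
  have "2 * real i * x \<ge> 0" unfolding xyz(1)[symmetric] by simp
  then have x: "x > 0" using xyz(2) i(1) by (simp add: zero_le_mult_iff)
  \<comment> \<open>By the sphere equation \<open>c\<close> is the squared norm of the target, so
    \<open>y / c\<close> and \<open>z / c\<close> are planar coordinates of its inverse. They
    prescribe the offsets divided by the least coordinate \<open>m\<close>; the third offset makes
    the sum zero, and \<open>m\<close> is the solution of
    \<open>1/3 + m * \<mu> = m\<close>.\<close>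
  define c where "c = 2 * real i * x"
  have c: "c > 0" using x i by (simp add: c_def)
  define u where "u k = (if k = 0 then y / c else if k = 1 then z / c else - y / c - z / c)" for k :: nat
  define \<mu> where "\<mu> = min (u 0) (min (u 1) (u 2))"
  have us: "u 0 + u 1 + u 2 = 0" by (simp add: u_def)
  have "\<mu> \<le> 0" using us unfolding \<mu>_def by linarith
  define m where "m = 1 / (3 * (1 - \<mu>))"
  have m: "m > 0" "1/3 + m * \<mu> = m" using \<open>\<mu> \<le> 0\<close> by (auto simp: m_def field_simps)
  define f where "f = restrict (\<lambda>v. if fst v = i then 1/3 + m * u (snd v) else 0) (verts P)"
  have fk: "f (i, k) = 1/3 + m * u k" if "k < 3" for k
    using that i by (simp add: f_def verts_def)
  have mt: "tmin i f = m"
  proof -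
    have "tmin i f = 1/3 + m * \<mu>" unfolding tmin_def \<mu>_def using m(1) fk[of 0] fk[of 1] fk[of 2]
      by (auto simp: min_def mult_le_cancel_left)
    then show ?thesis using m(2) by simp
  qed
  have pos: "f (i, k) \<ge> 0" if "k < 3" for k
  proof -
    have "tmin i f \<le> f (i, k)" using that unfolding less_3_iff tmin_def by auto
    then show ?thesis using m(1) mt by simp
  qed
  have sum1: "f (i, 0) + f (i, 1) + f (i, 2) = 1"
  proof -
    have "f (i, 0) + f (i, 1) + f (i, 2) = 1 + m * (u 0 + u 1 + u 2)"
      using fk[of 0] fk[of 1] fk[of 2] by (simp add: algebra_simps)
    then show ?thesis using us by simp
  qed
  have fT: "f \<in> topspace (cell P i)"
    unfolding tri_real_iff[OF i(2)] using pos sum1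
    by (auto simp: f_def) (auto simp: verts_def tri_def)
  have "1 - f (i, 0) - f (i, 1) - f (i, 2) = 0" using sum1 by simp
  then have "qden i f = m\<^sup>2 / (4 * (real i)\<^sup>2) + (m * u 0)\<^sup>2 + (m * u 1)\<^sup>2"
    using fk[of 0] fk[of 1] by (simp add: qden_def mt)
  also have "\<dots> = m\<^sup>2 * ((x\<^sup>2 + y\<^sup>2 + z\<^sup>2) / c\<^sup>2)"
    using x i by (simp add: u_def c_def power_divide power_mult_distrib field_simps)
  also have "\<dots> = m\<^sup>2 / c" unfolding xyz(1) c_def[symmetric] using c by (simp add: power2_eq_square)
  finally have d: "qden i f = m\<^sup>2 / c" .
  have "q0 i f = x" using m(1) c i unfolding q0_def d mt by (simp add: c_def)
  moreover have "q12 0 i f = y" "q12 1 i f = z"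
    using m(1) c fk[of 0] fk[of 1] unfolding q12_def d mt by (simp_all add: u_def power2_eq_square)
  ultimately have "collapse P f = (x, y, z)" using collapse_tri[OF i fT] by simp
  with fT show thesis by (rule that)
qed

theorem block_complex_wedge:
  assumes P: "2 \<le> P"
  shows "blocks P homotopy_equivalent_space wedge_S2 (P - 1)"
proof -
  let ?V = "verts P" and ?I = "top_of_set {0..1::real}"
  let ?L = "blocks P" and ?B = "band P"
  let ?T = "cell P"
  let ?e = "restrict (\<lambda>v. if v = (0, 0) then 1 else 0) ?V :: nat \<times> nat \<Rightarrow> real"
  have P0: "0 < P" using P by simp
  have "\<exists>h. continuous_map (prod_topology ?I ?B) ?B h \<and> (\<forall>x\<in>topspace ?B. h (0, x) = id x)
     \<and> (\<forall>x\<in>topspace ?B. h (1, x) = ?e) \<and> (\<forall>t\<in>{0..1}. True)"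
    using band_contraction[OF P0] by (subst (asm) homotopic_with) auto
  then obtain h where h: "continuous_map (prod_topology ?I ?B) ?B h"
     "\<And>x. x \<in> topspace ?B \<Longrightarrow> h (0, x) = x" "\<And>x. x \<in> topspace ?B \<Longrightarrow> h (1, x) = ?e"
    by auto
  obtain H where H: "continuous_map (prod_topology ?I ?L) ?L H"
    "\<And>f. f \<in> topspace ?L \<Longrightarrow> H (0, f) = f"
    "\<And>t f. t \<in> {0..1} \<Longrightarrow> f \<in> topspace ?B \<Longrightarrow> H (t, f) = h (t, f)"
    using extend_contraction[OF P0 h(1,2)] by metis
  have LB: "topspace ?B \<subseteq> topspace ?L"
    by (rule topspace_geom_real_mono[OF band_complex_sub])
  have hB: "h (t, f) \<in> topspace ?B" if "t \<in> {0..1}" "f \<in> topspace ?B" for t f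
    using continuous_map_funspace[OF h(1)] that by (auto simp: Pi_iff)
  have q0pos: "fst (collapse P f) > 0" if "f \<in> topspace (?T i)" "0 < i" "i < P" "f \<notin> topspace ?B" for f i
  proof -
    have "tmin i f > 0" using tri_inter_band[OF that(2,3,1)] that(4) tmin_bounds(1)[OF that(3,1)] by simp
    then show ?thesis using collapse_tri[OF that(2,3,1)] qden_pos[OF that(2), of f] that(2)
      by (simp add: q0_def)
  qed
  have top: "topspace (wedge_S2 (P - 1)) = (\<Union>i\<in>{1..P-1}. sphere (real i, 0, 0) (real i))"
    by (simp add: wedge_S2_def)
  have z_in: "(0, 0, 0) \<in> topspace (wedge_S2 (P - 1))"
    unfolding top
  proof (rule UN_I[of 1])
    show "(0, 0, 0) \<in> sphere (real 1, 0 :: real, 0 :: real) (real 1)" by (subst in_sphere_iff) simp_all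
  qed (use P in simp)
  have q_in: "collapse P f \<in> topspace (wedge_S2 (P - 1))" if fL: "f \<in> topspace ?L" for f
  proof (cases "f \<in> topspace ?B")
    case True
    then show ?thesis using collapse_band z_in by simp
  next
    case False
    then obtain i where i: "0 < i" "i < P" "f \<in> topspace (?T i)" using not_band_in_tri fL by blast
    then show ?thesis unfolding top using collapse_tri_sphere(1) by (intro UN_I[of i]) auto
  qed
  show ?thesis
  proof (rule homotopy_equivalent_collapse[where q = "collapse P" and M = "topspace ?B" and H = H and o' = "(0,0,0)"])
    show "compact_space ?L" by (rule compact_space_geom_real[OF finite_verts block_complex_down])
    show "Hausdorff_space (wedge_S2 (P - 1))"
      unfolding wedge_S2_def by (intro Hausdorff_space_subtopology) simp
    show "continuous_map ?L (wedge_S2 (P - 1)) (collapse P)"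
      unfolding wedge_S2_def continuous_map_in_subtopology
      using continuous_map_collapse q_in unfolding top by blast
    show "collapse P ` topspace ?L = topspace (wedge_S2 (P - 1))"
    proof
      show "collapse P ` topspace ?L \<subseteq> topspace (wedge_S2 (P - 1))" using q_in by blast
      show "topspace (wedge_S2 (P - 1)) \<subseteq> collapse P ` topspace ?L"
      proof
        fix p assume p: "p \<in> topspace (wedge_S2 (P - 1))"
        obtain x y z where xyz: "p = (x, y, z)" by (cases p)
        from p obtain i where i: "1 \<le> i" "i \<le> P - 1" "p \<in> sphere (real i, 0, 0) (real i)"
          unfolding top by auto
        then have i': "0 < i" "i < P" using P by auto
        have sp: "x\<^sup>2 + y\<^sup>2 + z\<^sup>2 = 2 * real i * x" using i(3) in_sphere_iff[of "real i"] by (simp add: xyz)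
        show "p \<in> collapse P ` topspace ?L"
        proof (cases "x = 0")
          case False
          obtain f where "f \<in> topspace (?T i)" "collapse P f = p"
            using collapse_surj[OF i' sp False] xyz by metis
          then show ?thesis using topspace_geom_real_mono[OF tri_complex_sub[OF i'(2)]] by blast
        next
          case True
          then have "x\<^sup>2 + y\<^sup>2 + z\<^sup>2 = 0" using sp by simp
          then have p0: "p = (0, 0, 0)" unfolding xyz
            by (simp add: add_nonneg_eq_0_iff)
          have "tri 0 \<in> band_complex P" using tri_in_block[OF P0] by (simp add: band_complex_def)
          then have "tri_complex 0 \<subseteq> band_complex P"
            using band_complex_down unfolding tri_complex_def down_closed_def by blast
          moreover have "?e \<in> topspace (?T 0)" unfolding tri_real_iff[OF P0]
            using tri_mem[OF P0] by (auto simp: tri_def)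
          ultimately have eB: "?e \<in> topspace ?B" using topspace_geom_real_mono by blast
          show ?thesis by (rule image_eqI[of _ _ ?e]) (simp add: collapse_band[OF eB] p0, use LB eB in blast)
        qed
      qed
    qed
    show "f = g \<or> (f \<in> topspace ?B \<and> g \<in> topspace ?B)"
      if fg: "f \<in> topspace ?L" "g \<in> topspace ?L" "collapse P f = collapse P g" for f g
    proof (cases "f \<in> topspace ?B"; cases "g \<in> topspace ?B")
      assume n: "f \<notin> topspace ?B" "g \<notin> topspace ?B"
      obtain i where i: "0 < i" "i < P" "f \<in> topspace (?T i)" using not_band_in_tri n(1) fg(1) by blast
      obtain j where j: "0 < j" "j < P" "g \<in> topspace (?T j)" using not_band_in_tri n(2) fg(2) by blast
      obtain x y z where xyz: "collapse P f = (x, y, z)" by (cases "collapse P f")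
      \<comment> \<open>Away from the origin a point determines its sphere: the radius is the
        squared norm divided by \<open>2 * x\<close>. Injectivity thus reduces to a single
        triangle.\<close>
      have "x > 0" using q0pos[OF i(3,1,2) n(1)] by (simp add: xyz)
      moreover have "2 * real i * x = 2 * real j * x"
        using collapse_tri_sphere(2)[OF i xyz] collapse_tri_sphere(2)[OF j] xyz fg(3) by auto
      ultimately have ij: "i = j" by simp
      have "f = g"
      proof (rule collapse_tri_inj[OF i _ _ _ fg(3)])
        show "g \<in> topspace (?T i)" using j ij by simp
        show "tmin i f > 0" using tri_inter_band[OF i] n(1) tmin_bounds(1)[OF i(2,3)] by simp
        show "tmin i g > 0" using tri_inter_band[OF j] n(2) tmin_bounds(1)[OF j(2,3)] ij by simp
      qed
      then show ?thesis by simp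
    next
      assume n: "f \<in> topspace ?B" "g \<notin> topspace ?B"
      obtain j where j: "0 < j" "j < P" "g \<in> topspace (?T j)" using not_band_in_tri n(2) fg(2) by blast
      show ?thesis using q0pos[OF j(3,1,2) n(2)] collapse_band[OF n(1)] fg(3) by simp
    next
      assume n: "f \<notin> topspace ?B" "g \<in> topspace ?B"
      obtain i where i: "0 < i" "i < P" "f \<in> topspace (?T i)" using not_band_in_tri n(1) fg(1) by blast
      show ?thesis using q0pos[OF i(3,1,2) n(1)] collapse_band[OF n(2)] fg(3) by simp
    qed simp
  qed (use LB H h hB collapse_band in auto)
qed

section \<open>Lifted cyclic graphs\<close>

text \<open>Here \<open>e\<close> unrolls the cycle to the line, with one turn of length 1, and
  \<open>R x y\<close> is a clockwise edge between lifted points. The nesting axiom is the abstract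
  form of the comparison of chords, and it is what makes the dynamics monotone.\<close>

locale cyclic_arcs =
  fixes e :: "real \<Rightarrow> 'v" and R :: "real \<Rightarrow> real \<Rightarrow> bool"
  assumes e_eq: "e x = e y \<longleftrightarrow> (\<exists>n::int. y = x + of_int n)"
    and R_less: "R x y \<Longrightarrow> x < y" and R_half: "R x y \<Longrightarrow> y < x + 1/2"
    and R_nest: "R x y \<Longrightarrow> x \<le> x' \<Longrightarrow> x' < y' \<Longrightarrow> y' \<le> y \<Longrightarrow> R x' y'"
    and R_shift: "R (x + of_int n) (y + of_int n) \<longleftrightarrow> R x y"
begin

definition lift :: "'v set \<Rightarrow> real set" where
  "lift X = {x. e x \<in> X}"

definition adv :: "'v set \<Rightarrow> real \<Rightarrow> real" where
  "adv X x = Max {y \<in> lift X. y = x \<or> R x y}"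

definition adj :: "'v \<Rightarrow> 'v \<Rightarrow> bool" where
  "adj u v \<longleftrightarrow> u = v \<or> (\<exists>x y. e x = u \<and> e y = v \<and> (R x y \<or> R y x))"

definition cliques :: "'v set \<Rightarrow> 'v set set" where
  "cliques X = {\<sigma>. \<sigma> \<subseteq> X \<and> finite \<sigma> \<and> \<sigma> \<noteq> {} \<and> (\<forall>u\<in>\<sigma>. \<forall>v\<in>\<sigma>. adj u v)}"

lemma e_shift [simp]: "e (x + of_int n) = e x" "e (x - of_int n) = e x"
proof -
  show "e (x + of_int n) = e x" using e_eq by metis
  show "e (x - of_int n) = e x"
    using e_eq[of "x - of_int n" x] by (metis diff_add_cancel)
qed

lemma e_shift1 [simp]: "e (x + 1) = e x" "e (x - 1) = e x" "e (x + real m) = e x"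
  using e_shift(1)[of x 1] e_shift(2)[of x 1] e_shift(1)[of x "int m"] by simp_all

lemma lift_shift [simp]: "x + of_int n \<in> lift X \<longleftrightarrow> x \<in> lift X" "x - of_int n \<in> lift X \<longleftrightarrow> x \<in> lift X"
    "x + 1 \<in> lift X \<longleftrightarrow> x \<in> lift X" "x - 1 \<in> lift X \<longleftrightarrow> x \<in> lift X"
  by (auto simp: lift_def)

lemma inj_on_e: "inj_on e {a..<a + 1}"
proof (rule inj_onI)
  fix x y assume xy: "x \<in> {a..<a + 1}" "y \<in> {a..<a + 1}" "e x = e y"
  then obtain n :: int where n: "y = x + of_int n" using e_eq by auto
  with xy have "of_int n < (1::real)" "of_int n > (-1::real)" by auto
  then have "n = 0" by linarith
  with n show "x = y" by simp
qed

lemma finite_lift: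
  assumes "finite X"
  shows "finite {y \<in> lift X. a \<le> y \<and> y < a + 1}"
proof -
  have "e ` {y \<in> lift X. a \<le> y \<and> y < a + 1} \<subseteq> X" by (auto simp: lift_def)
  then show ?thesis
    using assms inj_on_e[of a] by (intro inj_on_finite[of e _ X]) (auto intro: inj_on_subset)
qed

lemma lift_window: "\<exists>x \<ge> a. x < a + 1 \<and> e x = e y"
proof -
  have "e (y - of_int \<lfloor>y - a\<rfloor>) = e y" by simp
  moreover have "y - of_int \<lfloor>y - a\<rfloor> \<ge> a" "y - of_int \<lfloor>y - a\<rfloor> < a + 1" by linarith+
  ultimately show ?thesis by blast
qed

section \<open>The lifted dynamics of a finite vertex set\<close>

context
  fixes X :: "'v set" assumes X: "finite X"
begin

lemma finite_out: "finite {y \<in> lift X. y = x \<or> R x y}"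
  by (rule finite_subset[OF _ finite_lift[OF X, of x]]) (use R_less R_half in \<open>force\<close>)

lemma adv_in:
  assumes "x \<in> lift X"
  shows "adv X x \<in> lift X" "adv X x = x \<or> R x (adv X x)"
proof -
  have "adv X x \<in> {y \<in> lift X. y = x \<or> R x y}"
    unfolding adv_def using assms by (intro Max_in finite_out) auto
  then show "adv X x \<in> lift X" "adv X x = x \<or> R x (adv X x)" by auto
qed

lemma adv_ge: "x \<in> lift X \<Longrightarrow> x \<le> adv X x"
  using adv_in(2)[of x] R_less[of x "adv X x"] by auto

lemma adv_lt: "x \<in> lift X \<Longrightarrow> adv X x < x + 1/2"
  using adv_in(2)[of x] R_half[of x "adv X x"] by auto

lemma adv_max: "R x y \<Longrightarrow> y \<in> lift X \<Longrightarrow> y \<le> adv X x"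
  unfolding adv_def by (intro Max_ge finite_out) auto

lemma R_iff_adv:
  assumes "x \<in> lift X" "y \<in> lift X"
  shows "R x y \<longleftrightarrow> x < y \<and> y \<le> adv X x"
  using adv_max[of x y] R_less[of x y] adv_in(2)[OF assms(1)] R_nest[of x "adv X x" x y] assms by auto

text \<open>If \<open>x\<close> reaches beyond \<open>x'\<close>, then by nesting \<open>x'\<close>
  reaches the same point.\<close>

lemma adv_mono:
  assumes "x \<in> lift X" "x' \<in> lift X" "x \<le> x'"
  shows "adv X x \<le> adv X x'"
proof (cases "adv X x \<le> x'")
  case True
  then show ?thesis using adv_ge[OF assms(2)] by linarith
next
  case False
  then have "R x (adv X x)" using adv_in(2)[OF assms(1)] assms(3) by auto
  then have "R x' (adv X x)" using False assms(3) by (auto intro: R_nest)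
  then show ?thesis using adv_max adv_in(1)[OF assms(1)] by blast
qed

lemma adv_shift:
  assumes "x \<in> lift X"
  shows "adv X (x + of_int n) = adv X x + of_int n"
proof -
  have "{y \<in> lift X. y = x + of_int n \<or> R (x + of_int n) y} = (\<lambda>y. y + of_int n) ` {y \<in> lift X. y = x \<or> R x y}"
    (is "?A = ?f ` ?B")
  proof
    show "?f ` ?B \<subseteq> ?A" using R_shift by auto
    show "?A \<subseteq> ?f ` ?B"
    proof
      fix y assume y: "y \<in> ?A"
      have "R (x + of_int n) y \<longleftrightarrow> R x (y - of_int n)" using R_shift[of x n "y - of_int n"] by simp
      then have "y - of_int n \<in> ?B" using y by auto
      then show "y \<in> ?f ` ?B" by (intro image_eqI[of _ _ "y - of_int n"]) auto
    qed
  qed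
  moreover have "?B \<noteq> {}" using assms by auto
  then have "?f (Max ?B) = Max (?f ` ?B)"
    by (intro mono_Max_commute finite_out) (auto simp: mono_def)
  ultimately show ?thesis by (simp add: adv_def)
qed

lemma adv_pow_in: "x \<in> lift X \<Longrightarrow> (adv X ^^ k) x \<in> lift X"
  by (induction k) (auto intro: adv_in)

lemma adv_pow_mono:
  assumes "x \<in> lift X" "x' \<in> lift X" "x \<le> x'"
  shows "(adv X ^^ k) x \<le> (adv X ^^ k) x'"
  by (induction k) (auto intro: assms adv_mono adv_pow_in)

lemma adv_pow_shift:
  assumes "x \<in> lift X"
  shows "(adv X ^^ k) (x + of_int n) = (adv X ^^ k) x + of_int n"
  by (induction k) (auto simp: adv_shift adv_pow_in assms)

lemma adv_pow_period:
  assumes "x \<in> lift X" "(adv X ^^ 3) x = x + 1"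
  shows "(adv X ^^ (3 * m)) x = x + real m"
proof (induction m)
  case (Suc m)
  have "(adv X ^^ (3 * Suc m)) x = (adv X ^^ 3) ((adv X ^^ (3 * m)) x)"
    by (simp add: funpow_add[of 3 "3 * m", simplified, symmetric] del: funpow.simps flip: o_apply[of "adv X ^^ 3"])
  also have "\<dots> = (adv X ^^ 3) (x + of_int (int m))" by (simp add: Suc)
  also have "\<dots> = x + 1 + real m" by (subst adv_pow_shift) (simp_all add: assms)
  finally show ?case by simp
qed simp

text \<open>No step can be stationary: a fixed point would either stop the orbit or leave a whole
  turn to a single step, which is shorter than 1/2.\<close>

lemma period3_strict:
  assumes v: "v \<in> lift X" "(adv X ^^ 3) v = v + 1"
  shows "v < adv X v" "adv X v < adv X (adv X v)" "adv X (adv X v) < v + 1"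
proof -
  let ?F = "adv X"
  have p: "?F (?F (?F v)) = v + 1" using v(2) by (simp add: numeral_3_eq_3)
  have in': "?F v \<in> lift X" "?F (?F v) \<in> lift X" using v adv_in(1) by auto
  have s1: "?F (v + 1) = ?F v + 1" "?F (?F v + 1) = ?F (?F v) + 1"
    using adv_shift[OF v(1), of 1] adv_shift[OF in'(1), of 1] by simp_all
  have "?F v \<noteq> v" using p by auto
  then show "v < ?F v" using adv_ge[OF v(1)] by simp
  have "?F (?F v) \<noteq> ?F v"
  proof
    assume e: "?F (?F v) = ?F v"
    then have "?F v = v + 1" using p by simp
    then show False using adv_lt[OF v(1)] by simp
  qed
  then show "?F v < ?F (?F v)" using adv_ge[OF in'(1)] by simp
  have "?F (?F v) \<noteq> v + 1"
  proof
    assume "?F (?F v) = v + 1"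
    then have "?F v = v" using p s1 by simp
    then show False using \<open>?F v \<noteq> v\<close> by simp
  qed
  then show "?F (?F v) < v + 1" using p adv_ge[OF in'(2)] by simp
qed

text \<open>A three-cycle that no orbit can overtake: between \<open>y\<close> and the barriers \<open>z\<close> the third iterate,
  shifted back by a full turn, is a monotone self-map with a point moved forward, so it has a fixed point.\<close>

lemma trapped_orbit:
  assumes y: "y0 \<in> lift X" "y1 \<in> lift X" "y2 \<in> lift X"
    and cyc: "R y0 y1" "R y1 y2" "R y2 (y0 + 1)"
    and z: "y0 < z0" "z0 \<le> z1" "z1 \<le> z2" "z2 \<le> z0 + 1" "z0 \<le> y0 + 1"
    and b0: "\<And>x y. x < z0 \<Longrightarrow> z1 \<le> y \<Longrightarrow> \<not> R x y"
    and b1: "\<And>x y. x < z1 \<Longrightarrow> z2 \<le> y \<Longrightarrow> \<not> R x y"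
    and b2: "\<And>x y. x < z2 \<Longrightarrow> z0 + 1 \<le> y \<Longrightarrow> \<not> R x y"
  obtains v where "v \<in> lift X" "(adv X ^^ 3) v = v + 1" "y0 \<le> v" "v < z0"
    "y1 \<le> adv X v" "adv X v < z1" "y2 \<le> adv X (adv X v)" "adv X (adv X v) < z2"
proof -
  let ?F = "adv X"
  define W where "W = {x \<in> lift X. y0 \<le> x \<and> x < z0}"
  have up: "?F x < z1" if "x \<in> lift X" "x < z0" for x
    using adv_in(2)[OF that(1)] b0[of x "?F x"] that z by force
  have up1: "?F x < z2" if "x \<in> lift X" "x < z1" for x
    using adv_in(2)[OF that(1)] b1[of x "?F x"] that z by force
  have up2: "?F x < z0 + 1" if "x \<in> lift X" "x < z2" for x
    using adv_in(2)[OF that(1)] b2[of x "?F x"] that z by force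
  have lo: "y1 \<le> ?F x" if "x \<in> lift X" "y0 \<le> x" for x
    using adv_mono[OF y(1) that] adv_max[OF cyc(1) y(2)] by linarith
  have lo1: "y2 \<le> ?F x" if "x \<in> lift X" "y1 \<le> x" for x
    using adv_mono[OF y(2) that] adv_max[OF cyc(2) y(3)] by linarith
  have lo2: "y0 + 1 \<le> ?F x" if "x \<in> lift X" "y2 \<le> x" for x
    using adv_mono[OF y(3) that] adv_max[OF cyc(3)] y(1) by force
  define T where "T x = ?F (?F (?F x)) - 1" for x
  have TW: "T x \<in> W" if "x \<in> W" for x
    using that by (simp add: W_def T_def) (smt (verit) adv_in(1) up up1 up2 lo lo1 lo2)
  have Tm: "T x \<le> T x'" if "x \<in> W" "x' \<in> W" "x \<le> x'" for x x'
    using that by (auto simp: W_def T_def intro!: adv_mono adv_in)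
  have fW: "finite W" unfolding W_def
    by (rule finite_subset[OF _ finite_lift[OF X, of y0]]) (use z in auto)
  have y0W: "y0 \<in> W" using y z by (simp add: W_def)
  \<comment> \<open>The largest point that \<open>T\<close> does not move backward. By monotonicity
    its image is again such a point, hence not larger, and so \<open>v\<close> is fixed.\<close>
  define v where "v = Max {x \<in> W. x \<le> T x}"
  have ne: "{x \<in> W. x \<le> T x} \<noteq> {}" using y0W TW[OF y0W] unfolding W_def by blast
  have v: "v \<in> W" "v \<le> T v" using Max_in[OF _ ne] fW by (auto simp: v_def)
  have "T v \<in> {x \<in> W. x \<le> T x}" using v TW Tm by auto
  then have "T v \<le> v" using fW by (auto simp: v_def)
  with v have Tv: "T v = v" by simp
  show thesis
  proof (rule that)
    show vX: "v \<in> lift X" "y0 \<le> v" "v < z0" using v by (auto simp: W_def)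
    show "(?F ^^ 3) v = v + 1" using Tv by (simp add: T_def numeral_3_eq_3)
    show 1: "y1 \<le> ?F v" "?F v < z1" using lo up vX by auto
    show "y2 \<le> ?F (?F v)" "?F (?F v) < z2" using lo1 up1 vX adv_in(1) 1 by auto
  qed
qed

text \<open>Compare \<open>H\<close> with the period-three orbit over \<open>3 * n\<close> advances.
  In that time \<open>H\<close> gains at least \<open>3 * k * d\<close> turns, while the orbit,
  started less than one turn ahead, gains exactly \<open>n\<close>. Both gains are integers, so the
  head start of less than one turn does not count.\<close>

lemma rotation_bound:
  fixes H :: "nat \<Rightarrow> real" and d :: nat
  assumes H: "\<And>i. H i \<in> lift X" "\<And>i. H (i + k) \<le> adv X (H i)"
    and d: "\<And>i. H (i + n) = H i + real d" "1 \<le> d"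
    and x: "x \<in> lift X" "(adv X ^^ 3) x = x + 1"
  shows "3 * k \<le> n"
proof -
  have step: "H (j * k) \<le> (adv X ^^ j) (H 0)" for j
  proof (induction j)
    case (Suc j)
    have "H (Suc j * k) = H (j * k + k)" by (simp add: add.commute)
    also have "\<dots> \<le> adv X (H (j * k))" by (rule H)
    also have "\<dots> \<le> adv X ((adv X ^^ j) (H 0))" by (intro adv_mono H adv_pow_in Suc)
    finally show ?case by simp
  qed simp
  have per: "H (m * n) = H 0 + real m * real d" for m
  proof (induction m)
    case (Suc m)
    have "H (Suc m * n) = H (m * n + n)" by (simp add: add.commute)
    then show ?case using d(1)[of "m * n"] Suc by (simp add: algebra_simps)
  qed simp
  define x' where "x' = x + of_int \<lceil>H 0 - x\<rceil>"
  have x': "x' \<in> lift X" "H 0 \<le> x'" "x' < H 0 + 1" using x(1) unfolding x'_def by (simp, linarith, linarith)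
  have p: "(adv X ^^ 3) x' = x' + 1" using adv_pow_shift[OF x(1), of 3] x(2) by (simp add: x'_def)
  have "H 0 + real (3 * k) * real d = H ((3 * n) * k)"
    using per[of "3 * k"] by (simp add: mult.commute mult.left_commute)
  also have "\<dots> \<le> (adv X ^^ (3 * n)) (H 0)" by (rule step)
  also have "\<dots> \<le> (adv X ^^ (3 * n)) x'" by (intro adv_pow_mono H x')
  also have "\<dots> = x' + real n" by (rule adv_pow_period[OF x'(1) p])
  finally have "real (3 * k) * real d < 1 + real n" using x'(3) by linarith
  then have "real (3 * k * d) < real (n + 1)" by simp
  then have "3 * k * d \<le> n" by (simp only: of_nat_less_iff)
  moreover have "3 * k * 1 \<le> 3 * k * d" using d(2) by (intro mult_left_mono) auto
  ultimately show ?thesis by linarith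
qed

end

section \<open>Cliques and the removal of dominated vertices\<close>

lemma adj_lift:
  assumes "adj (e x) u" "u \<noteq> e x"
  obtains y where "e y = u" "R x y \<or> R y x"
proof -
  obtain x' y' where xy: "e x' = e x" "e y' = u" "R x' y' \<or> R y' x'"
    using assms unfolding adj_def by blast
  obtain n :: int where n: "x = x' + of_int n" using xy(1) e_eq by blast
  show thesis
    by (rule that[of "y' + of_int n"]) (use xy R_shift n in auto)
qed

lemma adj_refl: "adj u u"
  by (simp add: adj_def)

lemma adj_sym: "adj u v \<longleftrightarrow> adj v u"
  unfolding adj_def by blast

lemma R_adj: "R x y \<Longrightarrow> adj (e x) (e y)" "R y x \<Longrightarrow> adj (e x) (e y)"
  unfolding adj_def by blast+

lemma cliques_down: "down_closed (cliques X)"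
  unfolding down_closed_def cliques_def by (blast intro: finite_subset)

text \<open>As \<open>x\<close> is not fixed, it has a next vertex \<open>w\<close> within its
  reach. A vertex with an edge to \<open>x\<close> advances past \<open>x\<close>, since
  \<open>x\<close> is no image, and so reaches \<open>w\<close>; a vertex reached from
  \<open>x\<close> is \<open>w\<close> or is reached from \<open>w\<close> by nesting. Since
  \<open>x\<close> is never the farthest point reached, deleting it changes no other value of
  \<open>adv\<close>.\<close>

lemma remove_nonimage:
  assumes X: "finite X" and x: "x \<in> lift X" and noimg: "\<And>y. y \<in> lift X \<Longrightarrow> adv X y \<noteq> x"
  shows "geom_real X (cliques X) homotopy_equivalent_space geom_real (X - {e x}) (cliques (X - {e x}))"
    and "y \<in> lift (X - {e x}) \<Longrightarrow> adv (X - {e x}) y = adv X y"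
proof -
  let ?F = "adv X"
  have xF: "R x (?F x)" "x < ?F x" using adv_in(2)[OF X x] noimg[OF x] R_less by auto
  let ?N = "{y \<in> lift X. x < y \<and> y \<le> ?F x}"
  have fN: "finite ?N"
    by (rule finite_subset[OF _ finite_lift[OF X, of x]]) (use adv_lt[OF X x] in auto)
  define w where "w = Min ?N"
  have "?N \<noteq> {}" using xF adv_in(1)[OF X x] by auto
  then have w: "w \<in> lift X" "x < w" "w \<le> ?F x" using Min_in[OF fN] by (auto simp: w_def)
  have wmin: "w \<le> y" if "y \<in> lift X" "x < y" "y \<le> ?F x" for y
    unfolding w_def using fN that by (intro Min_le) auto
  have Rxw: "R x w" using R_nest[OF xF(1)] w by auto
  have ew: "e w \<noteq> e x"
    using inj_on_e[of x] w(2) R_half[OF Rxw] by (auto dest!: inj_onD[where x = w and y = x])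
  have dom: "adj (e w) u" if u: "u \<in> X" "adj (e x) u" for u
  proof (cases "u = e x")
    case True
    then show ?thesis using R_adj(2)[OF Rxw] by simp
  next
    case False
    then obtain y where y: "e y = u" "R x y \<or> R y x" using adj_lift u(2) by metis
    then have yX: "y \<in> lift X" using u by (simp add: lift_def)
    from y(2) show ?thesis
    proof
      assume r: "R x y"
      then have "w \<le> y" using wmin[OF yX] R_iff_adv[OF X x yX] by blast
      then show ?thesis using r w(2) y(1) R_nest[OF r, of w y] R_adj(1)[of w y]
        by (cases "w = y") (auto simp: adj_def)
    next
      assume r: "R y x"
      then have yx: "y < x" "x \<le> ?F y" using R_iff_adv[OF X yX x] by auto
      then have "x < ?F y" using noimg[OF yX] by auto
      then have "w \<le> ?F y"
        using adv_in(1)[OF X yX] adv_mono[OF X yX x] yx by (intro wmin) auto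
      then have "R y w" using R_iff_adv[OF X yX w(1)] yx w(2) by auto
      then show ?thesis using R_adj(2) y(1) by auto
    qed
  qed
  have "geom_real X (cliques X) homotopy_equivalent_space geom_real (X - {e x}) {\<sigma> \<in> cliques X. e x \<notin> \<sigma>}"
  proof (rule geom_real_remove_dominated[OF X cliques_down, where w = "e w"])
    show "e x \<in> X" "e w \<in> X" "e x \<noteq> e w" using x w(1) ew by (auto simp: lift_def)
    show "insert (e w) \<sigma> \<in> cliques X" if "\<sigma> \<in> cliques X" "e x \<in> \<sigma>" for \<sigma>
    proof -
      have \<sigma>: "\<sigma> \<subseteq> X" "finite \<sigma>" "\<And>a b. a \<in> \<sigma> \<Longrightarrow> b \<in> \<sigma> \<Longrightarrow> adj a b"
        using that(1) unfolding cliques_def by blast+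
      have w\<sigma>: "adj (e w) u" if "u \<in> \<sigma>" for u
        using dom[of u] \<sigma>(1) \<sigma>(3)[OF \<open>e x \<in> \<sigma>\<close> that] that by blast
      have "adj a b" if "a \<in> insert (e w) \<sigma>" "b \<in> insert (e w) \<sigma>" for a b
        using that w\<sigma> \<sigma>(3) adj_sym[of a b] by (auto simp: adj_refl)
      moreover have "e w \<in> X" using w(1) by (simp add: lift_def)
      ultimately show ?thesis using \<sigma>(1,2) unfolding cliques_def by blast
    qed
  qed (auto simp: cliques_def)
  also have "{\<sigma> \<in> cliques X. e x \<notin> \<sigma>} = cliques (X - {e x})"
    by (auto simp: cliques_def)
  finally show "geom_real X (cliques X) homotopy_equivalent_space geom_real (X - {e x}) (cliques (X - {e x}))" .
  assume y: "y \<in> lift (X - {e x})"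
  then have yX: "y \<in> lift X" by (auto simp: lift_def)
  have "e (?F y) \<noteq> e x"
  proof
    assume "e (?F y) = e x"
    then obtain n :: int where "x = ?F y + of_int n" using e_eq by blast
    then have "adv X (y + of_int n) = x" by (simp add: adv_shift[OF X yX])
    then show False using noimg yX by auto
  qed
  then have Fy: "?F y \<in> lift (X - {e x})" using adv_in(1)[OF X yX] by (auto simp: lift_def)
  have X': "finite (X - {e x})" using X by simp
  show "adv (X - {e x}) y = ?F y"
  proof (rule antisym)
    show "adv (X - {e x}) y \<le> ?F y"
      using adv_in[OF X' y] adv_max[OF X, of y "adv (X - {e x}) y"] adv_ge[OF X yX]
      by (auto simp: lift_def)
    show "?F y \<le> adv (X - {e x}) y"
      using adv_in(2)[OF X yX] adv_max[OF X' _ Fy, of y] adv_ge[OF X' y] by auto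
  qed
qed

text \<open>Removal stops when the dynamics is onto. The last clause says that a set covered by its
  own image never loses a vertex; it keeps the periodic orbits alive through the induction.\<close>

lemma dismantle:
  assumes "finite X"
  obtains X' where "X' \<subseteq> X"
    "geom_real X (cliques X) homotopy_equivalent_space geom_real X' (cliques X')"
    "\<And>y. y \<in> lift X' \<Longrightarrow> adv X' y = adv X y"
    "\<And>x. x \<in> lift X' \<Longrightarrow> \<exists>y \<in> lift X'. adv X' y = x"
    "\<And>S. S \<subseteq> X \<Longrightarrow> (\<And>x. x \<in> lift S \<Longrightarrow> \<exists>y \<in> lift S. adv X y = x) \<Longrightarrow> S \<subseteq> X'"
  using assms
proof (induction X arbitrary: thesis rule: finite_psubset_induct)
  case (psubset X)
  show ?case
  proof (cases "\<forall>x \<in> lift X. \<exists>y \<in> lift X. adv X y = x")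
    case True
    then show ?thesis
      using homotopy_equivalent_space_refl by (intro psubset.prems[of X]) auto
  next
    case False
    then obtain x where x: "x \<in> lift X" "\<And>y. y \<in> lift X \<Longrightarrow> adv X y \<noteq> x" by blast
    note rem = remove_nonimage[OF psubset.hyps x]
    have ps: "X - {e x} \<subset> X" using x(1) by (auto simp: lift_def)
    obtain X' where X': "X' \<subseteq> X - {e x}"
      "geom_real (X - {e x}) (cliques (X - {e x})) homotopy_equivalent_space geom_real X' (cliques X')"
      "\<And>y. y \<in> lift X' \<Longrightarrow> adv X' y = adv (X - {e x}) y"
      "\<And>x. x \<in> lift X' \<Longrightarrow> \<exists>y \<in> lift X'. adv X' y = x"
      "\<And>S. S \<subseteq> X - {e x} \<Longrightarrow> (\<And>z. z \<in> lift S \<Longrightarrow> \<exists>y \<in> lift S. adv (X - {e x}) y = z) \<Longrightarrow> S \<subseteq> X'"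
      using psubset.IH[OF ps] by metis
    show ?thesis
    proof (rule psubset.prems[of X'])
      show "X' \<subseteq> X" using X'(1) by auto
      show "geom_real X (cliques X) homotopy_equivalent_space geom_real X' (cliques X')"
        using rem(1) X'(2) by (rule homotopy_eqv_trans)
      show "adv X' y = adv X y" if "y \<in> lift X'" for y
        using X'(1,3) rem(2) that by (auto simp: lift_def)
      show "\<exists>y \<in> lift X'. adv X' y = z" if "z \<in> lift X'" for z using X'(4) that .
      fix S assume S: "S \<subseteq> X" "\<And>z. z \<in> lift S \<Longrightarrow> \<exists>y \<in> lift S. adv X y = z"
      have "e x \<notin> S"
      proof
        assume "e x \<in> S"
        then have "x \<in> lift S" by (simp add: lift_def)
        then obtain y where "y \<in> lift S" "adv X y = x" using S(2) by blast
        then show False using x(2) S(1) by (auto simp: lift_def)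
      qed
      then have S': "S \<subseteq> X - {e x}" using S(1) by auto
      moreover have "\<exists>y \<in> lift S. adv (X - {e x}) y = z" if "z \<in> lift S" for z
        using S(2)[OF that] rem(2) S' by (auto simp: lift_def)
      ultimately show "S \<subseteq> X'" by (rule X'(5))
    qed
  qed
qed

end

text \<open>The map injects the points below \<open>x\<close> into those below \<open>f x\<close>,
  and likewise the points above. Comparing cardinalities excludes a move in either
  direction.\<close>

lemma strict_mono_finite_id:
  fixes A :: "'a::linorder set"
  assumes A: "finite A" and f: "\<And>x. x \<in> A \<Longrightarrow> f x \<in> A"
    and mono: "\<And>x y. x \<in> A \<Longrightarrow> y \<in> A \<Longrightarrow> x < y \<Longrightarrow> f x < f y" and x: "x \<in> A"
  shows "f x = x"
proof -
  have inj: "inj_on f A"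
    by (rule linorder_inj_onI) (use mono in \<open>force simp: neq_iff\<close>)+
  have "card {y \<in> A. y < x} \<le> card {y \<in> A. y < f x}"
    by (rule card_inj_on_le[of f]) (use A f mono x inj in \<open>auto intro: inj_on_subset\<close>)
  moreover have "card {y \<in> A. y < f x} < card {y \<in> A. y < x}" if "f x < x"
    by (rule psubset_card_mono) (use A f x that in \<open>auto intro: less_trans\<close>)
  ultimately have 1: "\<not> f x < x" by fastforce
  have "card {y \<in> A. x < y} \<le> card {y \<in> A. f x < y}"
    by (rule card_inj_on_le[of f]) (use A f mono x inj in \<open>auto intro: inj_on_subset\<close>)
  moreover have "card {y \<in> A. f x < y} < card {y \<in> A. x < y}" if "x < f x"
    by (rule psubset_card_mono) (use A f x that in \<open>auto intro: less_trans\<close>)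
  ultimately have "\<not> x < f x" by fastforce
  with 1 show ?thesis by auto
qed

section \<open>Surjective dynamics and its three blocks\<close>

context cyclic_arcs
begin

context
  fixes X :: "'v set" and v0 :: real
  assumes X: "finite X" and XR: "X \<subseteq> range e"
    and surj: "\<And>x. x \<in> lift X \<Longrightarrow> \<exists>y \<in> lift X. adv X y = x"
    and v0: "v0 \<in> lift X" and p0: "(adv X ^^ 3) v0 = v0 + 1"
begin

text \<open>The lift is infinite, so the counting takes place on the quotient: \<open>f\<close> is
  the induced map on the finite set \<open>X\<close>, well defined because \<open>adv\<close>
  commutes with full turns, and onto, hence injective. Two lifted points with equal image then
  differ by whole turns, and the same equivariance makes them equal.\<close>

lemma adv_inj: "inj_on (adv X) (lift X)"
proof -
  define f where "f v = e (adv X (SOME x. e x = v))" for v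
  have f: "f (e x) = e (adv X x)" if "x \<in> lift X" for x
  proof -
    have "e (SOME y. e y = e x) = e x" by (rule someI[of "\<lambda>y. e y = e x" x]) simp
    then obtain n :: int where "(SOME y. e y = e x) = x + of_int n" using e_eq by metis
    then show ?thesis by (simp add: f_def adv_shift[OF X that])
  qed
  have "X \<subseteq> f ` X"
  proof
    fix u assume u: "u \<in> X"
    then obtain x where x: "e x = u" using XR by blast
    then have "x \<in> lift X" using u by (simp add: lift_def)
    then obtain y where y: "y \<in> lift X" "adv X y = x" using surj by blast
    then show "u \<in> f ` X" using f[OF y(1)] x by (intro image_eqI[of _ _ "e y"]) (auto simp: lift_def)
  qed
  then have inj: "inj_on f X" by (rule finite_surj_inj[OF X])
  show ?thesis
  proof (rule inj_onI)
    fix x y assume xy: "x \<in> lift X" "y \<in> lift X" "adv X x = adv X y"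
    then have "f (e x) = f (e y)" using f by simp
    then have "e x = e y" using inj xy by (auto simp: lift_def dest: inj_onD)
    then obtain n :: int where n: "y = x + of_int n" using e_eq by blast
    then show "x = y" using xy adv_shift[OF X xy(1), of n] by simp
  qed
qed

lemma adv_strict:
  assumes "x \<in> lift X" "y \<in> lift X"
  shows "adv X x < adv X y \<longleftrightarrow> x < y"
  using adv_mono[OF X assms] adv_mono[OF X assms(2,1)] inj_onD[OF adv_inj _ assms]
  by (metis leD le_less_linear less_le order_less_irrefl)

lemma adv_pow_strict:
  assumes "x \<in> lift X" "y \<in> lift X"
  shows "(adv X ^^ k) x < (adv X ^^ k) y \<longleftrightarrow> x < y"
  by (induction k) (simp_all add: adv_strict adv_pow_in[OF X] assms)

lemma adv_pow_surj:
  assumes "x \<in> lift X"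
  shows "\<exists>y \<in> lift X. (adv X ^^ k) y = x"
proof (induction k)
  case (Suc k)
  then obtain y where y: "y \<in> lift X" "(adv X ^^ k) y = x" by blast
  obtain z where "z \<in> lift X" "adv X z = y" using surj[OF y(1)] by blast
  then have "z \<in> lift X" "(adv X ^^ Suc k) z = x" using y by (simp_all add: funpow_Suc_right del: funpow.simps)
  then show ?case by blast
qed (use assms in simp)

text \<open>One orbit of period three forces the period on all points: the third iterate, shifted
  back by a turn, is a strictly increasing self-map of the finite window from \<open>v0\<close> to
  \<open>v0 + 1\<close>, hence the identity there.\<close>

lemma period3:
  assumes "x \<in> lift X"
  shows "(adv X ^^ 3) x = x + 1"
proof -
  define T where "T y = (adv X ^^ 3) y - 1" for y
  have T: "T y = y" if "y \<in> {y \<in> lift X. v0 \<le> y \<and> y < v0 + 1}" for y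
  proof (rule strict_mono_finite_id[OF finite_lift[OF X] _ _ that])
    fix y assume y: "y \<in> {y \<in> lift X. v0 \<le> y \<and> y < v0 + 1}"
    have "(adv X ^^ 3) v0 \<le> (adv X ^^ 3) y" using y v0 by (intro adv_pow_mono[OF X]) auto
    moreover have "(adv X ^^ 3) y < (adv X ^^ 3) (v0 + of_int 1)"
      using y v0 by (subst adv_pow_strict) auto
    ultimately show "T y \<in> {y \<in> lift X. v0 \<le> y \<and> y < v0 + 1}"
      using y p0 adv_pow_shift[OF X v0, of 3 1] adv_pow_in[OF X, of y 3] by (simp add: T_def)
  next
    fix y z assume "y \<in> {y \<in> lift X. v0 \<le> y \<and> y < v0 + 1}" "z \<in> {y \<in> lift X. v0 \<le> y \<and> y < v0 + 1}" "y < z"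
    then show "T y < T z" using adv_pow_strict[of y z 3] by (simp add: T_def)
  qed
  define y where "y = x - of_int \<lfloor>x - v0\<rfloor>"
  have y: "y \<in> lift X" "v0 \<le> y" "y < v0 + 1" using assms unfolding y_def by (simp, linarith, linarith)
  then have "(adv X ^^ 3) y = y + 1" using T[of y] by (simp add: T_def)
  moreover have "x = y + of_int \<lfloor>x - v0\<rfloor>" by (simp add: y_def)
  ultimately show ?thesis using adv_pow_shift[OF X y(1), of 3 "\<lfloor>x - v0\<rfloor>"] by simp
qed

lemmas adv_pow_pos = period3_strict[OF X v0 p0]

text \<open>The interval from \<open>v0\<close> to \<open>adv X v0\<close> is a fundamental domain
  of the dynamics. Its successive images follow one another without overlap, so advanced points are
  ordered by exponent first and by starting point second.\<close>

lemma block_order: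
  assumes a: "a \<in> lift X" "v0 \<le> a" "a < adv X v0" and b: "b \<in> lift X" "v0 \<le> b" "b < adv X v0"
  shows "(adv X ^^ k) a < (adv X ^^ l) b \<longleftrightarrow> k < l \<or> (k = l \<and> a < b)"
proof -
  have lt: "(adv X ^^ k) a < (adv X ^^ l) b"
    if kl: "k < l" and a: "a \<in> lift X" "v0 \<le> a" "a < adv X v0" and b: "b \<in> lift X" "v0 \<le> b" "b < adv X v0"
    for a b k l
  proof -
    obtain m where m: "l = k + Suc m" using less_imp_Suc_add[OF kl] by auto
    have ge: "x \<le> (adv X ^^ m) x" if "x \<in> lift X" for x
      by (induction m) (use adv_ge[OF X] adv_pow_in[OF X that] that in \<open>auto intro: order_trans\<close>)
    have "a < adv X v0" by (rule a)
    also have "\<dots> \<le> adv X b" using v0 b by (intro adv_mono[OF X])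
    also have "\<dots> \<le> (adv X ^^ m) (adv X b)" using adv_in(1)[OF X b(1)] by (rule ge)
    also have "\<dots> = (adv X ^^ Suc m) b" by (simp add: funpow_swap1)
    finally show ?thesis unfolding m
      using adv_pow_strict[OF a(1) adv_pow_in[OF X b(1), of "Suc m"], of k] by (simp only: funpow_add o_apply)
  qed
  show ?thesis
    using lt[of k l a b] lt[of l k b a] adv_pow_strict[OF a(1) b(1), of k] assms
    by (metis less_asym linorder_neqE_nat)
qed

lemma block_window:
  assumes c: "c \<in> lift X" "v0 \<le> c" "c < adv X v0" and j: "j < 3"
  shows "v0 \<le> (adv X ^^ j) c" "(adv X ^^ j) c < v0 + 1"
proof -
  have "\<not> (adv X ^^ j) c < (adv X ^^ 0) v0" using block_order[OF c v0, of j 0] c adv_pow_pos by auto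
  then show "v0 \<le> (adv X ^^ j) c" by simp
  have "(adv X ^^ j) c < (adv X ^^ 3) v0" using block_order[OF c v0, of j 3] j adv_pow_pos by auto
  then show "(adv X ^^ j) c < v0 + 1" by (simp only: p0)
qed

lemma adv_pow_3m: "x \<in> lift X \<Longrightarrow> (adv X ^^ (k + 3 * m)) x = (adv X ^^ k) x + real m"
  using adv_pow_period[OF X _ period3, of x m] adv_pow_shift[OF X, of x k "int m"]
  by (simp add: funpow_add)

text \<open>An edge from an advanced \<open>a\<close> ends no later than the next iterate of
  \<open>a\<close>; by the lexicographic order it ends in the same block beyond \<open>a\<close>, or
  in the next block at a start not beyond \<open>a\<close>. A full turn equals three advances, so
  different lifts of a vertex only change exponents by multiples of 3.\<close>

lemma adj_blocks:
  assumes a: "a \<in> lift X" "v0 \<le> a" "a < adv X v0" and b: "b \<in> lift X" "v0 \<le> b" "b < adv X v0"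
    and kl: "k < 3" "l < 3"
  shows "adj (e ((adv X ^^ k) a)) (e ((adv X ^^ l) b)) \<longleftrightarrow>
     k = l \<or> (l = (k + 1) mod 3 \<and> b \<le> a) \<or> (k = (l + 1) mod 3 \<and> a \<le> b)"
    (is "?lhs \<longleftrightarrow> ?rhs")
proof -
  have R_iff: "R ((adv X ^^ k) a) ((adv X ^^ l) b) \<longleftrightarrow> (k = l \<and> a < b) \<or> (l = Suc k \<and> b \<le> a)"
    if a: "a \<in> lift X" "v0 \<le> a" "a < adv X v0" and b: "b \<in> lift X" "v0 \<le> b" "b < adv X v0" for a b k l
  proof -
    have "R ((adv X ^^ k) a) ((adv X ^^ l) b) \<longleftrightarrow>
        (adv X ^^ k) a < (adv X ^^ l) b \<and> \<not> (adv X ^^ Suc k) a < (adv X ^^ l) b"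
      using R_iff_adv[OF X adv_pow_in[OF X a(1)] adv_pow_in[OF X b(1)], of k l] by (simp add: not_less)
    then show ?thesis unfolding block_order[OF a b] by auto
  qed
  have one: "(k = l \<and> a < b) \<or> (l = (k + 1) mod 3 \<and> b \<le> a)"
    if ee: "e x' = e ((adv X ^^ k) a)" "e y' = e ((adv X ^^ l) b)" and "R x' y'" "k < 3" "l < 3"
     and a: "a \<in> lift X" "v0 \<le> a" "a < adv X v0" and b: "b \<in> lift X" "v0 \<le> b" "b < adv X v0" for x' y' a b k l
  proof -
    obtain m n :: int where mn: "x' = (adv X ^^ k) a + of_int m" "y' = (adv X ^^ l) b + of_int n"
      using ee[symmetric] unfolding e_eq by blast
    \<comment> \<open>Raising both turn numbers by the same amount makes them non-negative, so that
      they can be absorbed into the exponents of \<open>adv\<close>.\<close>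
    define M where "M = nat (m + (\<bar>m\<bar> + \<bar>n\<bar>))"
    define N where "N = nat (n + (\<bar>m\<bar> + \<bar>n\<bar>))"
    have "real M = of_int (m + (\<bar>m\<bar> + \<bar>n\<bar>))" "real N = of_int (n + (\<bar>m\<bar> + \<bar>n\<bar>))"
      by (simp_all add: M_def N_def)
    then have "(adv X ^^ (k + 3 * M)) a = x' + of_int (\<bar>m\<bar> + \<bar>n\<bar>)" "(adv X ^^ (l + 3 * N)) b = y' + of_int (\<bar>m\<bar> + \<bar>n\<bar>)"
      using adv_pow_3m[OF a(1), of k M] adv_pow_3m[OF b(1), of l N] mn by simp_all
    then have "R ((adv X ^^ (k + 3 * M)) a) ((adv X ^^ (l + 3 * N)) b)"
      using that(3) R_shift[of x' "\<bar>m\<bar> + \<bar>n\<bar>" y'] by simp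
    then have *: "(k + 3 * M = l + 3 * N \<and> a < b) \<or> (l + 3 * N = k + 1 + 3 * M \<and> b \<le> a)"
      using R_iff[OF a b, of "k + 3 * M" "l + 3 * N"] by simp
    have "k mod 3 = l mod 3" if "k + 3 * M = l + 3 * N"
      using arg_cong[OF that, of "\<lambda>x. x mod 3"] by simp
    moreover have "l mod 3 = (k + 1) mod 3" if "l + 3 * N = k + 1 + 3 * M"
      using arg_cong[OF that, of "\<lambda>x. x mod 3"] by (simp only: mod_mult_self2)
    moreover have "k mod 3 = k" "l mod 3 = l" using that(4,5) by auto
    ultimately show ?thesis using * by metis
  qed
  have edge: "adj (e ((adv X ^^ k) a)) (e ((adv X ^^ l) b))"
    if "k < 3" "l = (k + 1) mod 3" "b \<le> a" and a: "a \<in> lift X" "v0 \<le> a" "a < adv X v0" and b: "b \<in> lift X" "v0 \<le> b" "b < adv X v0" for a b k l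
  proof -
    have "e ((adv X ^^ Suc k) b) = e ((adv X ^^ l) b)"
    proof (cases "k = 2")
      case True
      then have "Suc k = 0 + 3 * 1" "l = 0" using that(2) by auto
      then show ?thesis using adv_pow_3m[OF b(1), of 0 1] by simp
    next
      case False
      then have "l = Suc k" using that(1,2) by auto
      then show ?thesis by simp
    qed
    moreover have "R ((adv X ^^ k) a) ((adv X ^^ Suc k) b)" using R_iff[OF a b, of k "Suc k"] that(3) by simp
    ultimately show ?thesis using R_adj(1) by metis
  qed
  have same: "adj (e ((adv X ^^ k) a)) (e ((adv X ^^ k) b))"
    using R_iff[OF a b, of k k] R_iff[OF b a, of k k] R_adj adj_refl by (metis neq_iff)
  show ?thesis
  proof
    assume ?lhs
    then consider "e ((adv X ^^ k) a) = e ((adv X ^^ l) b)"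
      | x' y' where "e x' = e ((adv X ^^ k) a)" "e y' = e ((adv X ^^ l) b)" "R x' y'"
      | x' y' where "e x' = e ((adv X ^^ k) a)" "e y' = e ((adv X ^^ l) b)" "R y' x'"
      unfolding adj_def by blast
    then show ?rhs
    proof cases
      case 1
      have "(adv X ^^ k) a = (adv X ^^ l) b"
        using inj_onD[OF inj_on_e[of v0] 1] block_window[OF a kl(1)] block_window[OF b kl(2)] by auto
      then show ?thesis using block_order[OF a b, of k l] block_order[OF b a, of l k] by auto
    next
      case 2
      then show ?thesis using one[OF 2 kl a b] by auto
    next
      case 3
      then show ?thesis using one[OF 3(2,1,3) kl(2,1) b a] by auto
    qed
  next
    assume ?rhs
    then show ?lhs using same edge[OF kl(1) _ _ a b, of l] edge[OF kl(2) _ _ b a, of k] adj_sym by auto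
  qed
qed

text \<open>The increasing enumeration of the first block numbers the orbits in clockwise order,
  which is the order in \<open>block_adj\<close>. With a single orbit every vertex would belong to
  the orbit of \<open>v0\<close>; the vertex \<open>e v1\<close> excludes this.\<close>

lemma block_structure:
  assumes v1: "v1 \<in> lift X" "e v1 \<notin> {e v0, e (adv X v0), e (adv X (adv X v0))}"
  shows "\<exists>P\<ge>2. geom_real X (cliques X) homotopy_equivalent_space blocks P"
proof -
  define A where "A = {x \<in> lift X. v0 \<le> x \<and> x < adv X v0}"
  define P where "P = card A"
  define a where "a i = sorted_list_of_set A ! i" for i
  have fA: "finite A" unfolding A_def
    by (rule finite_subset[OF _ finite_lift[OF X, of v0]]) (use adv_pow_pos in auto)
  have a_bij: "bij_betw a {..<P} A"
    using bij_betw_nth[of "sorted_list_of_set A" "{..<P}" A] fA by (simp add: a_def[abs_def] P_def)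
  have a_mono: "a i < a j" if "i < j" "j < P" for i j
    using sorted_wrt_nth_less[OF strict_sorted_list_of_set[of A] that(1)] that(2) by (simp add: a_def P_def)
  have a_le: "a j \<le> a i \<longleftrightarrow> j \<le> i" if "i < P" "j < P" for i j
    using a_mono[of i j] a_mono[of j i] that by (cases i j rule: linorder_cases) auto
  have aA: "a i \<in> lift X" "v0 \<le> a i" "a i < adv X v0" if "i < P" for i
    using bij_betwE[OF a_bij] that by (auto simp: A_def)
  define \<phi> where "\<phi> = (\<lambda>(i, k). e ((adv X ^^ k) (a i)))"
  have X_ex: "\<exists>i<P. \<exists>k<3. u = e ((adv X ^^ k) (a i))" if uX: "u \<in> X" for u
  proof -
    obtain x0 where "u = e x0" using XR uX by blast
    then obtain x where x: "v0 \<le> x" "x < v0 + 1" "e x = u" using lift_window[of v0 x0] by auto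
    have xX: "x \<in> lift X" using x uX by (simp add: lift_def)
    have "\<exists>k<3. (adv X ^^ k) v0 \<le> x \<and> x < (adv X ^^ k) (adv X v0)"
    proof -
      consider "x < adv X v0" | "adv X v0 \<le> x" "x < adv X (adv X v0)" | "adv X (adv X v0) \<le> x" by linarith
      then show ?thesis
      proof cases
        case 1 then show ?thesis using x by (intro exI[of _ 0]) auto
      next
        case 2 then show ?thesis by (intro exI[of _ 1]) auto
      next
        case 3 then show ?thesis using x p0 by (intro exI[of _ 2]) (auto simp: numeral_2_eq_2 numeral_3_eq_3)
      qed
    qed
    then obtain k where k: "k < 3" "(adv X ^^ k) v0 \<le> x" "x < (adv X ^^ k) (adv X v0)" by blast
    obtain y where y: "y \<in> lift X" "(adv X ^^ k) y = x" using adv_pow_surj[OF xX] by blast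
    have "y \<in> A"
      using k y adv_pow_strict[OF y(1) v0, of k] adv_pow_strict[OF y(1) adv_in(1)[OF X v0], of k]
      by (auto simp: A_def not_less[symmetric])
    then obtain i where "i < P" "a i = y" using a_bij by (auto simp: bij_betw_def)
    then show ?thesis using k(1) y(2) x(3) by blast
  qed
  have inj: "inj_on \<phi> (verts P)"
  proof (rule inj_onI)
    fix u v assume uv: "u \<in> verts P" "v \<in> verts P" "\<phi> u = \<phi> v"
    obtain i k j l where e: "u = (i, k)" "v = (j, l)" by (cases u, cases v) auto
    have lt: "i < P" "j < P" "k < 3" "l < 3" using uv by (auto simp: e verts_def)
    have eq: "(adv X ^^ k) (a i) = (adv X ^^ l) (a j)"
      using inj_onD[OF inj_on_e[of v0], of "(adv X ^^ k) (a i)" "(adv X ^^ l) (a j)"] uv(3)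
        block_window[OF aA[OF lt(1)] lt(3)] block_window[OF aA[OF lt(2)] lt(4)] by (auto simp: \<phi>_def e)
    then have "k = l" "a i = a j"
      using block_order[OF aA[OF lt(1)] aA[OF lt(2)], of k l] block_order[OF aA[OF lt(2)] aA[OF lt(1)], of l k]
      by auto
    then show "u = v" using a_bij lt by (auto simp: e bij_betw_def dest: inj_onD)
  qed
  have im: "\<phi> ` verts P = X"
  proof
    show "\<phi> ` verts P \<subseteq> X"
    proof (clarsimp simp: \<phi>_def verts_def)
      fix i k assume "i < P" "k < (3::nat)"
      then show "e ((adv X ^^ k) (a i)) \<in> X" using adv_pow_in[OF X aA(1)[of i], of k] by (simp add: lift_def)
    qed
    show "X \<subseteq> \<phi> ` verts P"
    proof
      fix u assume "u \<in> X"
      then obtain i k where "i < P" "k < 3" "u = e ((adv X ^^ k) (a i))" using X_ex by blast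
      then show "u \<in> \<phi> ` verts P" by (intro image_eqI[of _ _ "(i, k)"]) (auto simp: \<phi>_def verts_def)
    qed
  qed
  have adj_iff: "adj (\<phi> u) (\<phi> v) \<longleftrightarrow> block_adj u v" if "u \<in> verts P" "v \<in> verts P" for u v
  proof -
    obtain i k j l where e: "u = (i, k)" "v = (j, l)" by (cases u, cases v) auto
    have lt: "i < P" "j < P" "k < 3" "l < 3" using that by (auto simp: e verts_def)
    show ?thesis
      unfolding e \<phi>_def prod.case adj_blocks[OF aA[OF lt(1)] aA[OF lt(2)] lt(3,4)] block_adj_def
      using a_le[OF lt(1,2)] a_le[OF lt(2,1)] by simp
  qed
  have "blocks P homotopy_equivalent_space geom_real X (cliques X)"
  proof (rule geom_real_iso[of \<phi>])
    show "bij_betw \<phi> (verts P) X" using inj im by (simp add: bij_betw_def)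
    fix \<sigma> assume s: "\<sigma> \<subseteq> verts P"
    have "(\<forall>u\<in>\<sigma>. \<forall>v\<in>\<sigma>. block_adj u v) \<longleftrightarrow> (\<forall>u\<in>\<phi> ` \<sigma>. \<forall>v\<in>\<phi> ` \<sigma>. adj u v)"
    proof -
      have "adj (\<phi> u) (\<phi> v) \<longleftrightarrow> block_adj u v" if "u \<in> \<sigma>" "v \<in> \<sigma>" for u v
        using that s adj_iff by blast
      then show ?thesis by auto
    qed
    moreover have "\<phi> ` \<sigma> \<subseteq> X" "finite (\<phi> ` \<sigma>)"
      using s im finite_subset[OF s finite_verts] by auto
    ultimately show "\<sigma> \<in> block_complex P \<longleftrightarrow> \<phi> ` \<sigma> \<in> cliques X"
      using s by (simp add: block_complex_def cliques_def)
  qed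
  moreover have "2 \<le> P"
  proof (rule ccontr)
    assume "\<not> 2 \<le> P"
    have "v0 \<in> A" using v0 adv_pow_pos by (simp add: A_def)
    have "e v1 \<in> X" using v1(1) by (simp add: lift_def)
    then obtain i k where ik: "i < P" "k < 3" "e v1 = e ((adv X ^^ k) (a i))" using X_ex by blast
    obtain j where "j < P" "a j = v0" using \<open>v0 \<in> A\<close> a_bij by (auto simp: bij_betw_def)
    moreover have "i = j" using ik(1) \<open>j < P\<close> \<open>\<not> 2 \<le> P\<close> by linarith
    ultimately show False using ik(2,3) v1(2) unfolding less_3_iff by (auto simp: numeral_2_eq_2)
  qed
  ultimately show ?thesis using homotopy_equivalent_space_sym by blast
qed

end

theorem cliques_wedge:
  assumes X: "finite X" "X \<subseteq> range e"
    and v: "v0 \<in> lift X" "(adv X ^^ 3) v0 = v0 + 1" "v1 \<in> lift X" "(adv X ^^ 3) v1 = v1 + 1"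
    and ne: "e v1 \<notin> {e v0, e (adv X v0), e (adv X (adv X v0))}"
  shows "\<exists>k\<ge>1. geom_real X (cliques X) homotopy_equivalent_space wedge_S2 k"
proof -
  obtain X' where X': "X' \<subseteq> X"
    "geom_real X (cliques X) homotopy_equivalent_space geom_real X' (cliques X')"
    "\<And>y. y \<in> lift X' \<Longrightarrow> adv X' y = adv X y"
    "\<And>x. x \<in> lift X' \<Longrightarrow> \<exists>y \<in> lift X'. adv X' y = x"
    "\<And>S. S \<subseteq> X \<Longrightarrow> (\<And>x. x \<in> lift S \<Longrightarrow> \<exists>y \<in> lift S. adv X y = x) \<Longrightarrow> S \<subseteq> X'"
    using dismantle[OF X(1)] by metis
  have orbit: "{e w, e (adv X w), e (adv X (adv X w))} \<subseteq> X'"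
    if w: "w \<in> lift X" "(adv X ^^ 3) w = w + 1" for w
  proof (rule X'(5))
    show "{e w, e (adv X w), e (adv X (adv X w))} \<subseteq> X"
      using w(1) adv_in(1)[OF X(1)] unfolding lift_def by simp
    fix x assume "x \<in> lift {e w, e (adv X w), e (adv X (adv X w))}"
    then have "e w = e x \<or> e (adv X w) = e x \<or> e (adv X (adv X w)) = e x" by (auto simp: lift_def)
    then obtain n :: int where n: "x = w + of_int n \<or> x = adv X w + of_int n \<or> x = adv X (adv X w) + of_int n"
      unfolding e_eq by blast
    have w': "adv X w \<in> lift X" "adv X (adv X w) \<in> lift X" using w(1) adv_in(1)[OF X(1)] by auto
    \<comment> \<open>The orbit must be covered by its own image. The predecessor of
      \<open>w\<close> is the third orbit point of the previous turn, hence the shift by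
      \<open>n - 1\<close>.\<close>
    have "w = adv X (adv X (adv X w)) + of_int (-1)" using w(2) by (simp add: numeral_3_eq_3)
    then have "w + of_int n = adv X (adv X (adv X w)) + of_int (n - 1)" by simp
    then have "x = adv X (adv X (adv X w) + of_int (n - 1)) \<or> x = adv X (w + of_int n) \<or> x = adv X (adv X w + of_int n)"
      using n adv_shift[OF X(1) w'(2), of "n - 1"] adv_shift[OF X(1) w(1), of n] adv_shift[OF X(1) w'(1), of n]
      by argo
    then show "\<exists>y \<in> lift {e w, e (adv X w), e (adv X (adv X w))}. adv X y = x"
    proof (elim disjE)
      assume "x = adv X (adv X (adv X w) + of_int (n - 1))"
      then show ?thesis
        by (intro bexI[of _ "adv X (adv X w) + of_int (n - 1)"]) (simp_all add: lift_def del: of_int_diff)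
    next
      assume "x = adv X (w + of_int n)"
      then show ?thesis by (intro bexI[of _ "w + of_int n"]) (simp_all add: lift_def)
    next
      assume "x = adv X (adv X w + of_int n)"
      then show ?thesis by (intro bexI[of _ "adv X w + of_int n"]) (simp_all add: lift_def)
    qed
  qed
  have in': "v0 \<in> lift X'" "v1 \<in> lift X'" "adv X v0 \<in> lift X'" "adv X (adv X v0) \<in> lift X'"
    using orbit[OF v(1,2)] orbit[OF v(3,4)] by (auto simp: lift_def)
  have a: "adv X' v0 = adv X v0" "adv X' (adv X v0) = adv X (adv X v0)"
      "adv X' (adv X (adv X v0)) = adv X (adv X (adv X v0))"
    using X'(3) in' by auto
  have "\<exists>P\<ge>2. geom_real X' (cliques X') homotopy_equivalent_space blocks P"
  proof (rule block_structure[OF _ _ X'(4) in'(1) _ in'(2)])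
    show "finite X'" "X' \<subseteq> range e" using X'(1) X finite_subset by auto
    show "(adv X' ^^ 3) v0 = v0 + 1" using v(2) by (simp add: numeral_3_eq_3 a)
    show "e v1 \<notin> {e v0, e (adv X' v0), e (adv X' (adv X' v0))}" using ne by (simp add: a)
  qed
  then obtain P where P: "2 \<le> P"
    "geom_real X' (cliques X') homotopy_equivalent_space blocks P"
    by blast
  have "geom_real X (cliques X) homotopy_equivalent_space wedge_S2 (P - 1)"
    by (rule homotopy_eqv_trans[OF X'(2) homotopy_eqv_trans[OF P(2) block_complex_wedge[OF P(1)]]])
  then show ?thesis using P(1) by (intro exI[of _ "P - 1"]) auto
qed

end

section \<open>Chords of the ellipse\<close>

text \<open>The squared length of the chord between two parameters. In this product the first factor
  depends only on the arc between them; the second depends only on their midpoint and measures how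
  the chord is turned relative to the axes.\<close>

definition chord2 :: "real \<Rightarrow> real \<Rightarrow> real \<Rightarrow> real" where
  "chord2 a x y = 4 * (sin (pi * (y - x)))\<^sup>2 * (1 + (a\<^sup>2 - 1) * (sin (pi * (x + y)))\<^sup>2)"

lemma dist_ellpt: "(dist (ellpt a x) (ellpt a y))\<^sup>2 = chord2 a x y"
proof -
  define S where "S = sin (pi * (x + y))"
  define C where "C = cos (pi * (x + y))"
  define s where "s = sin (pi * (y - x))"
  have h: "(2 * pi * x + 2 * pi * y) / 2 = pi * (x + y)" "(2 * pi * y - 2 * pi * x) / 2 = pi * (y - x)"
      "(2 * pi * y + 2 * pi * x) / 2 = pi * (x + y)"
    by (simp_all add: field_simps)
  have c: "cos (2 * pi * x) - cos (2 * pi * y) = 2 * S * s"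
    unfolding cos_diff_cos h by (simp add: S_def s_def)
  have d: "sin (2 * pi * y) - sin (2 * pi * x) = 2 * s * C"
    unfolding sin_diff_sin h by (simp add: C_def s_def)
  have "(dist (ellpt a x) (ellpt a y))\<^sup>2 =
     (a * cos (2 * pi * x) - a * cos (2 * pi * y))\<^sup>2 + (sin (2 * pi * y) - sin (2 * pi * x))\<^sup>2"
    by (simp add: ellpt_def dist_Pair_Pair dist_real_def)
  also have "a * cos (2 * pi * x) - a * cos (2 * pi * y) = a * (2 * S * s)"
    unfolding c[symmetric] by (simp add: algebra_simps)
  also have "(a * (2 * S * s))\<^sup>2 + (sin (2 * pi * y) - sin (2 * pi * x))\<^sup>2 = 4 * s\<^sup>2 * (a\<^sup>2 * S\<^sup>2 + C\<^sup>2)"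
    unfolding d by (simp add: power_mult_distrib algebra_simps)
  also have "C\<^sup>2 = 1 - S\<^sup>2" by (simp add: S_def C_def cos_squared_eq)
  finally show ?thesis by (simp add: chord2_def S_def s_def algebra_simps)
qed

lemma ellpt_eq_iff:
  assumes "a \<noteq> 0"
  shows "ellpt a x = ellpt a y \<longleftrightarrow> (\<exists>n::int. y = x + of_int n)"
proof -
  have "ellpt a x = ellpt a y \<longleftrightarrow> sin (2 * pi * y) = sin (2 * pi * x) \<and> cos (2 * pi * y) = cos (2 * pi * x)"
    using assms by (auto simp: ellpt_def)
  also have "\<dots> \<longleftrightarrow> (\<exists>n::int. 2 * pi * y = 2 * pi * x + 2 * pi * of_int n)"
    by (rule sin_cos_eq_iff)
  also have "\<dots> \<longleftrightarrow> (\<exists>n::int. y = x + of_int n)"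
    by (simp flip: distrib_left)
  finally show ?thesis .
qed

lemma ellpt_in_ellipse: "a \<noteq> 0 \<Longrightarrow> ellpt a x \<in> ellipse a"
  by (simp add: ellpt_def ellipse_def)

lemma ellipse_eq_range:
  assumes "a \<noteq> 0"
  shows "ellipse a = range (ellpt a)"
proof
  show "range (ellpt a) \<subseteq> ellipse a" using ellpt_in_ellipse[OF assms] by blast
  show "ellipse a \<subseteq> range (ellpt a)"
  proof
    fix p assume p: "p \<in> ellipse a"
    obtain x y where xy: "p = (x, y)" by force
    have "(x / a)\<^sup>2 + (- y)\<^sup>2 = 1" using p by (simp add: ellipse_def xy)
    then obtain t where t: "x / a = cos t" "- y = sin t" using sincos_total_2pi by metis
    have "p = ellpt a (t / (2 * pi))" using t assms by (simp add: xy ellpt_def field_simps)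
    then show "p \<in> range (ellpt a)" by blast
  qed
qed

lemma ang_ellpt:
  assumes "a \<noteq> 0"
  shows "ang a (ellpt a x) = frac x"
  unfolding ang_def
proof (rule the_equality)
  have "ellpt a (frac x) = ellpt a x"
    unfolding ellpt_eq_iff[OF assms] frac_def by (intro exI[of _ "\<lfloor>x\<rfloor>"]) simp
  then show "0 \<le> frac x \<and> frac x < 1 \<and> ellpt a (frac x) = ellpt a x" by (simp add: frac_lt_1)
  fix t assume t: "0 \<le> t \<and> t < 1 \<and> ellpt a t = ellpt a x"
  then obtain n :: int where "x = t + of_int n" using ellpt_eq_iff[OF assms] by blast
  then show "t = frac x" using t by (simp add: frac_eq)
qed

lemma frac_add_int: "frac (x + of_int n) = frac x"
  by (simp add: frac_def)

lemma cw_ellpt: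
  assumes "a \<noteq> 0"
  shows "cw a (ellpt a x) (ellpt a y) = frac (y - x)"
proof -
  have "frac y - frac x = (y - x) + of_int (\<lfloor>x\<rfloor> - \<lfloor>y\<rfloor>)" by (simp add: frac_def)
  then have "frac (frac y - frac x) = frac (y - x)" by (simp add: frac_add_int del: of_int_diff)
  then show ?thesis by (simp add: cw_def ang_ellpt[OF assms])
qed

lemma chord2_flip: "chord2 a (- y) (- x) = chord2 a x y"
proof -
  have "pi * (- x - - y) = pi * (y - x)" "pi * (- y + - x) = - (pi * (x + y))" by (simp_all add: algebra_simps)
  then show ?thesis by (simp add: chord2_def)
qed

lemma chord2_sym: "chord2 a y x = chord2 a x y"
  unfolding dist_ellpt[symmetric] by (simp add: dist_commute)

lemma chord2_shift:
  assumes "a \<noteq> 0"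
  shows "chord2 a (x + of_int n) y = chord2 a x y" "chord2 a x (y + of_int n) = chord2 a x y"
proof -
  have "ellpt a (x + of_int n) = ellpt a x" "ellpt a (y + of_int n) = ellpt a y"
    using ellpt_eq_iff[OF assms] by metis+
  then show "chord2 a (x + of_int n) y = chord2 a x y" "chord2 a x (y + of_int n) = chord2 a x y"
    by (simp_all flip: dist_ellpt)
qed

text \<open>Half a turn leads to the antipode, and no diameter is shorter than the minor axis 2.
  Hence a chord shorter than 2 always has a well-defined shorter side.\<close>

lemma chord2_half:
  assumes "1 \<le> a"
  shows "4 \<le> chord2 a x (x + 1/2)"
proof -
  have "0 \<le> (a\<^sup>2 - 1) * (sin (pi * (x + (x + 1/2))))\<^sup>2" using assms by simp
  then show ?thesis by (simp add: chord2_def)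
qed

lemma chord2_same [simp]: "chord2 a x x = 0"
  by (simp add: chord2_def)

text \<open>Since \<open>chord2 < 4\<close> reads \<open>cos\<^sup>2 w > b S\<^sup>2 sin\<^sup>2 w\<close>, the turning of the direction of the chord
  cannot compensate for its growth.\<close>

lemma chord_deriv_pos:
  fixes w m b :: real
  assumes w: "0 < w" "w < pi / 2" and b: "0 \<le> b" "b \<le> 1"
    and less: "(sin w)\<^sup>2 * (1 + b * (sin m)\<^sup>2) < 1"
  shows "cos w * (1 + b * (sin m)\<^sup>2) + b * sin w * (sin m * cos m) > 0"
proof (rule ccontr)
  assume "\<not> ?thesis"
  then have le: "cos w * (1 + b * (sin m)\<^sup>2) \<le> - (b * sin w * (sin m * cos m))" by simp
  have c: "cos w > 0" using w by (intro cos_gt_zero)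
  have "cos w * 1 \<le> cos w * (1 + b * (sin m)\<^sup>2)" using c b by (intro mult_left_mono) auto
  with le have "cos w \<le> - (b * sin w * (sin m * cos m))" by simp
  then have "(cos w)\<^sup>2 \<le> (b * sin w * (sin m * cos m))\<^sup>2"
    using c power_mono[of "cos w" "- (b * sin w * (sin m * cos m))" 2] by simp
  also have "\<dots> = (b\<^sup>2 * (cos m)\<^sup>2) * ((sin w)\<^sup>2 * (sin m)\<^sup>2)"
    by (simp add: power_mult_distrib mult_ac)
  also have "\<dots> \<le> b * ((sin w)\<^sup>2 * (sin m)\<^sup>2)"
  proof (rule mult_right_mono)
    have "b\<^sup>2 * (cos m)\<^sup>2 \<le> b\<^sup>2 * 1" by (intro mult_left_mono) (auto simp: abs_square_le_1)
    also have "\<dots> \<le> b" using b mult_left_le[of b b] by (simp add: power2_eq_square)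
    finally show "b\<^sup>2 * (cos m)\<^sup>2 \<le> b" .
  qed simp
  finally have "(cos w)\<^sup>2 \<le> b * ((sin w)\<^sup>2 * (sin m)\<^sup>2)" .
  then show False using less by (simp add: cos_squared_eq algebra_simps)
qed

text \<open>Between the two endpoints the chord is not known beforehand to be below 2, so its
  derivative cannot be controlled throughout. Instead, if the claim failed, a minimum over the
  interval would be attained to the right of \<open>y'\<close>; there the value is below 4, the
  derivative is positive, and a slightly earlier point gives a smaller value.\<close>

lemma chord2_less_right:
  assumes a: "1 \<le> a" "a\<^sup>2 \<le> 2" and y: "x \<le> y'" "y' < y" "y < x + 1/2" and less: "chord2 a x y < 4"
  shows "chord2 a x y' < chord2 a x y"
proof (rule ccontr)
  assume n: "\<not> ?thesis"
  let ?f = "chord2 a x"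
  have "continuous_on {y'..y} ?f" unfolding chord2_def by (intro continuous_intros)
  then obtain z0 where z0: "z0 \<in> {y'..y}" "\<And>u. u \<in> {y'..y} \<Longrightarrow> ?f z0 \<le> ?f u"
    using continuous_attains_inf[of "{y'..y}" ?f] y by auto
  \<comment> \<open>If the minimum sits at \<open>y'\<close>, the failure of the claim makes
    \<open>y\<close> a minimiser as well.\<close>
  define z where "z = (if z0 = y' then y else z0)"
  have z: "y' < z" "z \<le> y" "\<And>u. u \<in> {y'..y} \<Longrightarrow> ?f z \<le> ?f u"
    using z0 y n z0(2)[of y] by (auto simp: z_def) (meson atLeastAtMost_iff linorder_not_less order_trans)
  have fz: "?f z < 4" using z(3)[of y] y less by auto
  define w where "w = pi * (z - x)"
  define m where "m = pi * (x + z)"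
  define b where "b = a\<^sup>2 - 1"
  have b: "0 \<le> b" "b \<le> 1" using a by (auto simp: b_def)
  have w: "0 < w" "w < pi / 2"
  proof -
    show "0 < w" using z(1) y(1) by (simp add: w_def)
    have "pi * (z - x) < pi * (1/2)" using z(2) y by (intro mult_strict_left_mono) auto
    then show "w < pi / 2" by (simp add: w_def)
  qed
  have "(?f has_real_derivative 8 * pi * sin w * (cos w * (1 + b * (sin m)\<^sup>2) + b * sin w * (sin m * cos m))) (at z)"
    unfolding chord2_def[abs_def] b_def[symmetric]
    by (auto intro!: derivative_eq_intros simp: w_def m_def algebra_simps power2_eq_square)
  moreover have "(sin w)\<^sup>2 * (1 + b * (sin m)\<^sup>2) < 1"
    using fz by (simp add: chord2_def w_def m_def b_def)
  then have "8 * pi * sin w * (cos w * (1 + b * (sin m)\<^sup>2) + b * sin w * (sin m * cos m)) > 0"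
    using chord_deriv_pos[OF w b] sin_gt_zero[of w] w by simp
  ultimately obtain d where d: "d > 0" "\<And>h. 0 < h \<Longrightarrow> h < d \<Longrightarrow> ?f (z - h) < ?f z"
    using DERIV_pos_inc_left by blast
  define h where "h = min (d / 2) (z - y')"
  have "0 < h" "h < d" "z - h \<in> {y'..y}" using d(1) z(1,2) by (auto simp: h_def)
  then show False using d(2)[of h] z(3)[of "z - h"] by linarith
qed

text \<open>First the right end is moved inwards. The reflection of the parameter at 0 preserves
  chord lengths and exchanges the ends, so the same argument then moves the left end.\<close>

lemma chord2_nested:
  assumes a: "1 \<le> a" "a\<^sup>2 \<le> 2" and xy: "x \<le> x'" "x' \<le> y'" "y' \<le> y" "y < x + 1/2" and less: "chord2 a x y < 4"
  shows "chord2 a x' y' \<le> chord2 a x y"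
proof -
  have 1: "chord2 a x y' \<le> chord2 a x y"
    using chord2_less_right[OF a _ _ xy(4) less, of y'] xy by (cases "y' = y") auto
  then have "chord2 a (- y') (- x) < 4" using less by (simp add: chord2_flip)
  then have "chord2 a (- y') (- x') \<le> chord2 a (- y') (- x)"
    using chord2_less_right[OF a, of "- y'" "- x'" "- x"] xy by (cases "x = x'") auto
  then show ?thesis using 1 by (simp add: chord2_flip)
qed

subsection \<open>Farthest points\<close>

lemma compact_ellipse:
  assumes "a \<noteq> 0"
  shows "compact (ellipse a)"
proof -
  have "ellipse a = ellpt a ` {0..1}"
  proof
    show "ellipse a \<subseteq> ellpt a ` {0..1}"
    proof
      fix p assume "p \<in> ellipse a"
      then obtain x where "p = ellpt a x" using ellipse_eq_range[OF assms] by blast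
      also have "\<dots> = ellpt a (frac x)"
        unfolding ellpt_eq_iff[OF assms] frac_def by (intro exI[of _ "- \<lfloor>x\<rfloor>"]) simp
      finally show "p \<in> ellpt a ` {0..1}" using frac_lt_1[of x] by (intro image_eqI[of _ _ "frac x"]) auto
    qed
  qed (use ellpt_in_ellipse[OF assms] in blast)
  moreover have "continuous_on {0..1} (ellpt a)"
    unfolding ellpt_def by (intro continuous_intros)
  ultimately show ?thesis using compact_continuous_image[OF _ compact_Icc, of 0 1 "ellpt a"] by simp
qed

text \<open>At a farthest point \<open>q\<close> of \<open>p\<close> the vector \<open>q - p\<close> is normal to the ellipse.\<close>

lemma farthest_normal:
  assumes a: "0 < a" and q: "(x, y) \<in> ellipse a"
    and far: "\<And>z. z \<in> ellipse a \<Longrightarrow> dist p z \<le> dist p (x, y)"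
  obtains l where "x - fst p = l * x / a\<^sup>2" "y - snd p = l * y"
proof -
  have "a \<noteq> 0" using a by simp
  then obtain t where t: "(x, y) = ellpt a t" using q ellipse_eq_range by blast
  define c where "c = cos (2 * pi * t)"
  define s where "s = - sin (2 * pi * t)"
  have xy: "x = a * c" "y = s" using t by (auto simp: ellpt_def c_def s_def)
  have cs: "c\<^sup>2 + s\<^sup>2 = 1" by (simp add: c_def s_def)
  define g where "g u = (a * cos (2 * pi * u) - fst p)\<^sup>2 + (- sin (2 * pi * u) - snd p)\<^sup>2" for u
  have gd: "g u = (dist p (ellpt a u))\<^sup>2" for u
    by (cases p) (simp add: g_def ellpt_def dist_Pair_Pair dist_real_def power2_commute)
  have gmax: "g u \<le> g t" for u
    unfolding gd using far[OF ellpt_in_ellipse[OF \<open>a \<noteq> 0\<close>, of u]] by (auto simp: t intro: power_mono)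
  have "(g has_real_derivative 4 * pi * (a * s * (x - fst p) - c * (y - snd p))) (at t)"
    unfolding g_def xy by (auto intro!: derivative_eq_intros simp: c_def s_def algebra_simps)
  then have "4 * pi * (a * s * (x - fst p) - c * (y - snd p)) = 0"
    by (rule DERIV_local_max[of _ _ _ 1]) (use gmax in auto)
  then have tang: "a * s * (x - fst p) = c * (y - snd p)" by simp
  define n where "n = c\<^sup>2 + a\<^sup>2 * s\<^sup>2"
  have n: "n > 0"
  proof (cases "s = 0")
    case True
    then show ?thesis using cs by (simp add: n_def)
  next
    case False
    then have "a\<^sup>2 * s\<^sup>2 > 0" using a by simp
    then show ?thesis using zero_le_power2[of c] unfolding n_def by linarith
  qed
  \<comment> \<open>The vector \<open>(c, a * s)\<close> is normal to the ellipse at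
    \<open>(x, y)\<close> and \<open>n\<close> is its squared length; \<open>k\<close> is the
    coefficient of the projection of the difference onto it.\<close>
  define k where "k = ((x - fst p) * c + (y - snd p) * (a * s)) / n"
  have "(x - fst p) * n = ((x - fst p) * c + (y - snd p) * (a * s)) * c"
  proof -
    have "(x - fst p) * n = (x - fst p) * c * c + a * s * (a * s * (x - fst p))"
      by (simp add: n_def power2_eq_square algebra_simps)
    then show ?thesis unfolding tang by (simp add: algebra_simps)
  qed
  then have 1: "x - fst p = k * c" using n by (simp add: k_def field_simps)
  have "(y - snd p) * n = ((x - fst p) * c + (y - snd p) * (a * s)) * (a * s)"
  proof -
    have "(y - snd p) * n = c * (c * (y - snd p)) + (y - snd p) * (a * s) * (a * s)"
      by (simp add: n_def power2_eq_square algebra_simps)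
    then show ?thesis unfolding tang[symmetric] by (simp add: algebra_simps)
  qed
  then have 2: "y - snd p = k * (a * s)" using n by (simp add: k_def field_simps)
  show thesis
    by (rule that[of "k * a"]) (use 1 2 a in \<open>simp_all add: xy power2_eq_square\<close>)
qed

text \<open>The multiplier of a farthest point is at least \<open>a\<^sup>2\<close>, which makes the distance from \<open>p\<close> a
  concave quadratic relative to \<open>q\<close>; the condition \<open>a\<^sup>2 \<le> 2\<close> settles the degenerate case.\<close>

lemma farthest_unique:
  assumes a: "1 < a" "a\<^sup>2 \<le> 2" and p: "p \<in> ellipse a"
    and q: "q \<in> ellipse a" "\<And>z. z \<in> ellipse a \<Longrightarrow> dist p z \<le> dist p q"
    and q': "q' \<in> ellipse a" "\<And>z. z \<in> ellipse a \<Longrightarrow> dist p z \<le> dist p q'"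
  shows "q' = q"
proof -
  obtain x0 y0 where p0: "p = (x0, y0)" by force
  obtain x y where q0: "q = (x, y)" by force
  obtain x' y' where q0': "q' = (x', y')" by force
  have a2: "a\<^sup>2 > 1" using a(1) by simp
  obtain l where l: "x - x0 = l * x / a\<^sup>2" "y - y0 = l * y"
    using farthest_normal[of a x y p] q a by (auto simp: q0 p0)
  have el: "u\<^sup>2 / a\<^sup>2 + v\<^sup>2 = 1" if "(u, v) \<in> ellipse a" for u v
    using that by (simp add: ellipse_def power_divide)
  have key: "(dist p (u, v))\<^sup>2 - (dist p q)\<^sup>2 = (1 - l / a\<^sup>2) * (u - x)\<^sup>2 + (1 - l) * (v - y)\<^sup>2"
    if "(u, v) \<in> ellipse a" for u v
  proof -
    have e: "u\<^sup>2 / a\<^sup>2 + v\<^sup>2 = x\<^sup>2 / a\<^sup>2 + y\<^sup>2" using el[OF that] el[of x y] q(1) by (simp add: q0)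
    have xx: "x0 = x - l * x / a\<^sup>2" "y0 = y - l * y" using l by auto
    have "(dist p (u, v))\<^sup>2 - (dist p q)\<^sup>2 = (u - x0)\<^sup>2 + (v - y0)\<^sup>2 - (x - x0)\<^sup>2 - (y - y0)\<^sup>2"
      by (simp add: p0 q0 dist_Pair_Pair dist_real_def power2_commute)
    also have "\<dots> = (u - x)\<^sup>2 + (v - y)\<^sup>2 + 2 * l * ((u * x / a\<^sup>2 + v * y) - (x\<^sup>2 / a\<^sup>2 + y\<^sup>2))"
      unfolding xx by (simp add: power2_eq_square algebra_simps diff_divide_distrib add_divide_distrib)
    also have "\<dots> = (u - x)\<^sup>2 + (v - y)\<^sup>2 - l * ((u - x)\<^sup>2 / a\<^sup>2 + (v - y)\<^sup>2) + l * ((u\<^sup>2 / a\<^sup>2 + v\<^sup>2) - (x\<^sup>2 / a\<^sup>2 + y\<^sup>2))"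
      by (simp add: power2_eq_square algebra_simps diff_divide_distrib add_divide_distrib)
    also have "\<dots> = (1 - l / a\<^sup>2) * (u - x)\<^sup>2 + (1 - l) * (v - y)\<^sup>2"
      unfolding e by (simp add: algebra_simps)
    finally show ?thesis .
  qed
  have neg: "(1 - l / a\<^sup>2) * (u - x)\<^sup>2 + (1 - l) * (v - y)\<^sup>2 \<le> 0" if "(u, v) \<in> ellipse a" for u v
    using key[OF that] power_mono[OF q(2)[OF that] zero_le_dist, of 2] by linarith
  have la: "a\<^sup>2 \<le> l"
  proof (cases "x = 0")
    case False
    \<comment> \<open>The mirror image of \<open>q\<close> in the minor axis isolates the
      coefficient of the first square.\<close>
    have "(- x, y) \<in> ellipse a" using q(1) by (simp add: q0 ellipse_def power_divide)
    from neg[OF this] have "(1 - l / a\<^sup>2) * (4 * x\<^sup>2) \<le> 0" by (simp add: power2_eq_square algebra_simps)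
    then have "1 - l / a\<^sup>2 \<le> 0" using False by (simp add: mult_le_0_iff)
    then show ?thesis using a a2 pos_le_divide_eq[of "a\<^sup>2" 1 l] by simp
  next
    \<comment> \<open>Now \<open>q\<close> is an end of the minor axis, and so is \<open>p\<close>.
      The end opposite to \<open>p\<close> is at distance 2, which forces \<open>y = - y0\<close>
      and \<open>l = 2\<close>; the bound \<open>a\<^sup>2 \<le> 2\<close> is used here.\<close>
    case True
    then have x0: "x0 = 0" using l(1) by simp
    have y2: "y\<^sup>2 = 1" "y0\<^sup>2 = 1" using el[of x y] el[of x0 y0] q(1) p True x0 by (simp_all add: q0 p0)
    have "(0, - y0) \<in> ellipse a" using y2 by (simp add: ellipse_def)
    from q(2)[OF this] have "\<bar>2 * y0\<bar> \<le> \<bar>y0 - y\<bar>"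
      by (simp add: p0 q0 x0 True dist_Pair_Pair dist_real_def real_sqrt_mult)
    then have "y = - y0" using y2 by (auto simp: power2_eq_1_iff)
    then have "2 * y = l * y" using l(2) by simp
    then show ?thesis using y2 a(2) by auto
  qed
  have "1 - l < 0" using la a2 by linarith
  moreover have "1 - l / a\<^sup>2 \<le> 0" using la a pos_le_divide_eq[of "a\<^sup>2" 1 l] by auto
  ultimately have ge: "1 - l / a\<^sup>2 \<le> 0" "1 - l < 0" by auto
  have "dist p q' = dist p q" using q q' by (simp add: antisym)
  then have zero: "(1 - l / a\<^sup>2) * (x' - x)\<^sup>2 + (1 - l) * (y' - y)\<^sup>2 = 0"
    using key[of x' y'] q'(1) by (simp add: q0')
  have "(1 - l / a\<^sup>2) * (x' - x)\<^sup>2 \<le> 0" "(1 - l) * (y' - y)\<^sup>2 \<le> 0"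
    using ge by (auto intro: mult_nonpos_nonneg)
  with zero have z: "(1 - l / a\<^sup>2) * (x' - x)\<^sup>2 = 0" "(1 - l) * (y' - y)\<^sup>2 = 0" by linarith+
  then have yy: "y' = y" using ge by simp
  have "x' = x"
  proof (cases "l = a\<^sup>2")
    case False
    then have "1 - l / a\<^sup>2 \<noteq> 0" using a a2 eq_divide_eq[of 1 l "a\<^sup>2"] by auto
    then show ?thesis using z(1) by (metis mult_eq_0_iff power_eq_0_iff eq_iff_diff_eq_0)
  next
    \<comment> \<open>The quadratic form no longer sees the first coordinate. But then
      \<open>p\<close> lies on the minor axis, and \<open>a\<^sup>2 - 1 \<le> 1\<close> pushes
      \<open>y\<close> to an end of that axis, where the ellipse has only the first coordinate
      0.\<close>
    case True
    then have "x0 = 0" using l(1) a a2 by simp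
    then have "y0\<^sup>2 = 1" using el[of x0 y0] p by (simp add: p0)
    moreover have "y0 = - ((a\<^sup>2 - 1) * y)" using l(2) True by (simp add: algebra_simps)
    ultimately have "(a\<^sup>2 - 1)\<^sup>2 * y\<^sup>2 = 1" by (simp add: power_mult_distrib)
    moreover have "(a\<^sup>2 - 1)\<^sup>2 * y\<^sup>2 \<le> 1 * y\<^sup>2"
      using a a2 by (intro mult_right_mono) (auto simp: abs_square_le_1)
    ultimately have "1 \<le> y\<^sup>2" by simp
    moreover have "x\<^sup>2 / a\<^sup>2 + y\<^sup>2 = 1" "x'\<^sup>2 / a\<^sup>2 + y\<^sup>2 = 1"
      using el[of x y] el[of x' y'] q(1) q'(1) by (simp_all add: q0 q0' yy)
    ultimately have "x\<^sup>2 / a\<^sup>2 \<le> 0" "x'\<^sup>2 / a\<^sup>2 \<le> 0" by linarith+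
    then show ?thesis using a a2 by (simp add: divide_le_0_iff)
  qed
  then show ?thesis by (simp add: q0 q0' yy)
qed

section \<open>The Vietoris-Rips graph of the ellipse as a graph of lifted arcs\<close>

definition short :: "real \<Rightarrow> bool \<Rightarrow> real \<Rightarrow> real \<Rightarrow> real \<Rightarrow> bool" where
  "short a strict r x y \<longleftrightarrow> x < y \<and> y < x + 1/2 \<and>
     (if strict then chord2 a x y < r\<^sup>2 else chord2 a x y \<le> r\<^sup>2)"

locale ellipse_graph =
  fixes a r :: real and strict :: bool
  assumes a: "1 < a" "a\<^sup>2 \<le> 2" and r: "0 < r" "r < 2"
begin

lemma a_ne: "a \<noteq> 0"
  using a by simp

lemma r4: "r\<^sup>2 < 4"
  using power_strict_mono[of r 2 2] r by simp

lemma short_less4: "short a strict r x y \<Longrightarrow> chord2 a x y < 4"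
  using r4 by (auto simp: short_def split: if_splits)

sublocale cyclic_arcs "ellpt a" "short a strict r"
proof
  show "ellpt a x = ellpt a y \<longleftrightarrow> (\<exists>n::int. y = x + of_int n)" for x y
    by (rule ellpt_eq_iff[OF a_ne])
  show "x < y" "y < x + 1/2" if "short a strict r x y" for x y
    using that by (auto simp: short_def)
  show "short a strict r x' y'" if "short a strict r x y" "x \<le> x'" "x' < y'" "y' \<le> y" for x y x' y'
    using chord2_nested[of a x x' y' y] short_less4[OF that(1)] that a
    by (auto simp: short_def split: if_splits)
  show "short a strict r (x + of_int n) (y + of_int n) \<longleftrightarrow> short a strict r x y" for x y n
    by (simp add: short_def chord2_shift[OF a_ne])
qed

text \<open>The antipode is at distance at least 2, so the farthest point is too; this keeps it
  apart from all points at distance \<open>r\<close>.\<close>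

lemma far_lift:
  obtains f where "farthest a (ellpt a x) = ellpt a f" "x < f" "f < x + 1" "4 \<le> chord2 a x f"
proof -
  let ?p = "ellpt a x"
  have "continuous_on (ellipse a) (dist ?p)" by (intro continuous_intros)
  then obtain q where q: "q \<in> ellipse a" "\<And>z. z \<in> ellipse a \<Longrightarrow> dist ?p z \<le> dist ?p q"
    using continuous_attains_sup[OF compact_ellipse[OF a_ne], of "dist ?p"] ellpt_in_ellipse[OF a_ne] by blast
  have far: "farthest a ?p = q"
    unfolding farthest_def
  proof (rule the_equality)
    show "q \<in> ellipse a \<and> (\<forall>z\<in>ellipse a. dist ?p z \<le> dist ?p q)" using q by blast
    fix q' assume q': "q' \<in> ellipse a \<and> (\<forall>z\<in>ellipse a. dist ?p z \<le> dist ?p q')"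
    show "q' = q"
      by (rule farthest_unique[OF a ellpt_in_ellipse[OF a_ne] q]) (use q' in blast)+
  qed
  obtain f0 where "q = ellpt a f0" using q(1) ellipse_eq_range[OF a_ne] by blast
  then obtain f where f: "x \<le> f" "f < x + 1" "q = ellpt a f" using lift_window[of x f0] by metis
  have "4 \<le> chord2 a x (x + 1/2)" using a by (intro chord2_half) auto
  also have "\<dots> = (dist ?p (ellpt a (x + 1/2)))\<^sup>2" by (simp add: dist_ellpt)
  also have "\<dots> \<le> (dist ?p q)\<^sup>2" by (intro power_mono q ellpt_in_ellipse[OF a_ne]) auto
  also have "\<dots> = chord2 a x f" by (simp add: f dist_ellpt)
  finally have 4: "4 \<le> chord2 a x f" .
  then have "f \<noteq> x" by auto
  then show thesis using that[of f] far f 4 by auto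
qed

text \<open>A solution exists by the intermediate value theorem. A solution beyond half a turn would
  be close to \<open>x + 1\<close> on the other side; the farthest point, lying between the two,
  would by nesting be closer than 2. Within half a turn the chord is strictly increasing up to
  length 2, so the solution is unique.\<close>

lemma gmap_lift:
  obtains g where "gmap a r (ellpt a x) = ellpt a g" "x < g" "g < x + 1/2" "chord2 a x g = r\<^sup>2"
proof -
  let ?p = "ellpt a x"
  obtain f where f: "farthest a ?p = ellpt a f" "x < f" "f < x + 1" "4 \<le> chord2 a x f"
    using far_lift by blast
  have arc: "z \<in> arc_cc a ?p (farthest a ?p) \<longleftrightarrow> (\<exists>y. x \<le> y \<and> y \<le> f \<and> z = ellpt a y)" for z
  proof
    assume "z \<in> arc_cc a ?p (farthest a ?p)"
    then have z: "z \<in> ellipse a" "cw a ?p z \<le> cw a ?p (ellpt a f)" by (auto simp: arc_cc_def f(1))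
    obtain y0 where "z = ellpt a y0" using z(1) ellipse_eq_range[OF a_ne] by blast
    then obtain y where y: "x \<le> y" "y < x + 1" "z = ellpt a y" using lift_window[of x y0] by metis
    then have "frac (y - x) \<le> frac (f - x)" using z(2) by (simp add: cw_ellpt[OF a_ne])
    moreover have "frac (y - x) = y - x" "frac (f - x) = f - x" using y f by (auto simp: frac_eq)
    ultimately show "\<exists>y. x \<le> y \<and> y \<le> f \<and> z = ellpt a y" using y by auto
  next
    assume "\<exists>y. x \<le> y \<and> y \<le> f \<and> z = ellpt a y"
    then obtain y where y: "x \<le> y" "y \<le> f" "z = ellpt a y" by blast
    moreover have "frac (y - x) = y - x" "frac (f - x) = f - x" using y f by (auto simp: frac_eq)
    ultimately show "z \<in> arc_cc a ?p (farthest a ?p)"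
      by (simp add: arc_cc_def f(1) cw_ellpt[OF a_ne] ellpt_in_ellipse[OF a_ne])
  qed
  have half: "y < x + 1/2" if "x \<le> y" "y \<le> f" "chord2 a x y = r\<^sup>2" for y
  proof (rule ccontr)
    assume n: "\<not> ?thesis"
    have "y \<noteq> x + 1/2" using chord2_half[of a x] a that(3) r4 by auto
    with n have y: "y > x + 1/2" by simp
    have "chord2 a f (x + 1) \<le> chord2 a y (x + 1)"
      using a y that f(3) r4 chord2_shift(2)[OF a_ne, of y x 1]
      by (intro chord2_nested) (auto simp: chord2_sym)
    then show False using f(4) that(3) r4 chord2_shift(2)[OF a_ne, of f x 1] chord2_shift(2)[OF a_ne, of y x 1]
      by (simp add: chord2_sym[of a _ x])
  qed
  have "continuous_on {x..f} (chord2 a x)" unfolding chord2_def by (intro continuous_intros)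
  then obtain g where g: "x \<le> g" "g \<le> f" "chord2 a x g = r\<^sup>2"
    using IVT'[of "chord2 a x" x "r\<^sup>2" f] f r4 by auto
  have "x \<noteq> g" using g(3) r by auto
  then have xg: "x < g" using g by simp
  have uniq: "y = g" if "x \<le> y" "y \<le> f" "chord2 a x y = r\<^sup>2" for y
    using chord2_less_right[of a x y g] chord2_less_right[of a x g y] that g half[OF g] half[OF that] a r4
    by (cases y g rule: linorder_cases) auto
  have d: "dist ?p (ellpt a y) = r \<longleftrightarrow> chord2 a x y = r\<^sup>2" for y
    unfolding dist_ellpt[symmetric] using r by (simp add: power2_eq_iff_nonneg)
  have "gmap a r ?p = ellpt a g"
    unfolding gmap_def
  proof (rule the_equality)
    show "ellpt a g \<in> arc_cc a ?p (farthest a ?p) \<and> dist ?p (ellpt a g) = r"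
      using g by (auto simp: arc d)
    fix q assume "q \<in> arc_cc a ?p (farthest a ?p) \<and> dist ?p q = r"
    then obtain y where "x \<le> y" "y \<le> f" "q = ellpt a y" "dist ?p (ellpt a y) = r"
      unfolding arc by blast
    then show "q = ellpt a g" using uniq[of y] d[of y] by simp
  qed
  then show thesis using that xg half[OF g] g(3) by blast
qed

text \<open>Within half a turn the chord crosses the value \<open>r\<close> exactly once, at the
  lifted point of \<open>gmap\<close>. The arc up to that point is therefore described by chord
  lengths alone.\<close>

lemma vr_edge_lift:
  assumes y: "x \<le> y" "y < x + 1"
  shows "vr_edge a strict X r (ellpt a x) (ellpt a y) \<longleftrightarrow>
    ellpt a x \<in> X \<and> ellpt a y \<in> X \<and> short a strict r x y"
proof -
  obtain g where g: "gmap a r (ellpt a x) = ellpt a g" "x < g" "g < x + 1/2" "chord2 a x g = r\<^sup>2"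
    using gmap_lift by blast
  have fr: "frac (y - x) = y - x" "frac (g - x) = g - x" using y g by (auto simp: frac_eq)
  have "chord2 a x y < r\<^sup>2" if "y < g"
    using chord2_less_right[of a x y g] a y(1) g that r4 by auto
  moreover have "r\<^sup>2 < chord2 a x y" if "g < y" "y < x + 1/2"
    using chord2_less_right[of a x g y] a g that r4 by (cases "chord2 a x y < 4") auto
  ultimately have "short a strict r x y \<longleftrightarrow> x < y \<and> (if strict then y < g else y \<le> g)"
    using g by (cases y g rule: linorder_cases) (auto simp: short_def)
  then show ?thesis
    using y by (auto simp: vr_edge_def arc_oo_def arc_oc_def g(1) cw_ellpt[OF a_ne] fr
        ellpt_in_ellipse[OF a_ne] split: if_splits)
qed

lemma vr_dyn_lift:
  assumes X: "finite X" and x: "x \<in> lift X" and XE: "X \<subseteq> ellipse a"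
  shows "vr_dyn a strict X r (ellpt a x) = ellpt a (adv X x)"
proof -
  let ?v = "ellpt a x"
  let ?N = "insert ?v {w. vr_edge a strict X r ?v w}"
  have N: "w \<in> ?N \<longleftrightarrow> (\<exists>y. x \<le> y \<and> y < x + 1 \<and> w = ellpt a y \<and> y \<in> lift X \<and> (y = x \<or> short a strict r x y))" for w
  proof
    assume "w \<in> ?N"
    then have w: "w = ?v \<or> vr_edge a strict X r ?v w" by auto
    show "\<exists>y. x \<le> y \<and> y < x + 1 \<and> w = ellpt a y \<and> y \<in> lift X \<and> (y = x \<or> short a strict r x y)"
    proof (cases "w = ?v")
      case True
      then show ?thesis using x by (intro exI[of _ x]) auto
    next
      case False
      then have e: "vr_edge a strict X r ?v w" using w by simp
      then have "w \<in> ellipse a" using XE by (auto simp: vr_edge_def)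
      then obtain y0 where "w = ellpt a y0" using ellipse_eq_range[OF a_ne] by blast
      then obtain y where y: "x \<le> y" "y < x + 1" "w = ellpt a y" using lift_window[of x y0] by metis
      then show ?thesis using e vr_edge_lift[OF y(1,2), of X] by (auto simp: lift_def)
    qed
  next
    assume "\<exists>y. x \<le> y \<and> y < x + 1 \<and> w = ellpt a y \<and> y \<in> lift X \<and> (y = x \<or> short a strict r x y)"
    then show "w \<in> ?N" using x vr_edge_lift[of x _ X] by (auto simp: lift_def)
  qed
  have cwy: "cw a ?v (ellpt a y) = y - x" if "x \<le> y" "y < x + 1" for y
    using that by (auto simp: cw_ellpt[OF a_ne] frac_eq)
  have F: "x \<le> adv X x" "adv X x < x + 1" "adv X x \<in> lift X" "adv X x = x \<or> short a strict r x (adv X x)"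
    using adv_in[OF X x] adv_ge[OF X x] adv_lt[OF X x] by auto
  have FN: "ellpt a (adv X x) \<in> ?N" unfolding N using F by blast
  have mx: "cw a ?v u \<le> cw a ?v (ellpt a (adv X x))" if u: "u \<in> ?N" for u
  proof -
    obtain y where y: "x \<le> y" "y < x + 1" "u = ellpt a y" "y \<in> lift X" "y = x \<or> short a strict r x y"
      using u unfolding N by blast
    then have "y \<le> adv X x" using adv_max[OF X, of x y] F(1) by auto
    then show ?thesis using cwy[OF y(1,2)] cwy[OF F(1,2)] y(3) by simp
  qed
  have "(THE w. w \<in> ?N \<and> (\<forall>u \<in> ?N. cw a ?v u \<le> cw a ?v w)) = ellpt a (adv X x)"
  proof (rule the_equality)
    show "ellpt a (adv X x) \<in> ?N \<and> (\<forall>u \<in> ?N. cw a ?v u \<le> cw a ?v (ellpt a (adv X x)))"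
      using FN mx by blast
    fix w assume w: "w \<in> ?N \<and> (\<forall>u \<in> ?N. cw a ?v u \<le> cw a ?v w)"
    then obtain y where y: "x \<le> y" "y < x + 1" "w = ellpt a y" unfolding N by blast
    have "cw a ?v w = cw a ?v (ellpt a (adv X x))" using w mx FN by (meson antisym)
    then show "w = ellpt a (adv X x)" using cwy[OF y(1,2)] cwy[OF F(1,2)] y(3) by simp
  qed
  then show ?thesis by (simp add: vr_dyn_def Let_def)
qed

text \<open>Points closer than 2 are never half a turn apart, so one of the two arcs between them is
  shorter than half a turn. Which one it is decides the direction of the edge.\<close>

lemma adj_iff_dist:
  assumes "p \<in> ellipse a" "q \<in> ellipse a"
  shows "adj p q \<longleftrightarrow> (if strict then dist p q < r else dist p q \<le> r)"
proof (cases "p = q")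
  case True
  then show ?thesis using r by (simp add: adj_refl)
next
  case False
  obtain x where x: "p = ellpt a x" using assms(1) ellipse_eq_range[OF a_ne] by blast
  obtain y0 where "q = ellpt a y0" using assms(2) ellipse_eq_range[OF a_ne] by blast
  then obtain y where y: "x \<le> y" "y < x + 1" "q = ellpt a y" using lift_window[of x y0] by metis
  have "x \<noteq> y" using False x y by auto
  have d: "(if strict then dist p q < r else dist p q \<le> r) \<longleftrightarrow> (if strict then chord2 a x y < r\<^sup>2 else chord2 a x y \<le> r\<^sup>2)"
    unfolding dist_ellpt[symmetric] x y(3) using r
    by (auto intro: power_strict_mono power_mono power2_less_imp_less power2_le_imp_le)
  show ?thesis
  proof
    assume "adj p q"
    then obtain x' y' where s: "ellpt a x' = p" "ellpt a y' = q" "short a strict r x' y' \<or> short a strict r y' x'"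
      using False unfolding adj_def by blast
    have "chord2 a x' y' = chord2 a x y" using s(1,2) x y(3) by (simp flip: dist_ellpt)
    then show "if strict then dist p q < r else dist p q \<le> r"
      unfolding d using s(3) by (auto simp: short_def chord2_sym)
  next
    assume "if strict then dist p q < r else dist p q \<le> r"
    then have c: "if strict then chord2 a x y < r\<^sup>2 else chord2 a x y \<le> r\<^sup>2" using d by simp
    then have "chord2 a x y < 4" using r4 by (auto split: if_splits)
    then have "y \<noteq> x + 1/2" using chord2_half[of a x] a by auto
    then consider "y < x + 1/2" | "x + 1/2 < y" by linarith
    then show "adj p q"
    proof cases
      case 1
      then have "short a strict r x y" using c y(1) \<open>x \<noteq> y\<close> by (simp add: short_def)
      then show ?thesis using R_adj(1) x y(3) by blast
    next
      case 2
      have "chord2 a y (x + 1) = chord2 a x y"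
        using chord2_shift(2)[OF a_ne, of y x 1] by (simp add: chord2_sym)
      then have "short a strict r y (x + 1)" using c 2 y(2) by (simp add: short_def)
      then have "adj (ellpt a (x + 1)) (ellpt a y)" by (rule R_adj(2))
      then show ?thesis using x y(3) by simp
    qed
  qed
qed

lemma vr_simplices_eq:
  assumes "X \<subseteq> ellipse a"
  shows "vr_simplices strict X r = cliques X"
proof -
  have "(\<forall>x\<in>\<sigma>. \<forall>y\<in>\<sigma>. if strict then dist x y < r else dist x y \<le> r) \<longleftrightarrow> (\<forall>u\<in>\<sigma>. \<forall>v\<in>\<sigma>. adj u v)"
    if "\<sigma> \<subseteq> X" for \<sigma>
  proof (intro ball_cong refl)
    fix x y assume "x \<in> \<sigma>" "y \<in> \<sigma>"
    then show "(if strict then dist x y < r else dist x y \<le> r) \<longleftrightarrow> adj x y"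
      using adj_iff_dist[of x y] that assms by blast
  qed
  then show ?thesis unfolding vr_simplices_def cliques_def by (intro Collect_cong) blast
qed

lemma vr_dyn_pow_lift:
  assumes X: "finite X" and x: "x \<in> lift X" and XE: "X \<subseteq> ellipse a"
  shows "(vr_dyn a strict X r ^^ k) (ellpt a x) = ellpt a ((adv X ^^ k) x)"
  by (induction k) (simp_all add: vr_dyn_lift[OF X adv_pow_in[OF X x] XE])

end

section \<open>Winding fraction and periodic orbits\<close>

context ellipse_graph
begin

lemma ellpt_cw:
  assumes "q \<in> ellipse a"
  shows "ellpt a (x + cw a (ellpt a x) q) = q"
proof -
  obtain y where y: "q = ellpt a y" using assms ellipse_eq_range[OF a_ne] by blast
  have "y = (x + frac (y - x)) + of_int \<lfloor>y - x\<rfloor>" by (simp add: frac_def)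
  then have "ellpt a (x + frac (y - x)) = ellpt a y" unfolding ellpt_eq_iff[OF a_ne] by blast
  then show ?thesis by (simp add: y cw_ellpt[OF a_ne])
qed

text \<open>Summing the clockwise steps lifts the homomorphism to a weakly increasing sequence
  \<open>H\<close>, which gains a whole number of turns in \<open>n\<close> steps; the number is
  positive because the homomorphism is not constant. Once \<open>k\<close> steps of \<open>H\<close>
  are bounded by one advance, comparison with the period-three orbit gives the estimate.\<close>

lemma winding_upper:
  assumes X: "finite X" "X \<subseteq> ellipse a" and v: "v \<in> lift X" "(adv X ^^ 3) v = v + 1"
    and hom: "cyclic_hom a strict X r n k h" and k: "1 \<le> k" "2 * k < n"
  shows "3 * k \<le> n"
proof -
  have n: "0 < n" using k by simp
  have hX: "h (i mod n) \<in> X" for i using hom n by (simp add: cyclic_hom_def)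
  have edge: "h (i mod n) = h ((i + s) mod n) \<or> vr_edge a strict X r (h (i mod n)) (h ((i + s) mod n))"
    if "1 \<le> s" "s \<le> k" for i s
  proof -
    have "\<forall>s\<in>{1..k}. h (i mod n) = h ((i mod n + s) mod n) \<or> vr_edge a strict X r (h (i mod n)) (h ((i mod n + s) mod n))"
      using hom n by (simp add: cyclic_hom_def)
    then show ?thesis using that by (simp add: mod_add_left_eq)
  qed
  obtain x0 where x0: "h 0 = ellpt a x0" using hX[of 0] X(2) n ellipse_eq_range[OF a_ne] by auto
  define c where "c i = cw a (h (i mod n)) (h (Suc i mod n))" for i
  define H where "H i = x0 + (\<Sum>j<i. c j)" for i
  have c: "0 \<le> c i" "c i < 1" for i by (simp_all add: c_def cw_def frac_lt_1)
  have eH: "ellpt a (H i) = h (i mod n)" for i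
  proof (induction i)
    case 0
    then show ?case by (simp add: H_def x0)
  next
    case (Suc i)
    have "H (Suc i) = H i + cw a (ellpt a (H i)) (h (Suc i mod n))" by (simp only: Suc) (simp add: H_def c_def)
    then show ?case using ellpt_cw[of "h (Suc i mod n)" "H i"] hX[of "Suc i"] X(2) by auto
  qed
  have HX: "H i \<in> lift X" for i using hX eH by (simp add: lift_def)
  have reach: "H j \<le> adv X (H i)" if "H i \<le> H j" "H j < H i + 1" "1 \<le> s" "s \<le> k" "j = i + s" for i j s
  proof (cases "H i = H j")
    case True
    then show ?thesis using adv_ge[OF X(1) HX, of i] by simp
  next
    case False
    have "h (i mod n) \<noteq> h (j mod n)"
      using inj_onD[OF inj_on_e[of "H i"], of "H i" "H j"] eH[of i] eH[of j] that False by auto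
    then have "vr_edge a strict X r (ellpt a (H i)) (ellpt a (H j))"
      using edge[OF that(3,4), of i] that(5) eH by auto
    then show ?thesis using vr_edge_lift[OF that(1,2)] adv_max[OF X(1)] HX by blast
  qed
  have win: "H i \<le> H (i + s) \<and> H (i + s) \<le> adv X (H i)" if "s \<le> k" for i s
    using that
  proof (induction s)
    case 0
    then show ?case using adv_ge[OF X(1) HX, of i] by simp
  next
    case (Suc s)
    have ih: "H i \<le> H (i + s)" "H (i + s) \<le> adv X (H i)" using Suc by auto
    have st: "H (i + Suc s) = H (i + s) + c (i + s)" by (simp add: H_def)
    \<comment> \<open>The lift of an edge might in principle wrap around once more. By induction the
      sequence is at most one advance ahead of \<open>H i\<close>, and a further step adds at most
      one advance; two advances stay below a full turn, so the edge lifts to the short arc.\<close>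
    have "H (i + Suc s) \<le> adv X (H (i + s))"
      by (rule reach[of _ _ 1]) (use st c k in auto)
    also have "\<dots> < H (i + s) + 1/2" by (rule adv_lt[OF X(1) HX])
    also have "\<dots> \<le> adv X (H i) + 1/2" using ih by simp
    also have "\<dots> < H i + 1" using adv_lt[OF X(1) HX, of i] by simp
    finally have "H (i + Suc s) < H i + 1" .
    moreover have "H i \<le> H (i + Suc s)" using ih(1) st c by (smt (verit))
    ultimately show ?case using reach[of i "i + Suc s" "Suc s"] Suc.prems by auto
  qed
  have per: "H (i + n) = H i + (H n - H 0)" for i
  proof (induction i)
    case (Suc i)
    have "c (i + n) = c i" unfolding c_def by (metis add_Suc mod_add_self2)
    moreover have "H (Suc i + n) = H (i + n) + c (i + n)" by (simp add: H_def)
    moreover have "H (Suc i) = H i + c i" by (simp add: H_def)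
    ultimately show ?case using Suc by simp
  qed simp
  have "ellpt a (H 0) = ellpt a (H n)" using eH[of 0] eH[of n] by simp
  then obtain d where d: "H n = H 0 + of_int d" using e_eq by blast
  have Hmono: "H i \<le> H j" if "i \<le> j" for i j
    unfolding H_def using that c by (auto intro!: sum_mono2)
  have "d \<noteq> 0"
  proof
    assume "d = 0"
    have "h i = h 0" if "i < n" for i
      using Hmono[of 0 i] Hmono[of i n] that d \<open>d = 0\<close> eH[of i] eH[of 0] by simp
    then show False using hom k(1) unfolding cyclic_hom_def by blast
  qed
  moreover have "of_int d \<ge> (0::real)" using Hmono[of 0 n] d by simp
  ultimately have d1: "1 \<le> d" by simp
  show ?thesis
  proof (rule rotation_bound[OF X(1) HX _ _ _ v, where d = "nat d"])
    show "H (i + k) \<le> adv X (H i)" for i using win by simp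
    show "H (i + n) = H i + real (nat d)" for i using per[of i] d d1 by simp
    show "1 \<le> nat d" using d1 by simp
  qed
qed

text \<open>The bound \<open>1/3\<close> is attained: a period-three orbit is an image of the
  directed triangle.\<close>

lemma cyclic_hom_orbit:
  assumes X: "finite X" "X \<subseteq> ellipse a" and v: "v \<in> lift X" "(adv X ^^ 3) v = v + 1"
  shows "cyclic_hom a strict X r 3 1 (\<lambda>i. ellpt a ((adv X ^^ i) v))"
proof -
  let ?F = "adv X" and ?h = "\<lambda>i. ellpt a ((adv X ^^ i) v)"
  note o = period3_strict[OF X(1) v]
  have FX: "(?F ^^ i) v \<in> lift X" for i by (rule adv_pow_in[OF X(1) v(1)])
  have wrap: "?h ((i + 1) mod 3) = ?h (i + 1)" if "i < 3" for i
    using that v(2) by (cases "i = 2") auto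
  have edge: "?h i = ?h (i + 1) \<or> vr_edge a strict X r (?h i) (?h (i + 1))" for i
  proof (cases "?F ((?F ^^ i) v) = (?F ^^ i) v")
    case False
    have "(?F ^^ i) v \<le> ?F ((?F ^^ i) v)" "?F ((?F ^^ i) v) < (?F ^^ i) v + 1"
      using adv_ge[OF X(1) FX, of i] adv_lt[OF X(1) FX, of i] by auto
    then have "vr_edge a strict X r (ellpt a ((?F ^^ i) v)) (ellpt a (?F ((?F ^^ i) v)))"
      using vr_edge_lift[of "(?F ^^ i) v" "?F ((?F ^^ i) v)" X] adv_in[OF X(1) FX, of i] FX[of i] False
      by (auto simp: lift_def)
    then show ?thesis by simp
  qed simp
  have cy: "cyc_order a (ellpt a v) (ellpt a (?F v)) (ellpt a (?F (?F v)))"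
    using o by (simp add: cyc_order_def cw_ellpt[OF a_ne] frac_eq[THEN iffD2])
  have "ellpt a (?F v) \<noteq> ellpt a v"
    using inj_onD[OF inj_on_e[of v], of "?F v" v] o by auto
  then have nc: "\<exists>i<3. ?h i \<noteq> ?h 0" by (intro exI[of _ 1]) simp
  show ?thesis
    unfolding cyclic_hom_def
  proof (intro conjI allI impI ballI)
    show "?h i \<in> X" for i using FX by (simp add: lift_def)
    show "?h i = ?h ((i + s) mod 3) \<or> vr_edge a strict X r (?h i) (?h ((i + s) mod 3))"
      if "i < 3" "s \<in> {1..1}" for i s
    proof -
      have "s = 1" using that(2) by simp
      then show ?thesis using edge[of i] wrap[OF that(1)] by simp
    qed
    show "\<exists>i<3. ?h i \<noteq> ?h 0" by (rule nc)
    fix i j l :: nat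
    assume "i < j \<and> j < l \<and> l < 3 \<and> ?h i \<noteq> ?h j \<and> ?h j \<noteq> ?h l \<and> ?h i \<noteq> ?h l"
    then have "i = 0" "j = 1" "l = 2" by auto
    then show "cyc_order a (?h i) (?h j) (?h l)" using cy by (simp add: numeral_2_eq_2)
  qed
qed

lemma winding_fraction_third:
  assumes X: "finite X" "X \<subseteq> ellipse a" and v: "v \<in> lift X" "(adv X ^^ 3) v = v + 1"
  shows "winding_fraction a strict X r = 1 / 3"
  unfolding winding_fraction_def
proof (rule cSup_eq_maximum)
  show "1 / 3 \<in> {real k / real n | n k. 2 * k < n \<and> (\<exists>h. cyclic_hom a strict X r n k h)}"
    using cyclic_hom_orbit[OF assms] by (intro CollectI exI[of _ 3] exI[of _ 1]) auto
  fix x assume "x \<in> {real k / real n | n k. 2 * k < n \<and> (\<exists>h. cyclic_hom a strict X r n k h)}"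
  then obtain n k h where x: "x = real k / real n" "2 * k < n" "cyclic_hom a strict X r n k h" by blast
  have "3 * k \<le> n" using winding_upper[OF X v x(3) _ x(2)] by (cases "k = 0") auto
  then have "3 * real k \<le> real n" by (metis of_nat_le_iff of_nat_mult of_nat_numeral)
  then show "x \<le> 1 / 3" using x(2) by (simp add: x(1) field_simps)
qed

lemma periodic3_lift:
  assumes X: "finite X" "X \<subseteq> ellipse a" and v: "v \<in> lift X" "(adv X ^^ 3) v = v + 1"
  shows "periodic3 (vr_dyn a strict X r) (ellpt a v)"
    and "orbit_of (vr_dyn a strict X r) (ellpt a v) \<subseteq> {ellpt a v, ellpt a (adv X v), ellpt a (adv X (adv X v))}"
proof -
  let ?f = "vr_dyn a strict X r"
  note pw = vr_dyn_pow_lift[OF X(1) v(1) X(2)]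
  note o = period3_strict[OF X(1) v]
  have 3: "(?f ^^ 3) (ellpt a v) = ellpt a v" unfolding pw v(2) by simp
  moreover have "(?f ^^ 1) (ellpt a v) \<noteq> ellpt a v" "(?f ^^ 2) (ellpt a v) \<noteq> ellpt a v"
    unfolding pw
    using inj_onD[OF inj_on_e[of v], of "adv X v" v] inj_onD[OF inj_on_e[of v], of "adv X (adv X v)" v] o
    by (auto simp: numeral_2_eq_2)
  ultimately show "periodic3 ?f (ellpt a v)" by (simp add: periodic3_def)
  show "orbit_of ?f (ellpt a v) \<subseteq> {ellpt a v, ellpt a (adv X v), ellpt a (adv X (adv X v))}"
  proof
    fix p assume "p \<in> orbit_of ?f (ellpt a v)"
    then obtain i where "p = (?f ^^ i) (ellpt a v)" by (auto simp: orbit_of_def)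
    also have "\<dots> = (?f ^^ (i mod 3)) (ellpt a v)" by (rule funpow_mod_eq[OF 3, symmetric])
    finally have p: "p = ellpt a ((adv X ^^ (i mod 3)) v)" by (simp only: pw)
    have "i mod 3 = 0 \<or> i mod 3 = 1 \<or> i mod 3 = 2" by linarith
    then show "p \<in> {ellpt a v, ellpt a (adv X v), ellpt a (adv X (adv X v))}"
      unfolding p by (auto simp: numeral_2_eq_2)
  qed
qed

lemma two_orbits_imp:
  assumes X: "finite X" "X \<subseteq> ellipse a" and v: "v \<in> lift X" "(adv X ^^ 3) v = v + 1"
    and w: "w \<in> lift X" "(adv X ^^ 3) w = w + 1"
    and ne: "ellpt a w \<notin> {ellpt a v, ellpt a (adv X v), ellpt a (adv X (adv X v))}"
  shows "winding_fraction a strict X r = 1 / 3 \<and>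
    (\<exists>v1 \<in> X. \<exists>v2 \<in> X. periodic3 (vr_dyn a strict X r) v1 \<and> periodic3 (vr_dyn a strict X r) v2 \<and>
         v2 \<notin> orbit_of (vr_dyn a strict X r) v1) \<and>
    (\<exists>k \<ge> 1. geom_real X (vr_simplices strict X r) homotopy_equivalent_space wedge_S2 k)"
proof (intro conjI)
  show "winding_fraction a strict X r = 1 / 3" by (rule winding_fraction_third[OF X v])
  show "\<exists>v1 \<in> X. \<exists>v2 \<in> X. periodic3 (vr_dyn a strict X r) v1 \<and> periodic3 (vr_dyn a strict X r) v2 \<and>
         v2 \<notin> orbit_of (vr_dyn a strict X r) v1"
    using periodic3_lift[OF X v] periodic3_lift(1)[OF X w] v(1) w(1) ne
    by (intro bexI[of _ "ellpt a v"] bexI[of _ "ellpt a w"]) (auto simp: lift_def)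
  show "\<exists>k \<ge> 1. geom_real X (vr_simplices strict X r) homotopy_equivalent_space wedge_S2 k"
    unfolding vr_simplices_eq[OF X(2)]
    using X(2) ellipse_eq_range[OF a_ne] by (intro cliques_wedge[OF X(1) _ v w ne]) simp
qed

text \<open>An edge that starts before a long chord and ends at or after its far end would contain
  it, contrary to nesting.\<close>

lemma barrier:
  assumes "r\<^sup>2 < chord2 a z z'" "z \<le> z'" "x < z" "z' \<le> y"
  shows "\<not> short a strict r x y"
proof
  assume s: "short a strict r x y"
  have "chord2 a z z' \<le> chord2 a x y"
    using chord2_nested[of a x z z' y] short_less4[OF s] R_half[OF s] a assms by auto
  then show False using s assms(1) by (auto simp: short_def split: if_splits)
qed

end

section \<open>Trapping orbits of dense samples between triangles\<close>

lemma dense_near: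
  assumes a: "a \<noteq> 0" and \<delta>: "0 < \<delta>"
  shows "\<exists>\<epsilon>>0. \<forall>X. X \<subseteq> ellipse a \<and> eps_dense a \<epsilon> X \<longrightarrow> (\<exists>y. ellpt a y \<in> X \<and> \<bar>y - c\<bar> \<le> \<delta>)"
proof -
  \<comment> \<open>Density is measured in the plane, while a nearby parameter is wanted. The part
    of the curve outside the window is compact and misses the point at \<open>c\<close>; half of its
    distance to that point serves as density.\<close>
  define S where "S = ellpt a ` {c + \<delta>..c - \<delta> + 1}"
  have "continuous_on {c + \<delta>..c - \<delta> + 1} (ellpt a)" unfolding ellpt_def by (intro continuous_intros)
  then have "closed S" unfolding S_def by (intro compact_imp_closed compact_continuous_image) auto
  moreover have "ellpt a c \<notin> S"
  proof
    assume "ellpt a c \<in> S"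
    then obtain y where y: "c + \<delta> \<le> y" "y \<le> c - \<delta> + 1" "ellpt a c = ellpt a y" by (auto simp: S_def)
    then obtain n :: int where "y = c + of_int n" using ellpt_eq_iff[OF a] by blast
    then have "of_int n > (0::real)" "of_int n < (1::real)" using y \<delta> by auto
    then have "0 < n" "n < 1" by (simp_all only: of_int_0_less_iff of_int_less_1_iff)
    then show False by simp
  qed
  ultimately obtain d where d: "d > 0" "\<And>s. s \<in> S \<Longrightarrow> d \<le> dist (ellpt a c) s"
    using separate_point_closed[of S "ellpt a c"] by blast
  show ?thesis
  proof (rule exI[of _ "d / 2"], intro conjI allI impI)
    fix X assume X: "X \<subseteq> ellipse a \<and> eps_dense a (d / 2) X"
    then obtain p where p: "p \<in> X" "dist (ellpt a c) p \<le> d / 2"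
      using ellpt_in_ellipse[OF a, of c] by (auto simp: eps_dense_def)
    then have "p \<notin> S" using d(1) d(2)[of p] by linarith
    obtain y0 where "p = ellpt a y0" using p X ellipse_eq_range[OF a] by blast
    define y where "y = y0 - of_int \<lfloor>y0 - (c - \<delta>)\<rfloor>"
    have y: "c - \<delta> \<le> y" "y < c - \<delta> + 1" unfolding y_def by linarith+
    have py: "p = ellpt a y" unfolding \<open>p = ellpt a y0\<close> ellpt_eq_iff[OF a] y_def
      by (intro exI[of _ "- \<lfloor>y0 - (c - \<delta>)\<rfloor>"]) simp
    have "\<not> c + \<delta> \<le> y" using \<open>p \<notin> S\<close> y py by (auto simp: S_def)
    then show "\<exists>y. ellpt a y \<in> X \<and> \<bar>y - c\<bar> \<le> \<delta>" using p(1) py y by (intro exI[of _ y]) auto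
  qed (use d in simp)
qed

lemma eps_dense_mono: "eps_dense a e X \<Longrightarrow> e \<le> e' \<Longrightarrow> eps_dense a e' X"
  unfolding eps_dense_def by (meson order_trans)

lemma chord2_near:
  assumes "c < c'" "c' < c + 1/2" "chord2 a c c' < s"
  shows "\<exists>\<delta>>0. \<forall>y y'. \<bar>y - c\<bar> \<le> \<delta> \<and> \<bar>y' - c'\<bar> \<le> \<delta> \<longrightarrow> y < y' \<and> y' < y + 1/2 \<and> chord2 a y y' < s"
proof -
  let ?U = "{z. fst z < snd z \<and> snd z < fst z + 1/2 \<and> chord2 a (fst z) (snd z) < s}"
  have "open ?U"
    unfolding chord2_def by (intro open_Collect_conj open_Collect_less continuous_intros)
  moreover have "(c, c') \<in> ?U" using assms by simp
  ultimately obtain A B where AB: "open A" "open B" "c \<in> A" "c' \<in> B" "A \<times> B \<subseteq> ?U"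
    by (auto elim!: open_prod_elim)
  obtain d1 where d1: "d1 > 0" "\<And>y. dist y c < d1 \<Longrightarrow> y \<in> A" using AB(1,3) by (auto simp: open_dist)
  obtain d2 where d2: "d2 > 0" "\<And>y. dist y c' < d2 \<Longrightarrow> y \<in> B" using AB(2,4) by (auto simp: open_dist)
  show ?thesis
  proof (intro exI[of _ "min d1 d2 / 2"] conjI allI impI)
    fix y y' assume "\<bar>y - c\<bar> \<le> min d1 d2 / 2 \<and> \<bar>y' - c'\<bar> \<le> min d1 d2 / 2"
    then have "dist y c < d1" "dist y' c' < d2" using d1(1) d2(1) by (auto simp: dist_real_def)
    then have "(y, y') \<in> ?U" using d1 d2 AB(5) by blast
    then show "y < y'" "y' < y + 1/2" "chord2 a y y' < s" by auto
  qed (use d1 d2 in simp)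
qed

text \<open>Recording the position of each orbit point allows two orbits to be told apart later. The
  arguments \<open>strict\<close> and \<open>X\<close> are explicit because one density has to serve
  all of them.\<close>

definition orbit_between :: "real \<Rightarrow> bool \<Rightarrow> real \<Rightarrow> pt set \<Rightarrow> real \<times> real \<Rightarrow> real \<times> real \<Rightarrow> real \<times> real \<Rightarrow> bool" where
  "orbit_between a strict r X I0 I1 I2 \<longleftrightarrow> (let F = cyclic_arcs.adv (ellpt a) (short a strict r) X in
     \<exists>v \<in> cyclic_arcs.lift (ellpt a) X. (F ^^ 3) v = v + 1 \<and> fst I0 < v \<and> v < snd I0 \<and>
       fst I1 < F v \<and> F v < snd I1 \<and> fst I2 < F (F v) \<and> F (F v) < snd I2)"

text \<open>The \<open>c\<close> are vertices of a triangle with short sides, the \<open>z\<close>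
  those of an interleaved one with long sides, and the \<open>w\<close> mark how far below the
  \<open>c\<close> the orbit may lie. A dense sample has points so near the \<open>c\<close> that
  they still form a cycle of edges; this cycle drives an orbit forward while the \<open>z\<close>
  hold it back.\<close>

lemma trapped_triangle:
  assumes a: "1 < a" "a\<^sup>2 \<le> 2" and r: "0 < r" "r < 2"
    and c: "c0 < c1" "c1 < c0 + 1/2" "c1 < c2" "c2 < c1 + 1/2" "c2 < c0 + 1" "c0 < c2 - 1/2"
    and src: "chord2 a c0 c1 < r\<^sup>2" "chord2 a c1 c2 < r\<^sup>2" "chord2 a c2 (c0 + 1) < r\<^sup>2"
    and wz: "w0 < c0" "c0 < z0" "w1 < c1" "c1 < z1" "w2 < c2" "c2 < z2"
    and z: "z0 \<le> z1" "z1 \<le> z2" "z2 \<le> z0 + 1" "z0 \<le> w0 + 1"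
    and bar: "r\<^sup>2 < chord2 a z0 z1" "r\<^sup>2 < chord2 a z1 z2" "r\<^sup>2 < chord2 a z2 (z0 + 1)"
  obtains \<epsilon> where "\<epsilon> > 0"
    "\<And>X strict. finite X \<Longrightarrow> X \<subseteq> ellipse a \<Longrightarrow> eps_dense a \<epsilon> X \<Longrightarrow>
      orbit_between a strict r X (w0, z0) (w1, z1) (w2, z2)"
proof -
  have a0: "a \<noteq> 0" using a by simp
  obtain d1 where d1: "d1 > 0" "\<And>y y'. \<bar>y - c0\<bar> \<le> d1 \<Longrightarrow> \<bar>y' - c1\<bar> \<le> d1 \<Longrightarrow> y < y' \<and> y' < y + 1/2 \<and> chord2 a y y' < r\<^sup>2"
    using chord2_near[OF c(1,2) src(1)] by blast
  obtain d2 where d2: "d2 > 0" "\<And>y y'. \<bar>y - c1\<bar> \<le> d2 \<Longrightarrow> \<bar>y' - c2\<bar> \<le> d2 \<Longrightarrow> y < y' \<and> y' < y + 1/2 \<and> chord2 a y y' < r\<^sup>2"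
    using chord2_near[OF c(3,4) src(2)] by blast
  obtain d3 where d3: "d3 > 0" "\<And>y y'. \<bar>y - c2\<bar> \<le> d3 \<Longrightarrow> \<bar>y' - (c0 + 1)\<bar> \<le> d3 \<Longrightarrow> y < y' \<and> y' < y + 1/2 \<and> chord2 a y y' < r\<^sup>2"
    using chord2_near[OF c(5) _ src(3)] c(6) by auto
  \<comment> \<open>The halved distances leave strict gaps, since the approximation of the
    \<open>c\<close> is only weak.\<close>
  define \<delta> where "\<delta> = Min {d1, d2, d3, (c0 - w0) / 2, (z0 - c0) / 2, (c1 - w1) / 2, (z1 - c1) / 2, (c2 - w2) / 2, (z2 - c2) / 2}"
  have \<delta>: "0 < \<delta>" unfolding \<delta>_def by (subst Min_gr_iff) (use d1(1) d2(1) d3(1) wz in auto)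
  have \<delta>_le: "\<delta> \<le> x" if "x \<in> {d1, d2, d3, (c0 - w0) / 2, (z0 - c0) / 2, (c1 - w1) / 2, (z1 - c1) / 2, (c2 - w2) / 2, (z2 - c2) / 2}" for x
    unfolding \<delta>_def using that by (intro Min_le) auto
  have gap: "\<delta> \<le> d1" "\<delta> \<le> d2" "\<delta> \<le> d3" "\<delta> < c0 - w0" "\<delta> < z0 - c0" "\<delta> < c1 - w1" "\<delta> < z1 - c1" "\<delta> < c2 - w2" "\<delta> < z2 - c2"
    using \<delta>_le[of d1] \<delta>_le[of d2] \<delta>_le[of d3] \<delta>_le[of "(c0 - w0) / 2"] \<delta>_le[of "(z0 - c0) / 2"]
      \<delta>_le[of "(c1 - w1) / 2"] \<delta>_le[of "(z1 - c1) / 2"] \<delta>_le[of "(c2 - w2) / 2"] \<delta>_le[of "(z2 - c2) / 2"] wz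
    by simp_all
  obtain e0 where e0: "e0 > 0" "\<And>X. X \<subseteq> ellipse a \<Longrightarrow> eps_dense a e0 X \<Longrightarrow> \<exists>y. ellpt a y \<in> X \<and> \<bar>y - c0\<bar> \<le> \<delta>"
    using dense_near[OF a0 \<delta>, of c0] by blast
  obtain e1 where e1: "e1 > 0" "\<And>X. X \<subseteq> ellipse a \<Longrightarrow> eps_dense a e1 X \<Longrightarrow> \<exists>y. ellpt a y \<in> X \<and> \<bar>y - c1\<bar> \<le> \<delta>"
    using dense_near[OF a0 \<delta>, of c1] by blast
  obtain e2 where e2: "e2 > 0" "\<And>X. X \<subseteq> ellipse a \<Longrightarrow> eps_dense a e2 X \<Longrightarrow> \<exists>y. ellpt a y \<in> X \<and> \<bar>y - c2\<bar> \<le> \<delta>"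
    using dense_near[OF a0 \<delta>, of c2] by blast
  show thesis
  proof (rule that[of "min e0 (min e1 e2)"])
    show "0 < min e0 (min e1 e2)" using e0 e1 e2 by simp
    fix X and strict :: bool
    assume X: "finite X" "X \<subseteq> ellipse a" "eps_dense a (min e0 (min e1 e2)) X"
    interpret ellipse_graph a r strict by unfold_locales (use a r in auto)
    obtain y0 where y0: "y0 \<in> lift X" "\<bar>y0 - c0\<bar> \<le> \<delta>" using e0(2)[OF X(2) eps_dense_mono[OF X(3)]] by (auto simp: lift_def min_le_iff_disj)
    obtain y1 where y1: "y1 \<in> lift X" "\<bar>y1 - c1\<bar> \<le> \<delta>" using e1(2)[OF X(2) eps_dense_mono[OF X(3)]] by (auto simp: lift_def min_le_iff_disj)
    obtain y2 where y2: "y2 \<in> lift X" "\<bar>y2 - c2\<bar> \<le> \<delta>" using e2(2)[OF X(2) eps_dense_mono[OF X(3)]] by (auto simp: lift_def min_le_iff_disj)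
    have cyc: "short a strict r y0 y1" "short a strict r y1 y2" "short a strict r y2 (y0 + 1)"
      using d1(2)[of y0 y1] d2(2)[of y1 y2] d3(2)[of y2 "y0 + 1"] y0(2) y1(2) y2(2) gap(1-3)
      by (auto simp: short_def)
    obtain v where v: "v \<in> lift X" "(adv X ^^ 3) v = v + 1" "y0 \<le> v" "v < z0"
      "y1 \<le> adv X v" "adv X v < z1" "y2 \<le> adv X (adv X v)" "adv X (adv X v) < z2"
    proof (rule trapped_orbit[OF X(1) y0(1) y1(1) y2(1) cyc _ z(1-3)])
      show "y0 < z0" "z0 \<le> y0 + 1" using y0(2) gap z(4) by auto
      show "\<not> short a strict r x y" if "x < z0" "z1 \<le> y" for x y using barrier[OF bar(1) z(1) that] .
      show "\<not> short a strict r x y" if "x < z1" "z2 \<le> y" for x y using barrier[OF bar(2) z(2) that] .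
      show "\<not> short a strict r x y" if "x < z2" "z0 + 1 \<le> y" for x y using barrier[OF bar(3) z(3) that] .
    qed blast
    then show "orbit_between a strict r X (w0, z0) (w1, z1) (w2, z2)"
      unfolding orbit_between_def Let_def
      using y0(2) y1(2) y2(2) gap by (intro bexI[of _ v]) auto
  qed
qed

section \<open>The inscribed equilateral triangles and the conclusion\<close>

lemma chord2_cos:
  "chord2 a x y = (1 - cos (2 * pi * (y - x))) * (2 + (a\<^sup>2 - 1) * (1 - cos (2 * pi * (x + y))))"
proof -
  have sq: "(sin (pi * z))\<^sup>2 = (1 - cos (2 * pi * z)) / 2" for z
    using cos_double_sin[of "pi * z"] by (simp add: algebra_simps)
  have "4 * ((1 - c) / 2) * (1 + b * ((1 - d) / 2)) = (1 - c) * (2 + b * (1 - d))" for b c d :: real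
    by (simp add: field_simps)
  then show ?thesis unfolding chord2_def sq .
qed

lemma chord2_half_turn: "chord2 a (x + 1/2) (y + 1/2) = chord2 a x y"
proof -
  have "2 * pi * (x + 1/2 + (y + 1/2)) = 2 * pi * (x + y) + 2 * pi" by (simp add: algebra_simps)
  then show ?thesis by (simp add: chord2_cos)
qed

theorem mainTheorem4:
  fixes a r :: real
  assumes "1 < a" and "a \<le> sqrt 2"
    and "4 * sqrt 3 * a / (a\<^sup>2 + 3) < r" and "r < 4 * sqrt 3 * a\<^sup>2 / (3 * a\<^sup>2 + 1)"
  shows "\<exists>\<epsilon> > 0. \<forall>X. finite X \<and> X \<subseteq> ellipse a \<and> eps_dense a \<epsilon> X \<longrightarrow>
           (\<forall>strict :: bool.
              winding_fraction a strict X r = 1 / 3 \<and>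
              (\<exists>v1 \<in> X. \<exists>v2 \<in> X. periodic3 (vr_dyn a strict X r) v1 \<and> periodic3 (vr_dyn a strict X r) v2 \<and>
                   v2 \<notin> orbit_of (vr_dyn a strict X r) v1) \<and>
              (\<exists>k \<ge> 1. geom_real X (vr_simplices strict X r) homotopy_equivalent_space wedge_S2 k))"
proof -
  define A where "A = a\<^sup>2"
  have A: "1 < A" "A \<le> 2"
  proof -
    show "1 < A" using assms(1) by (simp add: A_def)
    have "a\<^sup>2 \<le> (sqrt 2)\<^sup>2" using assms(1,2) by (intro power_mono) auto
    then show "A \<le> 2" by (simp add: A_def)
  qed
  have a0: "a \<noteq> 0" using assms(1) by simp
  have "0 < 4 * sqrt 3 * a / (a\<^sup>2 + 3)" using assms(1) by (simp add: add_pos_pos)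
  then have r0: "0 < r" using assms(3) by linarith
  have r1: "48 * A / (A + 3)\<^sup>2 < r\<^sup>2"
  proof -
    have "(4 * sqrt 3 * a / (a\<^sup>2 + 3))\<^sup>2 < r\<^sup>2"
      using assms(1,3) by (intro power_strict_mono) (auto simp: add_nonneg_nonneg)
    then show ?thesis by (simp add: A_def power_divide power_mult_distrib)
  qed
  have r2: "r\<^sup>2 < 48 * A\<^sup>2 / (3 * A + 1)\<^sup>2"
  proof -
    have "r\<^sup>2 < (4 * sqrt 3 * a\<^sup>2 / (3 * a\<^sup>2 + 1))\<^sup>2"
      using r0 assms(4) by (intro power_strict_mono) auto
    then show ?thesis by (simp add: A_def power_divide power_mult_distrib)
  qed
  \<comment> \<open>The squared form of r2 \<le> 2: it keeps \<open>r\<close> below the minor axis,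
    and \<open>A \<le> 2\<close> makes the last product non-negative.\<close>
  have "4 * (3 * A + 1)\<^sup>2 - 48 * A\<^sup>2 = 4 + 12 * (A * (2 - A))" by (simp add: power2_eq_square algebra_simps)
  moreover have "0 \<le> A * (2 - A)" using A by simp
  ultimately have "48 * A\<^sup>2 \<le> 4 * (3 * A + 1)\<^sup>2" by linarith
  then have "48 * A\<^sup>2 / (3 * A + 1)\<^sup>2 \<le> 4" using A by (simp add: divide_le_eq)
  then have "r\<^sup>2 < 2\<^sup>2" using r2 by simp
  then have r4: "r < 2" by (rule power_less_imp_less_base) simp
  text \<open>\<open>0, \<alpha>, 1 - \<alpha>\<close> are the vertices of the smallest inscribed equilateral triangle, \<open>-1/4, \<beta>, 1/2 - \<beta>\<close>
    those of the largest. Together with their reflections they alternate around the ellipse: the small triangles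
    are carried forward by the dynamics and the large ones are never overtaken.\<close>
  define \<tau> where "\<tau> = (A - 3) / (A + 3)"
  define \<sigma> where "\<sigma> = (3 * A - 1) / (3 * A + 1)"
  define \<alpha> where "\<alpha> = arccos \<tau> / (2 * pi)"
  define \<beta> where "\<beta> = arcsin \<sigma> / (2 * pi)"
  have \<tau>: "-1 < \<tau>" "- \<tau> < 1/2" "\<tau> < 0" using A by (simp_all add: \<tau>_def field_simps)
  have \<sigma>: "0 < \<sigma>" "\<sigma> < 1" "\<sigma> \<le> 5/7" using A by (simp_all add: \<sigma>_def field_simps)
  have cos\<alpha>: "cos (2 * pi * \<alpha>) = \<tau>" using \<tau> by (simp add: \<alpha>_def)
  have sin\<beta>: "sin (2 * pi * \<beta>) = \<sigma>" using \<sigma> by (simp add: \<beta>_def)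
  have "pi / 2 < arccos \<tau>" "arccos \<tau> < pi"
    using arccos_less_arccos[of \<tau> 0] arccos_less_arccos[of "-1" \<tau>] \<tau> by simp_all
  then have \<alpha>: "1/4 < \<alpha>" "\<alpha> < 1/2" by (simp_all add: \<alpha>_def field_simps)
  have as: "0 < arcsin \<sigma>" "arcsin \<sigma> < pi / 2"
    using arcsin_less_arcsin[of 0 \<sigma>] arcsin_less_arcsin[of \<sigma> 1] \<sigma> by simp_all
  then have \<beta>: "0 < \<beta>" "\<beta> < 1/4" by (simp_all add: \<beta>_def field_simps)
  \<comment> \<open>The interlacing of the two kinds of triangle amounts to
    \<open>- \<tau> < cos (arcsin \<sigma>)\<close>. The number 1/2 separates the two sides: the
    left one stays below it because \<open>1 < A\<close>, and \<open>\<sigma> \<le> 5/7\<close>, the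
    value at \<open>A = 2\<close>, keeps the right one above it.\<close>
  have "arccos \<tau> < pi - arcsin \<sigma>"
  proof (rule ccontr)
    assume "\<not> ?thesis"
    then have "cos (arccos \<tau>) \<le> cos (pi - arcsin \<sigma>)"
      using as \<open>arccos \<tau> < pi\<close> by (intro cos_monotone_0_pi_le) auto
    then have le: "cos (arcsin \<sigma>) < 1/2" using \<tau> by simp
    have c0: "0 < cos (arcsin \<sigma>)" using as by (intro cos_gt_zero)
    have "\<sigma>\<^sup>2 \<le> (5/7)\<^sup>2" using \<sigma> by (intro power_mono) auto
    then have "(1/2)\<^sup>2 < (cos (arcsin \<sigma>))\<^sup>2" using \<sigma> by (simp add: cos_squared_eq power_divide)
    then have "1/2 < cos (arcsin \<sigma>)" using c0 by (intro power_less_imp_less_base[of "1/2" 2]) auto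
    with le show False by simp
  qed
  then have "arccos \<tau> / (2 * pi) < (pi - arcsin \<sigma>) / (2 * pi)" by (intro divide_strict_right_mono) auto
  then have \<alpha>\<beta>: "\<alpha> < 1/2 - \<beta>" by (simp add: \<alpha>_def \<beta>_def diff_divide_distrib)
  \<comment> \<open>The value of \<open>\<tau>\<close> comes from equating this side with the next
    one: after cancelling \<open>1 - \<tau>\<close> the equation is linear.\<close>
  have s1: "chord2 a 0 \<alpha> = 48 * A / (A + 3)\<^sup>2"
  proof -
    have "chord2 a 0 \<alpha> = (1 - \<tau>) * (2 + (A - 1) * (1 - \<tau>))" by (simp add: chord2_cos cos\<alpha> A_def)
    also have "1 - \<tau> = 6 / (A + 3)" using A by (simp add: \<tau>_def field_simps)
    also have "2 + (A - 1) * (6 / (A + 3)) = 8 * A / (A + 3)" using A by (simp add: field_simps)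
    finally show ?thesis by (simp add: power2_eq_square)
  qed
  have s2: "chord2 a \<alpha> (1 - \<alpha>) = 48 * A / (A + 3)\<^sup>2"
  proof -
    have "2 * pi * (1 - \<alpha> - \<alpha>) = 2 * pi - 2 * (2 * pi * \<alpha>)" by (simp add: algebra_simps)
    then have "cos (2 * pi * (1 - \<alpha> - \<alpha>)) = 2 * \<tau>\<^sup>2 - 1"
      using cos_double_cos[of "2 * pi * \<alpha>"] by (simp add: cos_diff cos\<alpha>)
    then have "chord2 a \<alpha> (1 - \<alpha>) = 4 * ((1 - \<tau>) * (1 + \<tau>))"
      by (simp add: chord2_cos power2_eq_square algebra_simps)
    also have "1 - \<tau> = 6 / (A + 3)" using A by (simp add: \<tau>_def field_simps)
    also have "1 + \<tau> = 2 * A / (A + 3)" using A by (simp add: \<tau>_def field_simps)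
    finally show ?thesis by (simp add: power2_eq_square)
  qed
  \<comment> \<open>Likewise \<open>\<sigma>\<close> solves the linear equation left after
    cancelling \<open>1 + \<sigma>\<close> when this side is equated with the next one.\<close>
  have b1: "chord2 a \<beta> (1/2 - \<beta>) = 48 * A\<^sup>2 / (3 * A + 1)\<^sup>2"
  proof -
    have "2 * pi * (1/2 - \<beta> - \<beta>) = pi - 2 * (2 * pi * \<beta>)" by (simp add: algebra_simps)
    then have c1: "cos (2 * pi * (1/2 - \<beta> - \<beta>)) = 2 * \<sigma>\<^sup>2 - 1"
      using cos_double_sin[of "2 * pi * \<beta>"] by (simp add: cos_diff sin\<beta>)
    have c2: "cos (2 * pi * (\<beta> + (1/2 - \<beta>))) = -1" by simp
    have "chord2 a \<beta> (1/2 - \<beta>) = 4 * A * ((1 - \<sigma>) * (1 + \<sigma>))"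
      unfolding chord2_cos c1 c2 A_def by (simp add: power2_eq_square algebra_simps)
    also have "1 - \<sigma> = 2 / (3 * A + 1)" using A by (simp add: \<sigma>_def field_simps)
    also have "1 + \<sigma> = 6 * A / (3 * A + 1)" using A by (simp add: \<sigma>_def field_simps)
    finally show ?thesis by (simp add: power2_eq_square)
  qed
  have b2: "chord2 a (-1/4) \<beta> = 48 * A\<^sup>2 / (3 * A + 1)\<^sup>2"
  proof -
    have "2 * pi * (\<beta> - (-1/4)) = 2 * pi * \<beta> + pi / 2" "2 * pi * (-1/4 + \<beta>) = 2 * pi * \<beta> - pi / 2"
      by (simp_all add: algebra_simps)
    then have "chord2 a (-1/4) \<beta> = (1 + \<sigma>) * (2 + (A - 1) * (1 - \<sigma>))"
      by (simp only: chord2_cos cos_add cos_diff sin\<beta> cos_pi_half sin_pi_half A_def) simp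
    also have "1 - \<sigma> = 2 / (3 * A + 1)" using A by (simp add: \<sigma>_def field_simps)
    also have "2 + (A - 1) * (2 / (3 * A + 1)) = 8 * A / (3 * A + 1)" using A by (simp add: field_simps)
    also have "1 + \<sigma> = 6 * A / (3 * A + 1)" using A by (simp add: \<sigma>_def field_simps)
    finally show ?thesis by (simp add: power2_eq_square)
  qed
  \<comment> \<open>Two sides of each kind have been computed; reflection, half turn and full turn
    carry them to all twelve sides of the four triangles.\<close>
  have flip: "chord2 a (- \<alpha>) 0 = 48 * A / (A + 3)\<^sup>2" "chord2 a (- \<beta>) (1/4) = 48 * A\<^sup>2 / (3 * A + 1)\<^sup>2"
    using chord2_flip[of a \<alpha> 0] chord2_flip[of a \<beta> "-1/4"] s1 b2 by simp_all
  have shift: "chord2 a (x + 1) (y + 1) = chord2 a x y" for x y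
    using chord2_shift(1)[OF a0, of x 1 "y + 1"] chord2_shift(2)[OF a0, of x y 1] by simp
  have src: "chord2 a 0 \<alpha> < r\<^sup>2" "chord2 a \<alpha> (1 - \<alpha>) < r\<^sup>2" "chord2 a (1 - \<alpha>) (0 + 1) < r\<^sup>2"
     "chord2 a (1/2 - \<alpha>) (1/2) < r\<^sup>2" "chord2 a (1/2) (1/2 + \<alpha>) < r\<^sup>2"
     "chord2 a (1/2 + \<alpha>) (1/2 - \<alpha> + 1) < r\<^sup>2"
    using r1 s1 s2 flip(1) shift[of "- \<alpha>" 0] chord2_half_turn[of a "- \<alpha>" 0] chord2_half_turn[of a 0 \<alpha>]
      chord2_half_turn[of a \<alpha> "1 - \<alpha>"]
    by (simp_all add: algebra_simps)
  have bar: "r\<^sup>2 < chord2 a \<beta> (1/2 - \<beta>)" "r\<^sup>2 < chord2 a (1/2 - \<beta>) (3/4)" "r\<^sup>2 < chord2 a (3/4) (\<beta> + 1)"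
     "r\<^sup>2 < chord2 a (1/4) (1/2 + \<beta>)" "r\<^sup>2 < chord2 a (1/2 + \<beta>) (1 - \<beta>)" "r\<^sup>2 < chord2 a (1 - \<beta>) (1/4 + 1)"
    using r2 b1 b2 flip(2) chord2_half_turn[of a "- \<beta>" "1/4"] shift[of "-1/4" \<beta>] chord2_half_turn[of a "-1/4" \<beta>]
      chord2_half_turn[of a \<beta> "1/2 - \<beta>"] shift[of "- \<beta>" "1/4"]
    by (simp_all add: algebra_simps)
  have a2: "a\<^sup>2 \<le> 2" using A by (simp add: A_def)
  \<comment> \<open>The lower marks for each small triangle are vertices of the large triangle that
    holds back the other orbit. The six vertices of the large triangles thus cut the circle into six
    arcs, which the two orbits occupy alternately.\<close>
  obtain e1 where e1: "e1 > 0" "\<And>X strict. finite X \<Longrightarrow> X \<subseteq> ellipse a \<Longrightarrow> eps_dense a e1 X \<Longrightarrow>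
      orbit_between a strict r X (- \<beta>, \<beta>) (1/4, 1/2 - \<beta>) (1/2 + \<beta>, 3/4)"
  proof (rule trapped_triangle[OF assms(1) a2 r0 r4, of 0 \<alpha> "1 - \<alpha>" "- \<beta>" \<beta> "1/4" "1/2 - \<beta>" "1/2 + \<beta>" "3/4"],
      goal_cases)
    case (23 \<epsilon>)
    then show thesis by (intro that[of \<epsilon>]) blast+
  qed (use \<alpha> \<beta> \<alpha>\<beta> src bar in simp_all)
  obtain e2 where e2: "e2 > 0" "\<And>X strict. finite X \<Longrightarrow> X \<subseteq> ellipse a \<Longrightarrow> eps_dense a e2 X \<Longrightarrow>
      orbit_between a strict r X (\<beta>, 1/4) (1/2 - \<beta>, 1/2 + \<beta>) (3/4, 1 - \<beta>)"
  proof (rule trapped_triangle[OF assms(1) a2 r0 r4, of "1/2 - \<alpha>" "1/2" "1/2 + \<alpha>" \<beta> "1/4" "1/2 - \<beta>" "1/2 + \<beta>" "3/4" "1 - \<beta>"],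
      goal_cases)
    case (23 \<epsilon>)
    then show thesis by (intro that[of \<epsilon>]) blast+
  qed (use \<alpha> \<beta> \<alpha>\<beta> src bar in simp_all)
  show ?thesis
  proof (intro exI[of _ "min e1 e2"] conjI[of "0 < min e1 e2"] allI impI)
    show "0 < min e1 e2" using e1(1) e2(1) by simp
    fix X and strict :: bool
    assume X: "finite X \<and> X \<subseteq> ellipse a \<and> eps_dense a (min e1 e2) X"
    interpret ellipse_graph a r strict by unfold_locales (use assms(1) a2 r0 r4 in auto)
    have d: "eps_dense a e1 X" "eps_dense a e2 X" using X eps_dense_mono by (meson min.cobounded1 min.cobounded2)+
    obtain v where v: "v \<in> lift X" "(adv X ^^ 3) v = v + 1" "- \<beta> < v" "v < \<beta>" "1/4 < adv X v" "adv X v < 1/2 - \<beta>"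
       "1/2 + \<beta> < adv X (adv X v)" "adv X (adv X v) < 3/4"
      using e1(2)[of X strict] X d unfolding orbit_between_def Let_def fst_conv snd_conv by blast
    obtain w where w: "w \<in> lift X" "(adv X ^^ 3) w = w + 1" "\<beta> < w" "w < 1/4"
      using e2(2)[of X strict] X d unfolding orbit_between_def Let_def fst_conv snd_conv by blast
    \<comment> \<open>The point \<open>w\<close> lies between the windows of \<open>v\<close> and
      \<open>adv X v\<close>, and it differs from every point of the first orbit by less than a full
      turn, so no identification modulo 1 is possible.\<close>
    have ne: "ellpt a w \<noteq> ellpt a u" if "u \<noteq> w" "- 1 < u - w" "u - w < 1" for u
    proof
      assume "ellpt a w = ellpt a u"
      then obtain n :: int where n: "u = w + of_int n" using e_eq by blast
      then have "of_int n > (-1::real)" "of_int n < (1::real)" using that by auto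
      then have "n = 0" by linarith
      then show False using n that by simp
    qed
    have "ellpt a w \<notin> {ellpt a v, ellpt a (adv X v), ellpt a (adv X (adv X v))}"
      using ne[of v] ne[of "adv X v"] ne[of "adv X (adv X v)"] v w \<beta> by auto
    then show "winding_fraction a strict X r = 1 / 3 \<and>
              (\<exists>v1 \<in> X. \<exists>v2 \<in> X. periodic3 (vr_dyn a strict X r) v1 \<and> periodic3 (vr_dyn a strict X r) v2 \<and>
                   v2 \<notin> orbit_of (vr_dyn a strict X r) v1) \<and>
              (\<exists>k \<ge> 1. geom_real X (vr_simplices strict X r) homotopy_equivalent_space wedge_S2 k)"
      using X by (intro two_orbits_imp[OF _ _ v(1,2) w(1,2)]) auto
  qed
qed

end
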